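(* Let $X$ be a standard Borel space and let $E$ be an aperiodic, countable Borel equivalence relation on $X$. The following are equivalent: (i) The Borel Ramsey property $E\rightarrow_B (E)^n_k$ holds for some integers $n,k>1$; (ii) The Borel Ramsey property $E\rightarrow_B (E)^n_k$ holds for all integers $n,k>1$; (iii) The weak Borel Ramsey property $E\rightarrow^*_B (E)^n_k$ holds for some integers $n,k>1$; (iv) The weak Borel Ramsey property $E\rightarrow^*_B (E)^n_k$ holds for all integers $n,k>1$; (v) $E$ is smooth.
   Context: An equivalence relation $E$ on a standard Borel space $X$ is a Borel equivalence relation if $E$ is a Borel subset of $X^2$; it is countable if every $E$-class is countable, and aperiodic if every $E$-class is infinite. $[x]_E$ denotes the $E$-class of $x$. $E$ is smooth if there are a standard Borel space $Y$ and a Borel function $f:X\to Y$ such that for all $x_1,x_2\in X$, $x_1Ex_2\iff f(x_1)=f(x_2)$. For an integer $n>0$, $[X]^n$ is the set of $n$-element subsets of $X$, and $[X]^n_E=\{A\in[X]^n: \exists x\in X\ (A\subseteq [x]_E)\}$. Fixing a Borel linear ordering $<$ of $X$ and listing the elements of each $A\in[X]^n$ in $<$-increasing order identifies $[X]^n_E$ with a Borel subset of $X^n$, so it is a standard Borel space. For an integer $k>0$, a Borel $E$-coloring of dimension $n$ over $X$ by $k$ many colors is a Borel function $c:[X]^n_E\to\{1,\dots,k\}$. A set $Y\subseteq X$ is a complete section for $E$ if $Y\cap[x]_E\neq\varnothing$ for all $x\in X$; it is an infinite complete section if $Y\cap[x]_E$ is infinite for all $x\in X$. A complete section $Y$ is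 $E$-monochromatic (for $c$) if for every $x\in X$ there is $a\in\{1,\dots,k\}$ such that $c(A)=a$ for all $A\in[Y]^n$ with $A\subseteq[x]_E$ (the color $a$ may depend on the class $[x]_E$). For aperiodic countable Borel $E$, the (strong) Borel Ramsey property $E\rightarrow_B(E)^n_k$ means: for every Borel $E$-coloring $c$ of dimension $n$ over $X$ by $k$ many colors there exists a Borel $E$-monochromatic, infinite complete section $Y\subseteq X$. For countable Borel $E$, the weak Borel Ramsey property $E\rightarrow^*_B(E)^n_k$ means: for every Borel $E$-coloring $c$ of dimension $n$ over $X$ by $k$ many colors there exists a Borel $E$-monochromatic complete section. *)

theory Defs
  imports "HOL-Analysis.Analysis" "HOL-Library.Ramsey"
begin

text \<open>
  A standard Borel space is carried by a \<open>measure\<close>, of which only \<open>space\<close> and \<open>sets\<close> matter.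
\<close>

definition standard_borel :: "'a measure \<Rightarrow> bool" where
  "standard_borel X \<longleftrightarrow>
     (\<exists>T. completely_metrizable_space T \<and> second_countable T \<and>
          topspace T = space X \<and> sets X = sigma_sets (space X) {U. openin T U})"

definition borel_equiv :: "'a measure \<Rightarrow> ('a \<times> 'a) set \<Rightarrow> bool" where
  "borel_equiv X E \<longleftrightarrow> equiv (space X) E \<and> E \<in> sets (X \<Otimes>\<^sub>M X)"

definition countable_borel_equiv :: "'a measure \<Rightarrow> ('a \<times> 'a) set \<Rightarrow> bool" where
  "countable_borel_equiv X E \<longleftrightarrow> borel_equiv X E \<and> (\<forall>x\<in>space X. countable (E `` {x}))"

definition aperiodic :: "'a measure \<Rightarrow> ('a \<times> 'a) set \<Rightarrow> bool" where
  "aperiodic X E \<longleftrightarrow> (\<forall>x\<in>space X. infinite (E `` {x}))"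

text \<open>
  HOL cannot quantify over the type underlying the target \<open>Y\<close>. Taking \<open>Y\<close> over the reals loses
  nothing, see \<open>smoothI\<close> below.
\<close>

definition smooth :: "'a measure \<Rightarrow> ('a \<times> 'a) set \<Rightarrow> bool" where
  "smooth X E \<longleftrightarrow>
     (\<exists>(Y :: real measure) f. standard_borel Y \<and> f \<in> X \<rightarrow>\<^sub>M Y \<and>
        (\<forall>x\<^sub>1\<in>space X. \<forall>x\<^sub>2\<in>space X. (x\<^sub>1, x\<^sub>2) \<in> E \<longleftrightarrow> f x\<^sub>1 = f x\<^sub>2))"

lemma standard_borel_real: "standard_borel (borel :: real measure)"
  unfolding standard_borel_def
proof (intro exI conjI)
  show "completely_metrizable_space (euclidean :: real topology)"
    by (rule completely_metrizable_space_euclidean)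
  obtain \<B> :: "real set set" where B: "countable \<B>" "topological_basis \<B>"
    using ex_countable_basis by blast
  show "second_countable (euclidean :: real topology)"
    unfolding second_countable_def open_openin[symmetric]
  proof (intro exI[of _ \<B>] conjI ballI allI impI)
    fix U and x :: real assume "open U \<and> x \<in> U"
    then show "\<exists>V\<in>\<B>. x \<in> V \<and> V \<subseteq> U"
      using topological_basisE[OF B(2)] by metis
  qed (use B topological_basis_open in auto)
qed (auto simp: borel_def)

lemma standard_borel_separating:
  assumes "standard_borel X"
  obtains U :: "nat \<Rightarrow> 'a set" where "\<And>n. U n \<in> sets X"
    "\<And>x y. x \<in> space X \<Longrightarrow> y \<in> space X \<Longrightarrow> x \<noteq> y \<Longrightarrow> \<exists>n. x \<in> U n \<longleftrightarrow> y \<notin> U n"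
proof -
  obtain T where T: "completely_metrizable_space T" "second_countable T"
      "topspace T = space X" "sets X = sigma_sets (space X) {U. openin T U}"
    using assms unfolding standard_borel_def by auto
  obtain \<B> where B: "countable \<B>" "\<forall>V\<in>\<B>. openin T V"
      "\<forall>U x. openin T U \<and> x \<in> U \<longrightarrow> (\<exists>V\<in>\<B>. x \<in> V \<and> V \<subseteq> U)"
    using T(2) unfolding second_countable_def by auto
  have haus: "Hausdorff_space T"
    by (simp add: T(1) completely_metrizable_imp_metrizable_space metrizable_imp_Hausdorff_space)
  define U where "U = from_nat_into (insert {} \<B>)"
  have rng: "range U = insert {} \<B>"
    unfolding U_def using B(1) by (intro range_from_nat_into) auto
  show thesis
  proof
    fix n show "U n \<in> sets X"
      using rng B(2) T(4) by (metis (mono_tags, lifting) insertE mem_Collect_eq openin_empty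
          rangeI sigma_sets.Basic)
  next
    fix x y assume "x \<in> space X" "y \<in> space X" "x \<noteq> y"
    then obtain V W where "openin T V" "x \<in> V" "openin T W" "y \<in> W" "disjnt V W"
      using haus T(3) unfolding Hausdorff_space_def by metis
    then obtain C where "C \<in> \<B>" "x \<in> C" "y \<notin> C"
      using B(3) by (metis disjnt_iff subsetD)
    then show "\<exists>n. x \<in> U n \<longleftrightarrow> y \<notin> U n"
      using rng by (metis insertI2 imageE)
  qed
qed

lemma standard_borel_inj_real:
  assumes "standard_borel X"
  obtains f :: "'a \<Rightarrow> real" where "f \<in> borel_measurable X" "inj_on f (space X)"
proof -
  obtain U :: "nat \<Rightarrow> 'a set" where U: "\<And>n. U n \<in> sets X"
    "\<And>x y. x \<in> space X \<Longrightarrow> y \<in> space X \<Longrightarrow> x \<noteq> y \<Longrightarrow> \<exists>n. x \<in> U n \<longleftrightarrow> y \<notin> U n"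
    by (rule standard_borel_separating[OF assms]) blast
  define t where "t = (\<lambda>x n. indicator (U n) x * (1/3::real) ^ n)"
  define f where "f = (\<lambda>x. \<Sum>n. t x n)"
  have geo: "summable (\<lambda>n. (1/3::real) ^ n)" by (rule summable_geometric) simp
  have sm: "summable (t x)" for x
    by (rule summable_comparison_test'[OF geo, of 0]) (auto simp: t_def indicator_def)
  have gt: "f y < f x" if "x \<in> U n" "y \<notin> U n" "\<And>m. m < n \<Longrightarrow> x \<in> U m \<longleftrightarrow> y \<in> U m" for x y n
  proof -
    have init: "(\<Sum>i<n. t x i) = (\<Sum>i<n. t y i)"
      using that(3) by (intro sum.cong) (auto simp: t_def indicator_def)
    have x: "f x = (\<Sum>i. t x (i + Suc n)) + (1/3)^n + (\<Sum>i<n. t x i)"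
      unfolding f_def using suminf_split_initial_segment[OF sm, of x "Suc n"] that(1)
      by (simp add: t_def)
    have y: "f y = (\<Sum>i. t y (i + Suc n)) + (\<Sum>i<n. t y i)"
      unfolding f_def using suminf_split_initial_segment[OF sm, of y "Suc n"] that(2)
      by (simp add: t_def)
    have "(\<Sum>i. t x (i + Suc n)) \<ge> 0"
      by (rule suminf_nonneg[OF summable_ignore_initial_segment[OF sm]]) (simp add: t_def)
    moreover have "(\<Sum>i. t y (i + Suc n)) \<le> (\<Sum>i. (1/3)^(i + Suc n))"
      by (rule suminf_le[OF _ summable_ignore_initial_segment[OF sm]
            summable_ignore_initial_segment[OF geo]]) (simp add: t_def indicator_def)
    moreover have "(\<Sum>i. (1/3::real)^(i + Suc n)) = (1/2) * (1/3)^n"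
    proof -
      have "(\<Sum>i. (1/3::real)^(i + Suc n)) = (\<Sum>i. (1/3)^Suc n * (1/3)^i)"
        by (simp add: power_add mult.commute)
      also have "\<dots> = (1/3)^Suc n * (\<Sum>i. (1/3)^i)" by (rule suminf_mult[OF geo])
      also have "(\<Sum>i. (1/3::real)^i) = 3/2" by (subst suminf_geometric) auto
      finally show ?thesis by simp
    qed
    moreover have "(1/3::real)^n > 0" by simp
    ultimately show ?thesis using x y init by linarith
  qed
  show thesis
  proof
    show "f \<in> borel_measurable X"
      unfolding f_def t_def using U(1) by measurable
    show "inj_on f (space X)"
    proof (rule inj_onI, rule ccontr)
      fix x y assume xy: "x \<in> space X" "y \<in> space X" "f x = f y" "x \<noteq> y"
      define n where "n = (LEAST n. x \<in> U n \<longleftrightarrow> y \<notin> U n)"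
      have n: "x \<in> U n \<longleftrightarrow> y \<notin> U n"
        unfolding n_def by (rule LeastI_ex) (rule U(2)[OF xy(1,2,4)])
      have m: "x \<in> U m \<longleftrightarrow> y \<in> U m" if "m < n" for m
        using not_less_Least[of m "\<lambda>n. x \<in> U n \<longleftrightarrow> y \<notin> U n"] that unfolding n_def by blast
      show False
        using gt[of x n y] gt[of y n x] n m xy(3) by (metis less_irrefl)
    qed
  qed
qed

lemma smoothI:
  fixes Y :: "'b measure"
  assumes "standard_borel Y" "f \<in> X \<rightarrow>\<^sub>M Y"
    and E: "\<And>x\<^sub>1 x\<^sub>2. x\<^sub>1 \<in> space X \<Longrightarrow> x\<^sub>2 \<in> space X \<Longrightarrow> (x\<^sub>1, x\<^sub>2) \<in> E \<longleftrightarrow> f x\<^sub>1 = f x\<^sub>2"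
  shows "smooth X E"
proof -
  obtain g :: "'b \<Rightarrow> real" where g: "g \<in> borel_measurable Y" "inj_on g (space Y)"
    by (rule standard_borel_inj_real[OF assms(1)])
  have "g (f x\<^sub>1) = g (f x\<^sub>2) \<longleftrightarrow> f x\<^sub>1 = f x\<^sub>2" if "x\<^sub>1 \<in> space X" "x\<^sub>2 \<in> space X" for x\<^sub>1 x\<^sub>2
    using inj_on_eq_iff[OF g(2)] measurable_space[OF assms(2)] that by metis
  then have "\<forall>x\<^sub>1\<in>space X. \<forall>x\<^sub>2\<in>space X. (x\<^sub>1, x\<^sub>2) \<in> E \<longleftrightarrow> (g \<circ> f) x\<^sub>1 = (g \<circ> f) x\<^sub>2"
    by (simp add: E)
  then show ?thesis
    unfolding smooth_def using standard_borel_real measurable_comp[OF assms(2) g(1)] by blast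
qed

definition borel_linear_order :: "'a measure \<Rightarrow> ('a \<times> 'a) set \<Rightarrow> bool" where
  "borel_linear_order X R \<longleftrightarrow> linear_order_on (space X) R \<and> R \<in> sets (X \<Otimes>\<^sub>M X)"

lemma ex_borel_linear_order:
  assumes "standard_borel X"
  shows "\<exists>R. borel_linear_order X R"
proof -
  obtain f :: "'a \<Rightarrow> real" where f: "f \<in> borel_measurable X" "inj_on f (space X)"
    by (rule standard_borel_inj_real[OF assms])
  define R where "R = {p \<in> space (X \<Otimes>\<^sub>M X). f (fst p) \<le> f (snd p)}"
  have "R \<in> sets (X \<Otimes>\<^sub>M X)"
    unfolding R_def using f(1) by measurable
  moreover have "linear_order_on (space X) R"
    using f(2) unfolding R_def order_on_defs
    by (auto simp: space_pair_measure refl_on_def trans_def antisym_def total_on_def inj_on_def)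
  ultimately show ?thesis
    unfolding borel_linear_order_def by blast
qed

text \<open>
  The fixed Borel linear ordering of \<open>X\<close>; the relation is reflexive, the strict ordering \<open><\<close> is its
  irreflexive part.
\<close>

definition the_order :: "'a measure \<Rightarrow> ('a \<times> 'a) set" where
  "the_order X = (SOME R. borel_linear_order X R)"

lemma borel_linear_order_the_order:
  "standard_borel X \<Longrightarrow> borel_linear_order X (the_order X)"
  unfolding the_order_def by (rule someI_ex[OF ex_borel_linear_order])

definition increasing_list :: "'a measure \<Rightarrow> 'a set \<Rightarrow> 'a list" where
  "increasing_list X A =
     (THE xs. set xs = A \<and> sorted_wrt (\<lambda>x y. (x, y) \<in> the_order X \<and> x \<noteq> y) xs)"

lemma increasing_list_ex1:
  assumes "standard_borel X" "finite A" "A \<subseteq> space X"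
  shows "\<exists>!xs. set xs = A \<and> sorted_wrt (\<lambda>x y. (x, y) \<in> the_order X \<and> x \<noteq> y) xs"
proof -
  define lt where "lt = (\<lambda>x y. (x, y) \<in> the_order X \<and> x \<noteq> y)"
  have lin: "linear_order_on (space X) (the_order X)"
    using borel_linear_order_the_order[OF assms(1)] unfolding borel_linear_order_def by blast
  have tr: "lt x z" if "lt x y" "lt y z" for x y z
    using lin that unfolding lt_def order_on_defs by (metis antisymD transD)
  have tot: "lt x y \<or> lt y x" if "x \<in> space X" "y \<in> space X" "x \<noteq> y" for x y
    using lin that unfolding lt_def order_on_defs by (metis total_on_def)
  have asym: "\<not> lt y x" if "lt x y" for x y
    using lin that unfolding lt_def order_on_defs by (metis antisymD)
  have ex: "\<exists>m\<in>A. \<forall>y\<in>A - {m}. lt m y" if "finite A" "A \<noteq> {}" "A \<subseteq> space X" for A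
    using that
  proof (induction A rule: finite_ne_induct)
    case (insert x F)
    then obtain m where m: "m \<in> F" "\<forall>y\<in>F - {m}. lt m y" by auto
    show ?case
    proof (cases "lt x m")
      case True
      then have "\<forall>y\<in>insert x F - {x}. lt x y" using m tr by blast
      then show ?thesis by blast
    next
      case False
      then have "\<forall>y\<in>insert x F - {m}. lt m y" using m tot insert by blast
      then show ?thesis using m by blast
    qed
  qed auto
  have "\<exists>!xs. set xs = A \<and> sorted_wrt lt xs"
    using assms(2,3)
  proof (induction "card A" arbitrary: A)
    case 0
    then show ?case by (intro ex1I[of _ "[]"]) auto
  next
    case (Suc n)
    then obtain m where m: "m \<in> A" "\<forall>y\<in>A - {m}. lt m y"
      using ex[of A] by force
    have "\<exists>!xs. set xs = A - {m} \<and> sorted_wrt lt xs"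
    proof (rule Suc.hyps(1))
      show "n = card (A - {m})" using Suc.hyps(2) m(1) by simp
    qed (use Suc.prems in auto)
    then obtain xs where xs: "set xs = A - {m} \<and> sorted_wrt lt xs"
      "\<forall>ys. set ys = A - {m} \<and> sorted_wrt lt ys \<longrightarrow> ys = xs" by (rule ex1E)
    show ?case
    proof (rule ex1I[of _ "m # xs"])
      show "set (m # xs) = A \<and> sorted_wrt lt (m # xs)"
        using xs(1) m by auto
    next
      fix ys assume ys: "set ys = A \<and> sorted_wrt lt ys"
      then obtain z zs where z: "ys = z # zs" using m by (cases ys) auto
      have zm: "z = m"
      proof (rule ccontr)
        assume "z \<noteq> m"
        then have "lt z m" "lt m z" using ys z m by auto
        then show False using asym by blast
      qed
      then have "m \<notin> set zs" using ys z asym by auto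
      then have "set zs = A - {m}" using ys z zm by auto
      then show "ys = m # xs" using xs(2) ys z zm by simp
    qed
  qed
  then show ?thesis unfolding lt_def .
qed

definition class_subsets :: "'a measure \<Rightarrow> ('a \<times> 'a) set \<Rightarrow> nat \<Rightarrow> 'a set set" where
  "class_subsets X E n = {A \<in> nsets (space X) n. \<exists>x\<in>space X. A \<subseteq> E `` {x}}"

text \<open>
  The measurable space \<open>[X]\<^sup>n\<^sub>E\<close>: the \<open>\<sigma>\<close>-algebra is pulled back from \<open>X\<^sup>n\<close> along the injection that
  lists a set in increasing order. Points of \<open>X\<^sup>n\<close> are functions on \<open>{..<n}\<close>.
\<close>

definition class_subsets_space :: "'a measure \<Rightarrow> ('a \<times> 'a) set \<Rightarrow> nat \<Rightarrow> 'a set measure" where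
  "class_subsets_space X E n =
     vimage_algebra (class_subsets X E n)
       (\<lambda>A. \<lambda>i\<in>{..<n}. increasing_list X A ! i) (\<Pi>\<^sub>M i\<in>{..<n}. X)"

definition borel_coloring :: "'a measure \<Rightarrow> ('a \<times> 'a) set \<Rightarrow> nat \<Rightarrow> nat \<Rightarrow> ('a set \<Rightarrow> nat) \<Rightarrow> bool" where
  "borel_coloring X E n k c \<longleftrightarrow> c \<in> class_subsets_space X E n \<rightarrow>\<^sub>M count_space {1..k}"

definition complete_section :: "'a measure \<Rightarrow> ('a \<times> 'a) set \<Rightarrow> 'a set \<Rightarrow> bool" where
  "complete_section X E Y \<longleftrightarrow> Y \<subseteq> space X \<and> (\<forall>x\<in>space X. Y \<inter> E `` {x} \<noteq> {})"

definition infinite_complete_section :: "'a measure \<Rightarrow> ('a \<times> 'a) set \<Rightarrow> 'a set \<Rightarrow> bool" where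
  "infinite_complete_section X E Y \<longleftrightarrow> Y \<subseteq> space X \<and> (\<forall>x\<in>space X. infinite (Y \<inter> E `` {x}))"

definition monochromatic ::
    "'a measure \<Rightarrow> ('a \<times> 'a) set \<Rightarrow> nat \<Rightarrow> nat \<Rightarrow> ('a set \<Rightarrow> nat) \<Rightarrow> 'a set \<Rightarrow> bool" where
  "monochromatic X E n k c Y \<longleftrightarrow>
     (\<forall>x\<in>space X. \<exists>a\<in>{1..k}. \<forall>A\<in>nsets Y n. A \<subseteq> E `` {x} \<longrightarrow> c A = a)"

definition borel_ramsey :: "'a measure \<Rightarrow> ('a \<times> 'a) set \<Rightarrow> nat \<Rightarrow> nat \<Rightarrow> bool" where
  "borel_ramsey X E n k \<longleftrightarrow>
     (\<forall>c. borel_coloring X E n k c \<longrightarrow>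
        (\<exists>Y\<in>sets X. infinite_complete_section X E Y \<and> monochromatic X E n k c Y))"

definition weak_borel_ramsey :: "'a measure \<Rightarrow> ('a \<times> 'a) set \<Rightarrow> nat \<Rightarrow> nat \<Rightarrow> bool" where
  "weak_borel_ramsey X E n k \<longleftrightarrow>
     (\<forall>c. borel_coloring X E n k c \<longrightarrow>
        (\<exists>Y\<in>sets X. complete_section X E Y \<and> monochromatic X E n k c Y))"

end

(*
  Smooth implies strong Ramsey: a countable Borel equivalence relation has countably many Borel
  involutions generating it (Feldman--Moore), a smooth one also has a Borel selector s, so the class
  of x is enumerated in a Borel way that depends on s x only. Ramsey's theorem for n-sets of naturals
  can be carried out measurably in a parameter, and is applied to the induced colorings.

  Weak Ramsey implies smooth: refine the topology so that the involutions become homeomorphisms of a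
  zero-dimensional Polish space with a countable clopen base. If every point is isolated in its
  orbit, choosing the first basic set that meets an orbit in one point gives a Borel selector.
  Otherwise let P be the closure of an orbit without isolated points, and color a finite set by
  whether the index of the first basic set splitting it lies in L, where L is chosen such that both
  colors occur densely in every nonempty open subset of P. A Borel complete section S is comeager in
  some open subset U of P, so a generic orbit is dense in P and its part in U is contained in S;
  hence S is not monochromatic.
*)
theory Submission
  imports Defs
begin

text \<open>One coloring serves for all sizes above 1, because the first basic set that splits a
  finite set makes sense for any such size. The coloring is fixed before the section is known, yet
  both colors must occur inside an open set that depends on the section. Hence \<open>L\<close>
  bisects countably many infinite sets of indices simultaneously, one for each basic open set
  meeting the orbit. Topologies are kept as countable sets of clauses, since refinements, countable
  joins and products then become operations on clauses, and completeness becomes a single statement: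
  decreasing nonempty sets that decide all basic sets and satisfy all clauses converge. Luzin
  separation, the Lusin-Novikov decomposition and the Baire category theorem are three applications
  of it. In the smooth direction the danger is that choosing a homogeneous set separately in each
  class destroys Borelness. So each class is enumerated from its selected point, and the choices in
  the proof of Ramsey's theorem are either least numbers or made once for all parameters.\<close>

section \<open>Codings of standard Borel spaces\<close>

text \<open>A literal is a pair \<open>(B, b)\<close>, true at \<open>z\<close> iff \<open>(z \<in> B) = b\<close>; a clause is the disjunction of its
  literals. That every valuation satisfying the clauses is realised by a point says that \<open>Z\<close> is a
  \<open>G\<^sub>\<delta>\<close> subset of the Cantor space over \<open>\<U>\<close>, so a coding is a zero-dimensional Polish topology in
  which the members of \<open>\<U>\<close> are clopen.\<close>

definition coding :: "'a measure \<Rightarrow> 'a set set \<Rightarrow> ('a set \<times> bool) set set \<Rightarrow> bool" where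
  "coding Z \<U> \<Q> \<longleftrightarrow>
     countable \<U> \<and> \<U> \<subseteq> sets Z \<and> countable \<Q> \<and> (\<forall>C\<in>\<Q>. C \<subseteq> \<U> \<times> UNIV) \<and>
     (\<forall>z\<in>space Z. \<forall>C\<in>\<Q>. \<exists>l\<in>C. (z \<in> fst l) = snd l) \<and>
     (\<forall>v. (\<forall>C\<in>\<Q>. \<exists>l\<in>C. v (fst l) = snd l) \<longrightarrow> (\<exists>z\<in>space Z. \<forall>B\<in>\<U>. v B = (z \<in> B))) \<and>
     (\<forall>z\<in>space Z. \<forall>w\<in>space Z. (\<forall>B\<in>\<U>. z \<in> B \<longleftrightarrow> w \<in> B) \<longrightarrow> z = w)"

lemma codingD:
  assumes "coding Z \<U> \<Q>"
  shows "countable \<U>" "\<U> \<subseteq> sets Z" "countable \<Q>" "\<And>C. C \<in> \<Q> \<Longrightarrow> C \<subseteq> \<U> \<times> UNIV"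
    "\<And>z C. z \<in> space Z \<Longrightarrow> C \<in> \<Q> \<Longrightarrow> \<exists>l\<in>C. (z \<in> fst l) = snd l"
    "\<And>v. (\<And>C. C \<in> \<Q> \<Longrightarrow> \<exists>l\<in>C. v (fst l) = snd l) \<Longrightarrow> \<exists>z\<in>space Z. \<forall>B\<in>\<U>. v B = (z \<in> B)"
    "\<And>z w. z \<in> space Z \<Longrightarrow> w \<in> space Z \<Longrightarrow> (\<And>B. B \<in> \<U> \<Longrightarrow> z \<in> B \<longleftrightarrow> w \<in> B) \<Longrightarrow> z = w"
  using assms unfolding coding_def by simp_all

lemma codingI:
  assumes "countable \<U>" "\<U> \<subseteq> sets Z" "countable \<Q>" "\<And>C. C \<in> \<Q> \<Longrightarrow> C \<subseteq> \<U> \<times> UNIV"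
    "\<And>z C. z \<in> space Z \<Longrightarrow> C \<in> \<Q> \<Longrightarrow> \<exists>l\<in>C. (z \<in> fst l) = snd l"
    "\<And>v. (\<And>C. C \<in> \<Q> \<Longrightarrow> \<exists>l\<in>C. v (fst l) = snd l) \<Longrightarrow> \<exists>z\<in>space Z. \<forall>B\<in>\<U>. v B = (z \<in> B)"
    "\<And>z w. z \<in> space Z \<Longrightarrow> w \<in> space Z \<Longrightarrow> (\<And>B. B \<in> \<U> \<Longrightarrow> z \<in> B \<longleftrightarrow> w \<in> B) \<Longrightarrow> z = w"
  shows "coding Z \<U> \<Q>"
  unfolding coding_def using assms by (intro conjI ballI allI impI) simp_all

text \<open>Each index yields a point realising the valuation on its own family. These points agree
  on \<open>\<U>\<^sub>0\<close>, which separates points, so they coincide. Topologically this is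
  the join of countably many Polish topologies above a common Hausdorff one.\<close>

lemma coding_UN:
  assumes "countable I" "I \<noteq> {}" and cod: "\<And>i. i \<in> I \<Longrightarrow> coding Z (\<U> i) (\<Q> i)"
    and base: "\<And>i. i \<in> I \<Longrightarrow> \<U>\<^sub>0 \<subseteq> \<U> i" "coding Z \<U>\<^sub>0 \<Q>\<^sub>0"
  shows "coding Z (\<Union>i\<in>I. \<U> i) (\<Union>i\<in>I. \<Q> i)"
proof (rule codingI)
  fix v assume v: "\<And>C. C \<in> (\<Union>i\<in>I. \<Q> i) \<Longrightarrow> \<exists>l\<in>C. v (fst l) = snd l"
  have "\<exists>z\<in>space Z. \<forall>B\<in>\<U> i. v B = (z \<in> B)" if "i \<in> I" for i
    by (rule codingD(6)[OF cod[OF that]]) (use v that in blast)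
  then obtain z where z: "\<And>i. i \<in> I \<Longrightarrow> z i \<in> space Z" "\<And>i B. i \<in> I \<Longrightarrow> B \<in> \<U> i \<Longrightarrow> v B = (z i \<in> B)"
    by metis
  obtain i where i: "i \<in> I" using assms(2) by blast
  have "z j = z i" if j: "j \<in> I" for j
  proof (rule codingD(7)[OF base(2) z(1)[OF j] z(1)[OF i]])
    fix B assume "B \<in> \<U>\<^sub>0"
    then show "z j \<in> B \<longleftrightarrow> z i \<in> B"
      using z(2)[OF j, of B] z(2)[OF i, of B] base(1)[OF i] base(1)[OF j] by (meson subsetD)
  qed
  then show "\<exists>z\<in>space Z. \<forall>B\<in>(\<Union>i\<in>I. \<U> i). v B = (z \<in> B)"
    using z i by (metis UN_E)
next
  obtain i where i: "i \<in> I" using assms(2) by blast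
  fix z w assume *: "z \<in> space Z" "w \<in> space Z" "\<And>B. B \<in> (\<Union>i\<in>I. \<U> i) \<Longrightarrow> z \<in> B \<longleftrightarrow> w \<in> B"
  show "z = w"
    by (rule codingD(7)[OF base(2) *(1,2)], rule *(3), rule UN_I[OF i]) (rule subsetD[OF base(1)[OF i]])
next
  fix z C assume z: "z \<in> space Z" and "C \<in> (\<Union>i\<in>I. \<Q> i)"
  then obtain i where "i \<in> I" "C \<in> \<Q> i" by blast
  then show "\<exists>l\<in>C. (z \<in> fst l) = snd l" using codingD(5)[OF cod z] by simp
next
  show "countable (\<Union>i\<in>I. \<U> i)" by (rule countable_UN[OF assms(1) codingD(1)[OF cod]])
  show "countable (\<Union>i\<in>I. \<Q> i)" by (rule countable_UN[OF assms(1) codingD(3)[OF cod]])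
  show "(\<Union>i\<in>I. \<U> i) \<subseteq> sets Z" by (rule UN_least[OF codingD(2)[OF cod]])
  fix C assume "C \<in> (\<Union>i\<in>I. \<Q> i)"
  then obtain i where i: "i \<in> I" "C \<in> \<Q> i" by blast
  then have "C \<subseteq> \<U> i \<times> UNIV" by (intro codingD(4)[OF cod])
  then show "C \<subseteq> (\<Union>i\<in>I. \<U> i) \<times> UNIV" using i(1) by blast
qed

text \<open>A set defined as a countable union of literals is pinned down by the clauses that spell out
  its definition, so it may be added to a coding.\<close>

lemma coding_insert:
  assumes cod: "coding Z \<U> \<Q>" and L: "L \<subseteq> \<U> \<times> UNIV" and A: "A \<in> sets Z"
    "\<And>z. z \<in> space Z \<Longrightarrow> z \<in> A \<longleftrightarrow> (\<exists>l\<in>L. (z \<in> fst l) = snd l)"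
  shows "\<exists>\<Q>'. coding Z (insert A \<U>) \<Q>'"
proof -
  define \<Q>' where "\<Q>' = insert (insert (A, False) L) ((\<lambda>l. {(fst l, \<not> snd l), (A, True)}) ` L) \<union> \<Q>"
  have cL: "countable L"
    by (rule countable_subset[OF L]) (use codingD(1)[OF cod] in auto)
  have "coding Z (insert A \<U>) \<Q>'"
  proof (rule codingI)
    fix v assume v: "\<And>C. C \<in> \<Q>' \<Longrightarrow> \<exists>l\<in>C. v (fst l) = snd l"
    obtain z where z: "z \<in> space Z" "\<And>B. B \<in> \<U> \<Longrightarrow> v B = (z \<in> B)"
      using codingD(6)[OF cod, of v] v unfolding \<Q>'_def by (meson UnI2)
    have "v A = (\<exists>l\<in>L. v (fst l) = snd l)"
    proof
      assume "v A"
      then show "\<exists>l\<in>L. v (fst l) = snd l"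
        using v[of "insert (A, False) L"] unfolding \<Q>'_def by auto
    next
      assume "\<exists>l\<in>L. v (fst l) = snd l"
      then obtain l where l: "l \<in> L" "v (fst l) = snd l" by blast
      then have "\<exists>l'\<in>{(fst l, \<not> snd l), (A, True)}. v (fst l') = snd l'"
        by (intro v) (auto simp: \<Q>'_def)
      then show "v A" using l by auto
    qed
    also have "\<dots> = (\<exists>l\<in>L. (z \<in> fst l) = snd l)"
      using z(2) L by (metis SigmaE fst_conv subsetD)
    finally show "\<exists>z\<in>space Z. \<forall>B\<in>insert A \<U>. v B = (z \<in> B)"
      using z A(2) by auto
  next
    fix z C assume "z \<in> space Z" "C \<in> \<Q>'"
    then consider "C = insert (A, False) L" | l where "l \<in> L" "C = {(fst l, \<not> snd l), (A, True)}" | "C \<in> \<Q>"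
      unfolding \<Q>'_def by blast
    then show "\<exists>l\<in>C. (z \<in> fst l) = snd l"
      by cases (use A(2)[OF \<open>z \<in> space Z\<close>] codingD(5)[OF cod \<open>z \<in> space Z\<close>] in auto)
  next
    fix z w assume *: "z \<in> space Z" "w \<in> space Z" "\<And>B. B \<in> insert A \<U> \<Longrightarrow> z \<in> B \<longleftrightarrow> w \<in> B"
    show "z = w" by (rule codingD(7)[OF cod *(1,2)], rule *(3)) (rule insertI2)
  next
    show "countable (insert A \<U>)" "insert A \<U> \<subseteq> sets Z" using codingD(1,2)[OF cod] A(1) by auto
    show "countable \<Q>'" using cL codingD(3)[OF cod] by (simp add: \<Q>'_def)
    fix C assume "C \<in> \<Q>'"
    then consider "C = insert (A, False) L" | l where "l \<in> L" "C = {(fst l, \<not> snd l), (A, True)}" | "C \<in> \<Q>"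
      unfolding \<Q>'_def by blast
    then show "C \<subseteq> insert A \<U> \<times> UNIV"
    proof cases
      case 3
      then show ?thesis using codingD(4)[OF cod, of C] by blast
    qed (use L in auto)
  qed
  then show ?thesis ..
qed

text \<open>The refinement theorem for Polish topologies, phrased as a property of the measurable
  space: any countably many Borel sets can be made clopen at the same time.\<close>

definition coded :: "'a measure \<Rightarrow> bool" where
  "coded Z \<longleftrightarrow> (\<forall>\<F>. countable \<F> \<longrightarrow> \<F> \<subseteq> sets Z \<longrightarrow> (\<exists>\<U> \<Q>. \<F> \<subseteq> \<U> \<and> coding Z \<U> \<Q>))"

lemma codedD:
  assumes "coded Z" "countable \<F>" "\<F> \<subseteq> sets Z"
  obtains \<U> \<Q> where "\<F> \<subseteq> \<U>" "coding Z \<U> \<Q>"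
  using assms(1)[unfolded coded_def, rule_format, OF assms(2,3)] by (elim exE conjE)

text \<open>Induction over the generated sigma-algebra. A complement is one negative literal and a
  countable union is a family of positive ones, so \<open>coding_insert\<close> adds both. Every
  coding built on the way extends \<open>\<U>\<^sub>0\<close>, which is what
  \<open>coding_UN\<close> requires when countably many are merged.\<close>

lemma codedI:
  assumes base: "coding Z \<U>\<^sub>0 \<Q>\<^sub>0" and gen: "sets Z = sigma_sets (space Z) \<G>"
    and G: "\<And>G. G \<in> \<G> \<Longrightarrow> \<exists>\<U> \<Q>. \<U>\<^sub>0 \<subseteq> \<U> \<and> G \<in> \<U> \<and> coding Z \<U> \<Q>"
  shows "coded Z"
proof -
  have one: "\<exists>\<U> \<Q>. \<U>\<^sub>0 \<subseteq> \<U> \<and> B \<in> \<U> \<and> coding Z \<U> \<Q>" if "B \<in> sigma_sets (space Z) \<G>" for B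
    using that
  proof induction
    case (Basic a)
    then show ?case by (rule G)
  next
    case Empty
    obtain \<Q>' where "coding Z (insert {} \<U>\<^sub>0) \<Q>'"
      using coding_insert[OF base, of "{}" "{}"] by auto
    then show ?case by (intro exI[of _ "insert {} \<U>\<^sub>0"] exI[of _ \<Q>']) auto
  next
    case (Compl a)
    then obtain \<U> \<Q> where u: "\<U>\<^sub>0 \<subseteq> \<U>" "a \<in> \<U>" "coding Z \<U> \<Q>" by blast
    obtain \<Q>' where "coding Z (insert (space Z - a) \<U>) \<Q>'"
      using coding_insert[OF u(3), of "{(a, False)}" "space Z - a"] u codingD(2)[OF u(3)] by auto
    then show ?case using u(1) by (intro exI[of _ "insert (space Z - a) \<U>"] exI[of _ \<Q>']) auto
  next
    case (Union a)
    from Union.IH have "\<forall>i. \<exists>\<U> \<Q>. \<U>\<^sub>0 \<subseteq> \<U> \<and> a i \<in> \<U> \<and> coding Z \<U> \<Q>" ..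
    from choice[OF this] obtain \<U> where
      "\<forall>i. \<exists>\<Q>. \<U>\<^sub>0 \<subseteq> \<U> i \<and> a i \<in> \<U> i \<and> coding Z (\<U> i) \<Q>" ..
    from choice[OF this] obtain \<Q> where
      "\<forall>i. \<U>\<^sub>0 \<subseteq> \<U> i \<and> a i \<in> \<U> i \<and> coding Z (\<U> i) (\<Q> i)" ..
    then have u: "\<And>i. \<U>\<^sub>0 \<subseteq> \<U> i" "\<And>i. a i \<in> \<U> i" "\<And>i. coding Z (\<U> i) (\<Q> i)" by auto
    have c: "coding Z (\<Union>i\<in>UNIV. \<U> i) (\<Union>i\<in>UNIV. \<Q> i)"
      by (rule coding_UN[OF _ _ u(3) u(1) base]) auto
    have "a i \<in> sets Z" for i using u(2) codingD(2)[OF u(3)] by blast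
    then have "\<exists>\<Q>'. coding Z (insert (\<Union>i. a i) (\<Union>i\<in>UNIV. \<U> i)) \<Q>'"
      by (intro coding_insert[OF c, of "(\<lambda>i. (a i, True)) ` UNIV"]) (use u(2) in auto)
    then obtain \<Q>' where "coding Z (insert (\<Union>i. a i) (\<Union>i\<in>UNIV. \<U> i)) \<Q>'" ..
    moreover have "\<U>\<^sub>0 \<subseteq> insert (\<Union>i. a i) (\<Union>i\<in>UNIV. \<U> i)" using u(1)[of undefined] by blast
    ultimately show ?case by (intro exI[of _ "insert (\<Union>i. a i) (\<Union>i\<in>UNIV. \<U> i)"] exI[of _ \<Q>']) simp
  qed
  show ?thesis
    unfolding coded_def
  proof (intro allI impI)
    fix \<F> assume F: "countable \<F>" "\<F> \<subseteq> sets Z"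
    show "\<exists>\<U> \<Q>. \<F> \<subseteq> \<U> \<and> coding Z \<U> \<Q>"
    proof (cases "\<F> = {}")
      case True
      then show ?thesis using base by blast
    next
      case False
      have "\<exists>\<U> \<Q>. \<U>\<^sub>0 \<subseteq> \<U> \<and> B \<in> \<U> \<and> coding Z \<U> \<Q>" if "B \<in> \<F>" for B
        using one F(2) gen that by blast
      then have "\<forall>B\<in>\<F>. \<exists>\<U>. \<exists>\<Q>. \<U>\<^sub>0 \<subseteq> \<U> \<and> B \<in> \<U> \<and> coding Z \<U> \<Q>" ..
      from bchoice[OF this] obtain \<U> where
        "\<forall>B\<in>\<F>. \<exists>\<Q>. \<U>\<^sub>0 \<subseteq> \<U> B \<and> B \<in> \<U> B \<and> coding Z (\<U> B) \<Q>" ..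
      from bchoice[OF this] obtain \<Q> where
        "\<forall>B\<in>\<F>. \<U>\<^sub>0 \<subseteq> \<U> B \<and> B \<in> \<U> B \<and> coding Z (\<U> B) (\<Q> B)" ..
      then have u: "\<And>B. B \<in> \<F> \<Longrightarrow> \<U>\<^sub>0 \<subseteq> \<U> B"
          "\<And>B. B \<in> \<F> \<Longrightarrow> B \<in> \<U> B" "\<And>B. B \<in> \<F> \<Longrightarrow> coding Z (\<U> B) (\<Q> B)" by auto
      have c: "coding Z (\<Union>B\<in>\<F>. \<U> B) (\<Union>B\<in>\<F>. \<Q> B)"
        by (rule coding_UN[OF F(1) False u(3) u(1) base])
      then show ?thesis using u(2) by blast
    qed
  qed
qed

text \<open>The clauses turn the true basic sets into a filter base with arbitrarily small members,
  so by completeness their closures share a point. Every true set contains the closure of a true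
  set, hence it contains this point. Conversely, a basic set around the point contains a small true
  set and is then true itself.\<close>

lemma (in Metric_space) coding_base:
  assumes mc: "mcomplete" and Z: "space Z = M" "\<B> \<subseteq> sets Z" and B: "countable \<B>" "{} \<notin> \<B>"
    "\<And>V. V \<in> \<B> \<Longrightarrow> openin mtopology V"
    "\<And>U x. openin mtopology U \<Longrightarrow> x \<in> U \<Longrightarrow> \<exists>V\<in>\<B>. x \<in> V \<and> V \<subseteq> U"
  shows "\<exists>\<Q>. coding Z \<B> \<Q>"
proof -
  define small where "small k = {B \<in> \<B>. \<exists>a. B \<subseteq> mcball a (1 / Suc k)}" for k
  define inside where "inside B B' = {D \<in> \<B>. mtopology closure_of D \<subseteq> B \<inter> B'}" for B B'
  \<comment> \<open>Three kinds of clauses: some basic set of radius \<open>1 / Suc k\<close> is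
    true; the intersection of two true sets contains the closure of a true set; truth passes to
    larger basic sets.\<close>
  define \<Q> where "\<Q> = range (\<lambda>k. small k \<times> {True})
    \<union> (\<lambda>(B, B'). {(B, False), (B', False)} \<union> inside B B' \<times> {True}) ` (\<B> \<times> \<B>)
    \<union> (\<lambda>(B, B'). {(B, False), (B', True)}) ` {(B, B'). B \<in> \<B> \<and> B' \<in> \<B> \<and> B \<subseteq> B'}"
  have sub: "B \<subseteq> M" if "B \<in> \<B>" for B
    using B(3)[OF that] openin_subset by fastforce
  have clos: "\<exists>D\<in>\<B>. x \<in> D \<and> mtopology closure_of D \<subseteq> U" if U: "openin mtopology U" "x \<in> U" for x U
  proof -
    obtain r where r: "r > 0" "mball x r \<subseteq> U" "x \<in> M" using U openin_mtopology by (metis subsetD)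
    have "mtopology closure_of mball x (r/2) \<subseteq> mcball x (r/2)"
      by (rule closure_of_minimal[OF mball_subset_mcball closedin_mcball])
    also have "\<dots> \<subseteq> mball x r" using r by (auto simp: in_mball in_mcball)
    finally have *: "mtopology closure_of mball x (r/2) \<subseteq> U" using r by blast
    obtain D where "D \<in> \<B>" "x \<in> D" "D \<subseteq> mball x (r/2)"
      using B(4)[of "mball x (r/2)" x] r by auto
    then show ?thesis using * closure_of_mono by blast
  qed
  have "coding Z \<B> \<Q>"
  proof (rule codingI)
    have "countable {(B, B'). B \<in> \<B> \<and> B' \<in> \<B> \<and> B \<subseteq> B'}"
      by (rule countable_subset[of _ "\<B> \<times> \<B>"]) (use B(1) in auto)
    then show "countable \<Q>" unfolding \<Q>_def using B(1) by simp
    fix C assume "C \<in> \<Q>"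
    then show "C \<subseteq> \<B> \<times> UNIV" by (auto simp: \<Q>_def small_def inside_def)
  next
    fix z C assume z: "z \<in> space Z" and "C \<in> \<Q>"
    then consider k where "C = small k \<times> {True}"
      | B B' where "B \<in> \<B>" "B' \<in> \<B>" "C = {(B, False), (B', False)} \<union> inside B B' \<times> {True}"
      | B B' where "B \<in> \<B>" "B' \<in> \<B>" "B \<subseteq> B'" "C = {(B, False), (B', True)}"
      unfolding \<Q>_def by blast
    then show "\<exists>l\<in>C. (z \<in> fst l) = snd l"
    proof cases
      case 1
      obtain D where "D \<in> \<B>" "z \<in> D" "D \<subseteq> mball z (1 / Suc k)"
        using B(4)[of "mball z (1 / Suc k)" z] z Z by auto
      then have "D \<in> small k" using mball_subset_mcball[of z "1 / Suc k"] by (auto simp: small_def)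
      then show ?thesis using 1 \<open>z \<in> D\<close> by (intro bexI[of _ "(D, True)"]) auto
    next
      case 2
      show ?thesis
      proof (cases "z \<in> B \<inter> B'")
        case True
        have "openin mtopology (B \<inter> B')" using B(3) 2 by blast
        then obtain D where "D \<in> \<B>" "z \<in> D" "mtopology closure_of D \<subseteq> B \<inter> B'"
          using clos True by blast
        then have "(D, True) \<in> C" using 2 by (auto simp: inside_def)
        then show ?thesis using \<open>z \<in> D\<close> by (intro bexI[of _ "(D, True)"]) auto
      qed (use 2 in auto)
    qed auto
  next
    fix v assume v: "\<And>C. C \<in> \<Q> \<Longrightarrow> \<exists>l\<in>C. v (fst l) = snd l"
    define F where "F = {B \<in> \<B>. v B}"
    have small: "\<exists>B\<in>F. \<exists>a. B \<subseteq> mcball a (1 / Suc k)" for k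
      using v[of "small k \<times> {True}"] by (auto simp: \<Q>_def small_def F_def)
    have inside: "\<exists>D\<in>F. mtopology closure_of D \<subseteq> B \<inter> B'" if "B \<in> F" "B' \<in> F" for B B'
      using v[of "{(B, False), (B', False)} \<union> inside B B' \<times> {True}"] that
      by (auto simp: \<Q>_def inside_def F_def)
    have up: "B' \<in> F" if "B \<in> F" "B' \<in> \<B>" "B \<subseteq> B'" for B B'
      using v[of "{(B, False), (B', True)}"] that by (auto simp: \<Q>_def F_def)
    have cl: "B \<subseteq> mtopology closure_of B" if "B \<in> F" for B
      using closure_of_subset[of B mtopology] sub[of B] that by (simp add: F_def)
    \<comment> \<open>Together with \<open>{} \<notin> \<B>\<close> this gives the finite
      intersection property that \<open>mcomplete_fip\<close> asks for.\<close>
    have fin: "\<exists>D\<in>F. D \<subseteq> \<Inter> ((\<lambda>B. mtopology closure_of B) ` G)" if "finite G" "G \<subseteq> F" for G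
      using that
    proof induction
      case empty
      then show ?case using small[of 0] by (simp only: image_empty Inter_empty subset_UNIV) blast
    next
      case (insert B G)
      then obtain D where D: "D \<in> F" "D \<subseteq> \<Inter> ((\<lambda>B. mtopology closure_of B) ` G)"
        by (meson insert_subset)
      obtain D' where D': "D' \<in> F" "mtopology closure_of D' \<subseteq> B \<inter> D"
        using inside[of B D] insert.prems D(1) by (meson insert_subset)
      have "D' \<subseteq> B \<inter> D" using cl[OF D'(1)] D'(2) by (rule subset_trans)
      moreover have "B \<subseteq> mtopology closure_of B" using cl insert.prems by simp
      ultimately have "D' \<subseteq> \<Inter> ((\<lambda>B. mtopology closure_of B) ` insert B G)"
        using D(2) unfolding image_insert Inter_insert by (meson Int_greatest le_inf_iff subset_trans)
      then show ?case using D' by blast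
    qed
    define \<C> where "\<C> = (\<lambda>B. mtopology closure_of B) ` F"
    have "\<Inter>\<C> \<noteq> {}"
    proof (rule mcomplete_fip[THEN iffD1, OF mc, rule_format], intro conjI allI ballI impI)
      fix C assume "C \<in> \<C>" then show "closedin mtopology C" by (auto simp: \<C>_def)
    next
      fix e :: real assume "e > 0"
      then obtain k where k: "1 / Suc k < e" using nat_approx_posE[of e] by auto
      obtain B a where "B \<in> F" "B \<subseteq> mcball a (1 / Suc k)" using small by blast
      then have "mtopology closure_of B \<subseteq> mcball a (1 / Suc k)"
        by (intro closure_of_minimal closedin_mcball)
      also have "\<dots> \<subseteq> mcball a e" using k by (auto simp: in_mcball)
      finally show "\<exists>C a. C \<in> \<C> \<and> C \<subseteq> mcball a e" using \<open>B \<in> F\<close> by (auto simp: \<C>_def)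
    next
      fix \<F> assume "finite \<F> \<and> \<F> \<subseteq> \<C>"
      then obtain G where "finite G" "G \<subseteq> F" "\<F> = (\<lambda>B. mtopology closure_of B) ` G"
        unfolding \<C>_def by (meson finite_subset_image)
      then obtain D where "D \<in> F" "D \<subseteq> \<Inter>\<F>" using fin by blast
      moreover have "D \<noteq> {}" using \<open>D \<in> F\<close> B(2) by (auto simp: F_def)
      ultimately show "\<Inter>\<F> \<noteq> {}" by blast
    qed
    then obtain x where x: "\<And>B. B \<in> F \<Longrightarrow> x \<in> mtopology closure_of B" unfolding \<C>_def by blast
    have xin: "x \<in> B" if "B \<in> F" for B
    proof -
      obtain D where "D \<in> F" "mtopology closure_of D \<subseteq> B \<inter> B" using inside \<open>B \<in> F\<close> by blast
      then show ?thesis using x[of D] by blast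
    qed
    have xM: "x \<in> M" using small[of 0] xin sub unfolding F_def by blast
    have "B \<in> F" if "B \<in> \<B>" "x \<in> B" for B
    proof -
      obtain r where r: "r > 0" "mball x r \<subseteq> B" 
        using B(3)[OF \<open>B \<in> \<B>\<close>] \<open>x \<in> B\<close> unfolding openin_mtopology by blast
      \<comment> \<open>Half of \<open>r\<close>, because the small set lies in a ball around some
        \<open>a\<close>, and both \<open>x\<close> and \<open>y\<close> are only known to be close
        to \<open>a\<close>.\<close>
      obtain k where k: "1 / Suc k < r / 2" using nat_approx_posE[of "r / 2"] r(1) by auto
      obtain D a where D: "D \<in> F" "D \<subseteq> mcball a (1 / Suc k)" using small by blast
      have "D \<subseteq> mball x r"
      proof
        fix y assume "y \<in> D"
        then have "y \<in> mcball a (1 / Suc k)" "x \<in> mcball a (1 / Suc k)" using D xin by blast+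
        then have *: "d a y \<le> 1 / Suc k" "d a x \<le> 1 / Suc k" "a \<in> M" "y \<in> M"
          unfolding in_mcball by blast+
        then have "d x y < r" using triangle[OF xM *(3,4)] commute[of x a] k by linarith
        then show "y \<in> mball x r" using xM *(4) unfolding in_mball by blast
      qed
      then show "B \<in> F" using up[OF D(1) \<open>B \<in> \<B>\<close>] r(2) by (meson subset_trans)
    qed
    then have "\<forall>B\<in>\<B>. v B = (x \<in> B)" using xin unfolding F_def by blast
    then show "\<exists>z\<in>space Z. \<forall>B\<in>\<B>. v B = (z \<in> B)" using xM unfolding Z(1) by (rule bexI)
  next
    fix z w assume zw: "z \<in> space Z" "w \<in> space Z" "\<And>B. B \<in> \<B> \<Longrightarrow> z \<in> B \<longleftrightarrow> w \<in> B"
    show "z = w"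
    proof (rule ccontr)
      assume "z \<noteq> w"
      then have "d z w > 0" using zw(1,2) unfolding Z(1) by simp
      then obtain D where D: "D \<in> \<B>" "z \<in> D" "D \<subseteq> mball z (d z w)"
        using B(4)[of "mball z (d z w)" z] zw(1) unfolding Z(1) by auto
      then have "w \<in> mball z (d z w)" using zw(3)[of D] by blast
      then show False unfolding in_mball by blast
    qed
  qed (rule B(1), rule Z(2))
  then show ?thesis ..
qed

lemma standard_borel_coded:
  assumes "standard_borel X"
  obtains \<B> where "countable \<B>" "\<B> \<subseteq> sets X" "sets X = sigma_sets (space X) \<B>" "coded X"
proof -
  obtain T where T: "completely_metrizable_space T" "second_countable T"
      "topspace T = space X" "sets X = sigma_sets (space X) {U. openin T U}"
    using assms unfolding standard_borel_def by auto
  obtain M d where Md: "Metric_space M d" "Metric_space.mcomplete M d" "T = Metric_space.mtopology M d"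
    using T(1) unfolding completely_metrizable_space_def by auto
  interpret Metric_space M d by (rule Md)
  from T(2) obtain \<A> where A: "countable \<A>" "\<forall>V\<in>\<A>. openin T V"
      "\<forall>U x. openin T U \<and> x \<in> U \<longrightarrow> (\<exists>V\<in>\<A>. x \<in> V \<and> V \<subseteq> U)"
    unfolding second_countable_def by (elim exE conjE)
  \<comment> \<open>The empty set is dropped because no point could realise a valuation in which it
    is true.\<close>
  define \<B> where "\<B> = \<A> - {{}}"
  have open_sets: "U \<in> sets X" if "openin T U" for U using that T(4) by auto
  have B: "countable \<B>" "{} \<notin> \<B>" "\<And>V. V\<in>\<B> \<Longrightarrow> openin T V" "\<B> \<subseteq> sets X"
    using A(1,2) open_sets by (auto simp: \<B>_def)
  have Bx: "\<exists>V\<in>\<B>. x \<in> V \<and> V \<subseteq> U" if "openin T U" "x \<in> U" for U x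
  proof -
    obtain V where "V \<in> \<A>" "x \<in> V" "V \<subseteq> U" using A(3) \<open>openin T U\<close> \<open>x \<in> U\<close> by blast
    then show ?thesis by (intro bexI[of _ V]) (auto simp: \<B>_def)
  qed
  have "space X = M" using T(3) Md(3) by simp
  then have "\<exists>\<Q>. coding X \<B> \<Q>"
    by (rule coding_base[OF Md(2) _ B(4,1,2)]) (use B(3) Bx in \<open>simp_all add: Md(3)\<close>)
  then obtain \<Q> where Q: "coding X \<B> \<Q>" ..
  have "U \<in> sigma_sets (space X) \<B>" if "openin T U" for U
  proof -
    have "U = \<Union>{V \<in> \<B>. V \<subseteq> U}" using Bx[OF that] by auto
    moreover have "\<Union>{V \<in> \<B>. V \<subseteq> U} \<in> sigma_sets (space X) \<B>"
      by (rule sigma_sets_UNION) (use B(1) in auto)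
    ultimately show ?thesis by simp
  qed
  then have "{U. openin T U} \<subseteq> sigma_sets (space X) \<B>" by (intro subsetI) simp
  then have "sets X \<subseteq> sigma_sets (space X) \<B>"
    unfolding T(4) by (rule sigma_sets_mono)
  moreover have "sigma_sets (space X) \<B> \<subseteq> sets X" using B(4) by (simp add: sets.sigma_sets_subset)
  ultimately have g: "sets X = sigma_sets (space X) \<B>" by blast
  have "coded X" by (rule codedI[OF Q g], rule exI[of _ \<B>], rule exI[of _ \<Q>]) (simp add: Q)
  then show thesis by (rule that[OF B(1,4) g])
qed

section \<open>Separation and countable-to-one maps\<close>

text \<open>The valuation that makes \<open>B\<close> true iff some \<open>a n\<close> lies inside
  \<open>B\<close> satisfies all clauses, so some point realises it. This is the form in which
  completeness enters the limit constructions below.\<close>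

lemma coding_limit:
  assumes cod: "coding Z \<U> \<Q>"
    and dec: "\<And>n::nat. a (Suc n) \<subseteq> a n" and ne: "\<And>n. a n \<noteq> {}" and sp: "\<And>n. a n \<subseteq> space Z"
    and U: "\<And>B. B \<in> \<U> \<Longrightarrow> \<exists>n. a n \<subseteq> B \<or> a n \<inter> B = {}"
    and Q: "\<And>C. C \<in> \<Q> \<Longrightarrow> \<exists>n. \<exists>l\<in>C. if snd l then a n \<subseteq> fst l else a n \<inter> fst l = {}"
  shows "\<exists>z. z \<in> space Z \<and>
    (\<forall>B\<in>\<U>. (z \<in> B \<longleftrightarrow> (\<exists>n. a n \<subseteq> B)) \<and> (z \<notin> B \<longleftrightarrow> (\<exists>n. a n \<inter> B = {})))"
proof -
  have mono: "a m \<subseteq> a n" if "n \<le> m" for m n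
    using lift_Suc_antimono_le[of a, OF dec that] .
  \<comment> \<open>Nonemptiness of the sets enters here: \<open>B\<close> cannot be decided both
    ways at different stages.\<close>
  have excl: "\<not> (\<exists>m. a m \<subseteq> B)" if "a n \<inter> B = {}" for n B
  proof
    assume "\<exists>m. a m \<subseteq> B"
    then obtain m where "a m \<subseteq> B" ..
    then have "a (max m n) \<subseteq> a n \<inter> B" using mono[of m "max m n"] mono[of n "max m n"] by auto
    then show False using that ne[of "max m n"] by simp
  qed
  define v where "v B = (\<exists>n. a n \<subseteq> B)" for B
  have "\<exists>l\<in>C. v (fst l) = snd l" if "C \<in> \<Q>" for C
  proof -
    obtain n l where l: "l \<in> C" "if snd l then a n \<subseteq> fst l else a n \<inter> fst l = {}" 
      using Q[OF \<open>C \<in> \<Q>\<close>] by blast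
    have "v (fst l) = snd l"
      using l(2) excl[of n "fst l"] by (cases "snd l") (auto simp: v_def)
    then show ?thesis using l(1) by blast
  qed
  then obtain z where "z \<in> space Z" "\<forall>B\<in>\<U>. v B = (z \<in> B)" using codingD(6)[OF cod, of v] by auto
  then show ?thesis
  proof (intro exI[of _ z] conjI ballI)
    fix B assume "B \<in> \<U>"
    then show *: "z \<in> B \<longleftrightarrow> (\<exists>n. a n \<subseteq> B)" using \<open>\<forall>B\<in>\<U>. v B = (z \<in> B)\<close> by (simp add: v_def)
    show "z \<notin> B \<longleftrightarrow> (\<exists>n. a n \<inter> B = {})"
      using U[OF \<open>B \<in> \<U>\<close>] excl * by blast
  qed
qed

text \<open>The padding makes the enumerations total even if \<open>\<U>\<close> or
  \<open>\<Q>\<close> is empty: \<open>{}\<close> is Borel, and the clause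
  \<open>{({}, False)}\<close> holds at every point.\<close>

lemma coding_enum:
  assumes cod: "coding Z \<U> \<Q>"
  obtains e :: "nat \<Rightarrow> 'a set" and q :: "nat \<Rightarrow> ('a set \<times> bool) set"
  where "\<U> \<subseteq> range e" "\<forall>n. e n \<in> sets Z" "\<Q> \<subseteq> range q" "\<forall>n. countable (q n)"
    "\<forall>n. \<forall>l\<in>q n. fst l \<in> sets Z" "\<forall>n. \<forall>z\<in>space Z. \<exists>l\<in>q n. (z \<in> fst l) = snd l"
proof -
  define e where "e = from_nat_into (insert {} \<U>)"
  define q where "q = from_nat_into (insert {({} :: 'a set, False)} \<Q>)"
  have re: "range e = insert {} \<U>"
    unfolding e_def using codingD(1)[OF cod] by (intro range_from_nat_into) simp_all
  have rq: "range q = insert {({} :: 'a set, False)} \<Q>"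
    unfolding q_def using codingD(3)[OF cod] by (intro range_from_nat_into) simp_all
  have en: "e n \<in> insert {} \<U>" for n using re by blast
  have qn: "q n = {({}, False)} \<or> q n \<in> \<Q>" for n using rq by blast
  have sub: "q n \<subseteq> insert {} \<U> \<times> UNIV" for n
  proof (cases "q n \<in> \<Q>")
    case True
    then show ?thesis using codingD(4)[OF cod, of "q n"] by blast
  next
    case False
    then show ?thesis using qn[of n] by simp
  qed
  show thesis
  proof (rule that[of e q]; (intro allI ballI)?)
    show "\<U> \<subseteq> range e" "\<Q> \<subseteq> range q" using re rq by auto
    fix n
    show "e n \<in> sets Z" using en[of n] subsetD[OF codingD(2)[OF cod], of "e n"] by auto
    show "countable (q n)"
      by (rule countable_subset[OF sub]) (simp add: codingD(1)[OF cod])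
    show "\<exists>l\<in>q n. (z \<in> fst l) = snd l" if "z \<in> space Z" for z
      using qn[of n] codingD(5)[OF cod that, of "q n"] by (elim disjE) simp_all
    fix l assume "l \<in> q n"
    with sub[of n] have "l \<in> insert {} \<U> \<times> UNIV" by (rule subsetD)
    then have "fst l \<in> insert {} \<U>" by (simp add: mem_Times_iff)
    then show "fst l \<in> sets Z" using subsetD[OF codingD(2)[OF cod], of "fst l"] by auto
  qed
qed

text \<open>With \<open>\<N> = {{}}\<close> this is separation of the images by Borel sets with empty intersection; in the
  Lusin--Novikov argument \<open>\<N>\<close> consists of the countable unions of Borel sets on which \<open>f\<close> is
  injective.\<close>

definition separated :: "'b measure \<Rightarrow> ('a \<Rightarrow> 'b) \<Rightarrow> 'a set set \<Rightarrow> 'i set \<Rightarrow> ('i \<Rightarrow> 'a set) \<Rightarrow> bool" where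
  "separated X f \<N> I A \<longleftrightarrow>
     (\<exists>N\<in>\<N>. \<exists>B. (\<forall>i\<in>I. B i \<in> sets X \<and> f ` (A i - N) \<subseteq> B i) \<and> (\<Inter>i\<in>I. B i) = {})"

lemma separatedI:
  assumes "N \<in> \<N>" "\<And>i. i \<in> I \<Longrightarrow> B i \<in> sets X"
    "\<And>i z. i \<in> I \<Longrightarrow> z \<in> A i \<Longrightarrow> z \<notin> N \<Longrightarrow> f z \<in> B i"
    "\<And>x. (\<And>i. i \<in> I \<Longrightarrow> x \<in> B i) \<Longrightarrow> False"
  shows "separated X f \<N> I A"
  unfolding separated_def
proof (intro bexI[OF _ assms(1)] exI[of _ B] conjI ballI)
  show "f ` (A i - N) \<subseteq> B i" if "i \<in> I" for i using assms(3)[OF that] by blast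
  show "(\<Inter>i\<in>I. B i) = {}" using assms(4) by (meson INT_E equals0I)
qed (rule assms(2))

locale small_sets =
  fixes Z :: "'a measure" and X :: "'b measure" and f :: "'a \<Rightarrow> 'b" and \<N> :: "'a set set"
  assumes f [measurable]: "f \<in> Z \<rightarrow>\<^sub>M X"
    and small_Union: "countable \<A> \<Longrightarrow> \<A> \<subseteq> \<N> \<Longrightarrow> \<Union>\<A> \<in> \<N>"
begin

text \<open>Used contrapositively: an inseparable family has an inseparable choice of pieces. There
  are only countably many choices \<phi>, so the separators of all choices can be combined into
  Borel sets and their exceptional sets into one member of \<N>.\<close>

lemma separated_decompose:
  assumes I: "finite I" and W: "\<And>i. i \<in> I \<Longrightarrow> countable (W i)"
    and sp: "\<And>i. i \<in> I \<Longrightarrow> A i \<subseteq> space Z"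
    and A: "\<And>i. i \<in> I \<Longrightarrow> A i \<subseteq> (\<Union>w\<in>W i. P i w)"
    and sep: "\<And>\<phi>. \<phi> \<in> PiE I W \<Longrightarrow> separated X f \<N> I (\<lambda>i. P i (\<phi> i))"
  shows "separated X f \<N> I A"
proof -
  define \<Phi> where "\<Phi> = PiE I W"
  have \<Phi>: "countable \<Phi>" unfolding \<Phi>_def using I W by (rule countable_PiE)
  let ?R = "\<lambda>\<phi> N B. N \<in> \<N> \<and> (\<forall>i\<in>I. B i \<in> sets X \<and> f ` (P i (\<phi> i) - N) \<subseteq> B i) \<and> (\<Inter>i\<in>I. B i) = {}"
  have "\<forall>\<phi>\<in>\<Phi>. \<exists>N B. ?R \<phi> N B"
  proof
    fix \<phi> assume "\<phi> \<in> \<Phi>"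
    then have "separated X f \<N> I (\<lambda>i. P i (\<phi> i))" unfolding \<Phi>_def by (rule sep)
    then show "\<exists>N B. ?R \<phi> N B"
      unfolding separated_def by (elim bexE exE) (rule exI, rule exI, rule conjI; assumption)
  qed
  from bchoice[OF this] obtain N where "\<forall>\<phi>\<in>\<Phi>. \<exists>B. ?R \<phi> (N \<phi>) B" ..
  from bchoice[OF this] obtain B where NB: "\<forall>\<phi>\<in>\<Phi>. ?R \<phi> (N \<phi>) (B \<phi>)" ..
  \<comment> \<open>A point of all \<open>D i\<close> picks a piece for each index. These pieces
    form one choice \<phi>, whose separators have empty intersection but would all contain the
    point.\<close>
  define D where "D i = {x \<in> space X. \<exists>w\<in>W i. \<forall>\<phi>\<in>\<Phi>. \<phi> i = w \<longrightarrow> x \<in> B \<phi> i}" for i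
  show ?thesis
  proof (rule separatedI)
    show "\<Union>(N ` \<Phi>) \<in> \<N>" using NB \<Phi> by (intro small_Union) auto
  next
    fix i assume i: "i \<in> I"
    have "{x \<in> space X. \<phi> i = w \<longrightarrow> x \<in> B \<phi> i} \<in> sets X" if "\<phi> \<in> \<Phi>" for \<phi> w
    proof -
      have "B \<phi> i \<in> sets X" using NB i that by simp
      moreover have "{x \<in> space X. \<phi> i = w \<longrightarrow> x \<in> B \<phi> i} = (if \<phi> i = w then space X \<inter> B \<phi> i else space X)"
        by auto
      ultimately show ?thesis by auto
    qed
    then show "D i \<in> sets X"
      unfolding D_def by (intro sets.sets_Collect_countable_Ex' sets.sets_Collect_countable_All' W[OF i] \<Phi>)
    fix z assume z: "z \<in> A i" "z \<notin> \<Union>(N ` \<Phi>)"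
    then obtain w where w: "w \<in> W i" "z \<in> P i w" using A[OF i] by blast
    have "f z \<in> B \<phi> i" if "\<phi> \<in> \<Phi>" "\<phi> i = w" for \<phi>
    proof -
      have "f ` (P i (\<phi> i) - N \<phi>) \<subseteq> B \<phi> i" using NB that(1) i by simp
      moreover have "z \<in> P i (\<phi> i) - N \<phi>" using w(2) that z(2) by simp
      ultimately show ?thesis by blast
    qed
    moreover have "f z \<in> space X" using sp[OF i] z(1) measurable_space[OF f] by blast
    ultimately show "f z \<in> D i" using w(1) unfolding D_def by blast
  next
    fix x assume x: "\<And>i. i \<in> I \<Longrightarrow> x \<in> D i"
    then have "\<forall>i\<in>I. \<exists>w. w \<in> W i \<and> (\<forall>\<phi>\<in>\<Phi>. \<phi> i = w \<longrightarrow> x \<in> B \<phi> i)" unfolding D_def by blast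
    from bchoice[OF this] obtain w where w: "\<forall>i\<in>I. w i \<in> W i \<and> (\<forall>\<phi>\<in>\<Phi>. \<phi> i = w i \<longrightarrow> x \<in> B \<phi> i)" ..
    define \<phi> where "\<phi> = restrict w I"
    have \<phi>: "\<phi> \<in> \<Phi>" using w by (auto simp: \<Phi>_def \<phi>_def)
    have "x \<in> B \<phi> i" if "i \<in> I" for i using w that \<phi> by (simp add: \<phi>_def)
    then have "x \<in> (\<Inter>i\<in>I. B \<phi> i)" by blast
    then show False using NB \<phi> by simp
  qed
qed

text \<open>One stage of the later constructions, with \<open>B\<close> a basic set and
  \<open>C\<close> a clause. Each \<open>A i\<close> is cut into countably many pieces by membership
  in \<open>B\<close> and by a literal of \<open>C\<close> that holds there;
  \<open>separated_decompose\<close> then finds an inseparable choice.\<close>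

lemma separated_refine:
  assumes I: "finite I" and A: "\<And>i. i \<in> I \<Longrightarrow> A i \<in> sets Z" and B: "B \<in> sets Z"
    and C: "countable C" "\<And>l. l \<in> C \<Longrightarrow> fst l \<in> sets Z" "\<And>z. z \<in> space Z \<Longrightarrow> \<exists>l\<in>C. (z \<in> fst l) = snd l"
    and ns: "\<not> separated X f \<N> I A"
  obtains A' where "\<forall>i\<in>I. A' i \<in> sets Z \<and> A' i \<subseteq> A i \<and> (A' i \<subseteq> B \<or> A' i \<inter> B = {}) \<and>
      (\<exists>l\<in>C. if snd l then A' i \<subseteq> fst l else A' i \<inter> fst l = {})"
    "\<not> separated X f \<N> I A'"
proof -
  define pos where "pos l = (if snd l then fst l else space Z - fst l)" for l :: "'a set \<times> bool"
  have pos: "pos l \<in> sets Z" if "fst l \<in> sets Z" for l using that by (simp add: pos_def)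
  define P where "P i w = A i \<inter> pos (B, fst w) \<inter> pos (snd w)" for i and w :: "bool \<times> 'a set \<times> bool"
  obtain \<phi> where \<phi>: "\<phi> \<in> PiE I (\<lambda>_. UNIV \<times> C)" "\<not> separated X f \<N> I (\<lambda>i. P i (\<phi> i))"
  proof (rule ccontr)
    assume "\<not> thesis"
    then have *: "separated X f \<N> I (\<lambda>i. P i (\<phi> i))" if "\<phi> \<in> PiE I (\<lambda>_. UNIV \<times> C)" for \<phi>
      using that \<open>\<And>\<phi>. \<lbrakk>\<phi> \<in> PiE I (\<lambda>_. UNIV \<times> C); \<not> separated X f \<N> I (\<lambda>i. P i (\<phi> i))\<rbrakk> \<Longrightarrow> thesis\<close> by blast
    have "separated X f \<N> I A"
    proof (rule separated_decompose[OF I _ _ _ *])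
      fix i assume i: "i \<in> I"
      show "countable (UNIV \<times> C :: (bool \<times> 'a set \<times> bool) set)" using C(1) by simp
      show "A i \<subseteq> space Z" using A[OF i] by (rule sets.sets_into_space)
      show "A i \<subseteq> (\<Union>w\<in>UNIV \<times> C. P i w)"
      proof
        fix z assume z: "z \<in> A i"
        then have zZ: "z \<in> space Z" using A[OF i] sets.sets_into_space by blast
        obtain l where "l \<in> C" "(z \<in> fst l) = snd l" using C(3)[OF zZ] by blast
        then have "(z \<in> B, l) \<in> UNIV \<times> C" "z \<in> P i (z \<in> B, l)"
          using z zZ by (auto simp: P_def pos_def)
        then show "z \<in> (\<Union>w\<in>UNIV \<times> C. P i w)" by blast
      qed
    qed
    then show False using ns by blast
  qed
  show thesis
  proof (rule that[of "\<lambda>i. P i (\<phi> i)", OF _ \<phi>(2)], intro ballI conjI)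
    fix i assume i: "i \<in> I"
    then have w: "snd (\<phi> i) \<in> C" using \<phi>(1) by (auto simp: PiE_def Pi_def)
    show "P i (\<phi> i) \<in> sets Z" unfolding P_def using A[OF i] B C(2)[OF w] pos by (intro sets.Int) auto
    show "P i (\<phi> i) \<subseteq> A i" by (auto simp: P_def)
    show "P i (\<phi> i) \<subseteq> B \<or> P i (\<phi> i) \<inter> B = {}" by (cases "fst (\<phi> i)") (auto simp: P_def pos_def)
    show "\<exists>l\<in>C. if snd l then P i (\<phi> i) \<subseteq> fst l else P i (\<phi> i) \<inter> fst l = {}"
      by (rule bexI[OF _ w], cases "snd (snd (\<phi> i))") (auto simp: P_def pos_def)
  qed
qed

text \<open>The separators are \<open>V\<close>, its complement, and the whole space at the other
  indices. Contrapositively, a Borel set that tells two images apart at a finite stage contradicts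
  inseparability, which is how limit points get equal images.\<close>

lemma separated_of_disjoint_images:
  assumes "i \<in> I" "j \<in> I" "V \<in> sets X" "{} \<in> \<N>" "\<And>i. i \<in> I \<Longrightarrow> A i \<subseteq> space Z"
    "A i \<subseteq> f -` V" "A j \<inter> f -` V = {}" "i \<noteq> j"
  shows "separated X f \<N> I A"
proof (rule separatedI[OF assms(4)])
  define B where "B k = (if k = i then V else if k = j then space X - V else space X)" for k
  show "B k \<in> sets X" for k using assms(3) by (simp add: B_def)
  show "f z \<in> B k" if "k \<in> I" "z \<in> A k" for k z
    using that assms(6,7) measurable_space[OF f] assms(5)[OF that(1)] by (auto simp: B_def)
  fix x assume x: "\<And>k. k \<in> I \<Longrightarrow> x \<in> B k"
  show False using x[OF assms(1)] x[OF assms(2)] assms(8) by (auto simp: B_def)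
qed

text \<open>Inseparability thus keeps every piece nonempty, as \<open>coding_limit\<close>
  demands.\<close>

lemma separated_of_empty:
  assumes "i \<in> I" "A i = {}" "{} \<in> \<N>" "\<And>i. i \<in> I \<Longrightarrow> A i \<subseteq> space Z"
  shows "separated X f \<N> I A"
proof (rule separatedI[OF assms(3)])
  define B where "B k = (if k = i then {} else space X)" for k
  show "B k \<in> sets X" for k by (simp add: B_def)
  show "f z \<in> B k" if "k \<in> I" "z \<in> A k" for k z
    using that assms(2) measurable_space[OF f] assms(4)[OF that(1)] by (auto simp: B_def)
  show False if "\<And>k. k \<in> I \<Longrightarrow> x \<in> B k" for x
    using that[OF assms(1)] by (simp add: B_def)
qed

text \<open>The branching step of the Lusin-Novikov tree: every node of level \<open>n\<close> is
  cut in two by a basic set so that the doubled family stays inseparable. If all cuts \<beta>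
  failed, their separators would combine to separate the original family, up to parts on which
  \<open>f\<close> is injective and which therefore belong to \<N>.\<close>

lemma separated_split:
  assumes \<N>: "\<N> \<subseteq> sets Z" "\<And>C. C \<in> sets Z \<Longrightarrow> inj_on f C \<Longrightarrow> C \<in> \<N>"
    and A: "\<And>u. length u = n \<Longrightarrow> A u \<in> sets Z" and U: "countable \<U>" "\<U> \<subseteq> sets Z"
    and sepU: "\<And>z w. z \<in> space Z \<Longrightarrow> w \<in> space Z \<Longrightarrow> (\<And>B. B \<in> \<U> \<Longrightarrow> z \<in> B \<longleftrightarrow> w \<in> B) \<Longrightarrow> z = w"
    and ns: "\<not> separated X f \<N> {u :: bool list. length u = n} A"
  obtains \<beta> where "\<forall>u. length u = n \<longrightarrow> \<beta> u \<in> \<U>"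
    "\<not> separated X f \<N> {u. length u = Suc n}
      (\<lambda>u. if last u then A (butlast u) \<inter> \<beta> (butlast u) else A (butlast u) - \<beta> (butlast u))"
proof (rule ccontr)
  assume no: "\<not> thesis"
  define I where "I = {u :: bool list. length u = n}"
  have fI: "finite I" unfolding I_def using finite_lists_length_eq[of "UNIV :: bool set" n] by simp
  define A' where "A' \<beta> u = (if last u then A (butlast u) \<inter> \<beta> (butlast u) else A (butlast u) - \<beta> (butlast u))"
    for \<beta> and u :: "bool list"
  define \<Phi> where "\<Phi> = PiE I (\<lambda>_. \<U>)"
  have \<Phi>: "countable \<Phi>" unfolding \<Phi>_def using fI U(1) by (rule countable_PiE)
  let ?R = "\<lambda>\<beta> N B. N \<in> \<N> \<and>
    (\<forall>i\<in>{u. length u = Suc n}. B i \<in> sets X \<and> f ` (A' \<beta> i - N) \<subseteq> B i) \<and>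
    (\<Inter>i\<in>{u. length u = Suc n}. B i) = {}"
  have "\<forall>\<beta>\<in>\<Phi>. \<exists>N B. ?R \<beta> N B"
  proof
    fix \<beta> assume "\<beta> \<in> \<Phi>"
    then have "\<beta> u \<in> \<U>" if "length u = n" for u using that by (auto simp: \<Phi>_def I_def)
    then have "separated X f \<N> {u. length u = Suc n} (A' \<beta>)"
      using no that[of \<beta>] unfolding A'_def by blast
    then show "\<exists>N B. ?R \<beta> N B"
      unfolding separated_def by (elim bexE exE) (rule exI, rule exI, rule conjI; assumption)
  qed
  from bchoice[OF this] obtain N where "\<forall>\<beta>\<in>\<Phi>. \<exists>B. ?R \<beta> (N \<beta>) B" ..
  from bchoice[OF this] obtain B where NB: "\<forall>\<beta>\<in>\<Phi>. ?R \<beta> (N \<beta>) (B \<beta>)" ..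
  have Bsets: "B \<beta> (u @ [b]) \<in> sets X" if "\<beta> \<in> \<Phi>" "u \<in> I" for \<beta> u b
    using NB that by (simp add: I_def)
  have Bimg: "f z \<in> B \<beta> (u @ [b])" if "\<beta> \<in> \<Phi>" "u \<in> I" "z \<in> A u" "z \<in> \<beta> u \<longleftrightarrow> b" "z \<notin> N \<beta>" for \<beta> u b z
  proof -
    have "z \<in> A' \<beta> (u @ [b]) - N \<beta>" using that by (simp add: A'_def)
    moreover have "f ` (A' \<beta> (u @ [b]) - N \<beta>) \<subseteq> B \<beta> (u @ [b])" using NB that by (simp add: I_def)
    ultimately show ?thesis by blast
  qed
  \<comment> \<open>\<open>S u V b\<close> collects the points that lie in the separator of the
    \<open>b\<close>-half of \<open>u\<close> for every \<beta> cutting \<open>u\<close> by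
    \<open>V\<close>. A point of \<open>D u\<close> does so for both halves of one cut.\<close>
  define S where "S u V b = {x \<in> space X. \<forall>\<beta>\<in>\<Phi>. \<beta> u = V \<longrightarrow> x \<in> B \<beta> (u @ [b])}" for u V b
  define D where "D u = (\<Union>V\<in>\<U>. S u V True \<inter> S u V False)" for u
  have S: "S u V b \<in> sets X" if u: "u \<in> I" for u V b
  proof -
    have "{x \<in> space X. \<beta> u = V \<longrightarrow> x \<in> B \<beta> (u @ [b])} \<in> sets X" if "\<beta> \<in> \<Phi>" for \<beta>
    proof -
      have "{x \<in> space X. \<beta> u = V \<longrightarrow> x \<in> B \<beta> (u @ [b])} =
          (if \<beta> u = V then space X \<inter> B \<beta> (u @ [b]) else space X)" by auto
      then show ?thesis using Bsets[OF that u] by auto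
    qed
    then show ?thesis unfolding S_def by (intro sets.sets_Collect_countable_All' \<Phi>)
  qed
  have D: "D u \<in> sets X" if "u \<in> I" for u
    unfolding D_def using U(1) S[OF that] by (intro sets.countable_UN') auto
  define N0 where "N0 = \<Union>(N ` \<Phi>)"
  have N0: "N0 \<in> \<N>" unfolding N0_def using NB \<Phi> by (intro small_Union) auto
  \<comment> \<open>On this part \<open>f\<close> is injective: a basic set \<open>V\<close> that
    tells apart two points with the same image would put this image into \<open>S u V True\<close>
    and \<open>S u V False\<close>, hence into \<open>D u\<close>.\<close>
  define C where "C u = A u \<inter> (space Z - f -` D u \<inter> space Z) - N0" for u
  have AZ: "A u \<subseteq> space Z" if "u \<in> I" for u
    using A[of u] that sets.sets_into_space by (simp add: I_def)
  have C: "C u \<in> \<N>" if u: "u \<in> I" for u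
  proof (rule \<N>(2))
    have "N0 \<in> sets Z" "A u \<in> sets Z" using subsetD[OF \<N>(1) N0] A[of u] u by (simp_all add: I_def)
    moreover have "f -` D u \<inter> space Z \<in> sets Z" by (rule measurable_sets[OF f D[OF u]])
    ultimately show "C u \<in> sets Z" unfolding C_def by auto
    have le: "z \<in> V \<longleftrightarrow> w \<in> V" if zw: "z \<in> C u" "w \<in> C u" "f z = f w" and V: "V \<in> \<U>" for z w V
    proof (rule ccontr)
      assume neq: "\<not> (z \<in> V \<longleftrightarrow> w \<in> V)"
      have inS: "f y \<in> S u V (y \<in> V)" if "y \<in> C u" for y
        unfolding S_def
      proof (intro CollectI conjI ballI impI)
        show "f y \<in> space X" using that AZ[OF u] measurable_space[OF f] by (auto simp: C_def)
        fix \<beta> assume "\<beta> \<in> \<Phi>" "\<beta> u = V"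
        then show "f y \<in> B \<beta> (u @ [y \<in> V])"
          using Bimg[of \<beta> u y "y \<in> V"] u that by (simp add: C_def N0_def)
      qed
      have "f z \<in> S u V True \<inter> S u V False"
        using inS[OF zw(1)] inS[OF zw(2)] neq zw(3) by (cases "z \<in> V") auto
      then have "f z \<in> D u" using V by (auto simp: D_def)
      then show False using zw(1) AZ[OF u] by (auto simp: C_def)
    qed
    show "inj_on f (C u)"
    proof (rule inj_onI)
      fix z w assume zw: "z \<in> C u" "w \<in> C u" "f z = f w"
      show "z = w"
      proof (rule sepU)
        show "z \<in> space Z" "w \<in> space Z" using zw AZ[OF u] by (auto simp: C_def)
      qed (rule le[OF zw])
    qed
  qed
  have "separated X f \<N> I A"
  proof (rule separatedI)
    show "\<Union>(insert N0 (C ` I)) \<in> \<N>" using N0 C fI by (intro small_Union) (auto intro: countable_finite)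
    show "D u \<in> sets X" if "u \<in> I" for u by (rule D[OF that])
    show "f z \<in> D u" if "u \<in> I" "z \<in> A u" "z \<notin> \<Union>(insert N0 (C ` I))" for u z
      using that AZ[OF that(1)] by (auto simp: C_def)
    fix x assume x: "\<And>u. u \<in> I \<Longrightarrow> x \<in> D u"
    \<comment> \<open>The cuts chosen at the individual nodes form one \<beta>, and \<open>x\<close>
      lies in all separators of this \<beta>, whose intersection is empty.\<close>
    then have "\<forall>u\<in>I. \<exists>V. V \<in> \<U> \<and> x \<in> S u V True \<and> x \<in> S u V False" unfolding D_def by blast
    from bchoice[OF this] obtain \<gamma> where \<gamma>: "\<forall>u\<in>I. \<gamma> u \<in> \<U> \<and> x \<in> S u (\<gamma> u) True \<and> x \<in> S u (\<gamma> u) False" ..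
    define \<beta> where "\<beta> = restrict \<gamma> I"
    have \<beta>: "\<beta> \<in> \<Phi>" using \<gamma> by (auto simp: \<Phi>_def \<beta>_def)
    have "x \<in> B \<beta> v" if "length v = Suc n" for v
    proof -
      have "v \<noteq> []" using that by auto
      then have v: "v = butlast v @ [last v]" "butlast v \<in> I" using that by (simp_all add: I_def)
      have "x \<in> S (butlast v) (\<gamma> (butlast v)) (last v)" using \<gamma> v(2) by (cases "last v") auto
      then have "x \<in> B \<beta> (butlast v @ [last v])" using \<beta> v(2) by (auto simp: S_def \<beta>_def)
      then show ?thesis using v(1) by simp
    qed
    then have "x \<in> (\<Inter>i\<in>{u. length u = Suc n}. B \<beta> i)" by blast
    then show False using NB \<beta> by simp
  qed
  then show False using ns by (simp add: I_def)
qed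

end

section \<open>Luzin separation, injective Borel images, and the Lusin-Novikov decomposition\<close>

definition separating :: "'b measure \<Rightarrow> 'b set set \<Rightarrow> bool" where
  "separating X \<V> \<longleftrightarrow> countable \<V> \<and> \<V> \<subseteq> sets X \<and>
     (\<forall>x\<in>space X. \<forall>y\<in>space X. (\<forall>V\<in>\<V>. x \<in> V \<longleftrightarrow> y \<in> V) \<longrightarrow> x = y)"

lemma separatingD:
  assumes "separating X \<V>"
  shows "countable \<V>" "\<V> \<subseteq> sets X"
    "\<And>x y. x \<in> space X \<Longrightarrow> y \<in> space X \<Longrightarrow> (\<And>V. V \<in> \<V> \<Longrightarrow> x \<in> V \<longleftrightarrow> y \<in> V) \<Longrightarrow> x = y"
  using assms by (simp_all add: separating_def)

lemma coding_separating: "coding Z \<U> \<Q> \<Longrightarrow> separating Z \<U>"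
  unfolding separating_def using codingD(1,2,7)[of Z \<U> \<Q>] by simp

text \<open>If separation failed, an inseparable pair could be refined along all basic sets and
  clauses to two limit points, one in \<open>C1\<close> and one in \<open>C2\<close>. Their images
  cannot be told apart by any member of \<V>, so they are equal, against disjointness.\<close>

lemma disjoint_images_separation:
  assumes Z: "coded Z" and f: "f \<in> Z \<rightarrow>\<^sub>M X" and V: "separating X \<V>"
    and C: "C1 \<in> sets Z" "C2 \<in> sets Z" "f ` C1 \<inter> f ` C2 = {}"
  shows "\<exists>B\<in>sets X. f ` C1 \<subseteq> B \<and> B \<inter> f ` C2 = {}"
proof -
  define pre where "pre V = f -` V \<inter> space Z" for V
  \<comment> \<open>With the preimages of \<V> among the basic sets, a finite stage decides whether
    the image of a limit point lies in a given \<open>V\<close>. The sets \<open>C1\<close> and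
    \<open>C2\<close> are included so that the limit points stay in them.\<close>
  have "countable ({C1, C2} \<union> pre ` \<V>)" using separatingD(1)[OF V] by simp
  moreover have "{C1, C2} \<union> pre ` \<V> \<subseteq> sets Z"
    using C(1,2) measurable_sets[OF f] separatingD(2)[OF V] by (auto simp: pre_def)
  ultimately obtain \<U> \<Q> where sub: "{C1, C2} \<union> pre ` \<V> \<subseteq> \<U>" and cod: "coding Z \<U> \<Q>"
    by (rule codedD[OF Z])
  obtain e :: "nat \<Rightarrow> 'a set" and q :: "nat \<Rightarrow> ('a set \<times> bool) set" where eq0: "\<U> \<subseteq> range e" "\<forall>n. e n \<in> sets Z" "\<Q> \<subseteq> range q" "\<forall>n. countable (q n)"
    "\<forall>n. \<forall>l\<in>q n. fst l \<in> sets Z" "\<forall>n. \<forall>z\<in>space Z. \<exists>l\<in>q n. (z \<in> fst l) = snd l"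
    by (rule coding_enum[OF cod])
  note eq = eq0(1) eq0(2)[rule_format] eq0(3) eq0(4-6)[rule_format]
  interpret small_sets Z X f "{{}}" by standard (use f in auto)
  define A0 where "A0 b = (if b then C1 else C2)" for b
  have A0: "A0 b \<in> sets Z" "A0 b \<in> \<U>" for b using C sub by (auto simp: A0_def)
  have "separated X f {{}} UNIV A0"
  proof (rule ccontr)
    assume ns: "\<not> separated X f {{}} UNIV A0"
    \<comment> \<open>The last conjunct pins the initial term: \<open>dependent_nat_choice\<close>
      only says that the initial term satisfies the invariant.\<close>
    define Pr where "Pr n A \<longleftrightarrow> (\<forall>b. A b \<in> sets Z) \<and> \<not> separated X f {{}} UNIV A \<and> (n = (0::nat) \<longrightarrow> A = A0)" for n A
    define Qr where "Qr n A A' \<longleftrightarrow> (\<forall>b::bool. A' b \<subseteq> A b \<and> (A' b \<subseteq> e n \<or> A' b \<inter> e n = {}) \<and>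
      (\<exists>l\<in>q n. if snd l then A' b \<subseteq> fst l else A' b \<inter> fst l = {}))" for n A A'
    have "\<exists>A. \<forall>n. Pr n (A n) \<and> Qr n (A n) (A (Suc n))"
    proof (rule dependent_nat_choice)
      show "\<exists>A. Pr 0 A" using ns A0 by (auto simp: Pr_def)
      fix A n assume "Pr n A"
      then have A: "\<And>i. A i \<in> sets Z" "\<not> separated X f {{}} UNIV A" by (simp_all add: Pr_def)
      obtain A' where "\<forall>i\<in>UNIV. A' i \<in> sets Z \<and> A' i \<subseteq> A i \<and> (A' i \<subseteq> e n \<or> A' i \<inter> e n = {}) \<and>
          (\<exists>l\<in>q n. if snd l then A' i \<subseteq> fst l else A' i \<inter> fst l = {})"
        "\<not> separated X f {{}} UNIV A'"
        by (rule separated_refine[OF finite A(1) eq(2)[of n] eq(4)[of n] eq(5)[of _ n] eq(6)[of _ n] A(2)])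
      then show "\<exists>A'. Pr (Suc n) A' \<and> Qr n A A'" unfolding Pr_def Qr_def by (intro exI[of _ A']) simp
    qed
    then obtain A where "\<forall>n. Pr n (A n) \<and> Qr n (A n) (A (Suc n))" ..
    then have A: "\<And>n. Pr n (A n)" "\<And>n. Qr n (A n) (A (Suc n))" by simp_all
    have sets: "A n b \<in> sets Z" and nsep: "\<not> separated X f {{}} UNIV (A n)" for n b
      using A(1)[of n] unfolding Pr_def by blast+
    have sp: "A n b \<subseteq> space Z" for n b using sets by (rule sets.sets_into_space)
    have ne: "A n b \<noteq> {}" for n b using nsep[of n] separated_of_empty[of b UNIV "A n"] sp by auto
    have mono: "A m b \<subseteq> A n b" if "n \<le> m" for m n b
      using lift_Suc_antimono_le[of "\<lambda>n. A n b", OF _ that] A(2) by (simp add: Qr_def)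
    have "\<exists>z. z \<in> space Z \<and> (\<forall>B\<in>\<U>. (z \<in> B \<longleftrightarrow> (\<exists>n. A n b \<subseteq> B)) \<and> (z \<notin> B \<longleftrightarrow> (\<exists>n. A n b \<inter> B = {})))" for b
    proof -
      have 1: "A (Suc n) b \<subseteq> A n b" for n using A(2)[of n] by (simp add: Qr_def)
      have 2: "\<exists>n. A n b \<subseteq> B \<or> A n b \<inter> B = {}" if "B \<in> \<U>" for B
      proof -
        obtain n where "B = e n" using eq(1) \<open>B \<in> \<U>\<close> by blast
        then show ?thesis using A(2)[of n] unfolding Qr_def by blast
      qed
      have 3: "\<exists>n. \<exists>l\<in>D. if snd l then A n b \<subseteq> fst l else A n b \<inter> fst l = {}" if "D \<in> \<Q>" for D
      proof -
        obtain n where "D = q n" using eq(3) \<open>D \<in> \<Q>\<close> by blast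
        then show ?thesis using A(2)[of n] unfolding Qr_def by blast
      qed
      show ?thesis
        by (rule coding_limit[OF cod, of "\<lambda>n. A n b", OF 1 ne sp 2 3])
    qed
    then have "\<forall>b. \<exists>z. z \<in> space Z \<and> (\<forall>B\<in>\<U>. (z \<in> B \<longleftrightarrow> (\<exists>n. A n b \<subseteq> B)) \<and> (z \<notin> B \<longleftrightarrow> (\<exists>n. A n b \<inter> B = {})))" ..
    from choice[OF this] obtain z where
      "\<forall>b. z b \<in> space Z \<and> (\<forall>B\<in>\<U>. (z b \<in> B \<longleftrightarrow> (\<exists>n. A n b \<subseteq> B)) \<and> (z b \<notin> B \<longleftrightarrow> (\<exists>n. A n b \<inter> B = {})))" ..
    then have z: "\<And>b. z b \<in> space Z" "\<And>b B. B \<in> \<U> \<Longrightarrow> z b \<in> B \<longleftrightarrow> (\<exists>n. A n b \<subseteq> B)"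
        "\<And>b B. B \<in> \<U> \<Longrightarrow> z b \<notin> B \<longleftrightarrow> (\<exists>n. A n b \<inter> B = {})" by meson+
    have zA: "z b \<in> A0 b" for b
    proof -
      have "A 0 b \<subseteq> A0 b" using A(1)[of 0] by (simp add: Pr_def)
      then show ?thesis using z(2)[OF A0(2)] by blast
    qed
    have ff: "f (z b) \<in> V \<longrightarrow> f (z c) \<in> V" if "V \<in> \<V>" "b \<noteq> c" for V b c
    proof (intro impI, rule ccontr)
      assume as: "f (z b) \<in> V" "f (z c) \<notin> V"
      have pV: "pre V \<in> \<U>" using sub that(1) by blast
      obtain n m where nm: "A n b \<subseteq> pre V" "A m c \<inter> pre V = {}"
        using z(2)[OF pV, of b] z(3)[OF pV, of c] z(1) as by (auto simp: pre_def)
      have "separated X f {{}} UNIV (A (max n m))"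
      proof (rule separated_of_disjoint_images[of b _ c V])
        show "V \<in> sets X" using that(1) separatingD(2)[OF V] by blast
        show "A (max n m) b \<subseteq> f -` V" using nm(1) mono[of n "max n m" b] by (auto simp: pre_def)
        show "A (max n m) c \<inter> f -` V = {}"
          using nm(2) mono[of m "max n m" c] sp[of "max n m" c] by (auto simp: pre_def)
      qed (use that sp in auto)
      then show False using nsep by blast
    qed
    have "f (z True) = f (z False)"
    proof (rule separatingD(3)[OF V])
      show "f (z True) \<in> V \<longleftrightarrow> f (z False) \<in> V" if "V \<in> \<V>" for V
        using ff[OF that, of True False] ff[OF that, of False True] by auto
    qed (use z(1) measurable_space[OF f] in auto)
    moreover have "z True \<in> C1" "z False \<in> C2" using zA[of True] zA[of False] by (auto simp: A0_def)
    ultimately show False using C(3) by (metis IntI empty_iff imageI)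
  qed
  then obtain B where "(\<forall>b\<in>UNIV. B b \<in> sets X \<and> f ` (A0 b - {}) \<subseteq> B b) \<and> (\<Inter>b\<in>UNIV. B b) = {}"
    unfolding separated_def by (elim bexE exE) simp
  then have B: "\<And>b. B b \<in> sets X" "\<And>b. f ` A0 b \<subseteq> B b" "(\<Inter>b. B b) = {}" by simp_all
  have "f ` C1 \<subseteq> B True" "f ` C2 \<subseteq> B False" using B(2)[of True] B(2)[of False] by (auto simp: A0_def)
  moreover have "B True \<inter> B False = {}" using B(3) by (auto simp: UNIV_bool)
  ultimately show ?thesis using B(1)[of True] by blast
qed

text \<open>The separating sets \<open>S B\<close> recover from a point \<open>x\<close> of the image the valuation of its unique
  preimage.\<close>

lemma inj_image_sets:
  assumes Z: "coded Z" and f: "f \<in> Z \<rightarrow>\<^sub>M X" and V: "separating X \<V>"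
    and C: "C \<in> sets Z" and inj: "inj_on f C"
  shows "f ` C \<in> sets X"
proof -
  define pre where "pre V = f -` V \<inter> space Z" for V
  have "countable ({C} \<union> pre ` \<V>)" using separatingD(1)[OF V] by simp
  moreover have "{C} \<union> pre ` \<V> \<subseteq> sets Z"
    using C measurable_sets[OF f] separatingD(2)[OF V] by (auto simp: pre_def)
  ultimately obtain \<U> \<Q> where sub: "{C} \<union> pre ` \<V> \<subseteq> \<U>" and cod: "coding Z \<U> \<Q>"
    by (rule codedD[OF Z])
  have "\<exists>S. S \<in> sets X \<and> f ` (C \<inter> B) \<subseteq> S \<and> S \<inter> f ` (C - B) = {}" if "B \<in> \<U>" for B
  proof -
    have "B \<in> sets Z" using codingD(2)[OF cod] that by blast
    moreover have "f ` (C \<inter> B) \<inter> f ` (C - B) = {}" using inj by (auto simp: inj_on_def)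
    ultimately show ?thesis
      using disjoint_images_separation[OF Z f V, of "C \<inter> B" "C - B"] C by auto
  qed
  then have "\<forall>B\<in>\<U>. \<exists>S. S \<in> sets X \<and> f ` (C \<inter> B) \<subseteq> S \<and> S \<inter> f ` (C - B) = {}" by blast
  from bchoice[OF this] obtain S
    where S: "\<forall>B\<in>\<U>. S B \<in> sets X \<and> f ` (C \<inter> B) \<subseteq> S B \<and> S B \<inter> f ` (C - B) = {}" ..
  have Siff: "f z \<in> S B \<longleftrightarrow> z \<in> B" if "z \<in> C" "B \<in> \<U>" for z B
    using S that by blast
  have meas: "{x \<in> space X. x \<in> T} \<in> sets X" if "T \<in> sets X" for T
  proof -
    have "{x \<in> space X. x \<in> T} = space X \<inter> T" by auto
    then show ?thesis using that by auto
  qed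
  \<comment> \<open>The first condition makes the valuation read off from \<open>x\<close>
    realisable by some \<open>z\<close>, the second forces \<open>f z = x\<close>, and the third
    puts \<open>z\<close> into \<open>C\<close>.\<close>
  have "f ` C = {x \<in> space X. (\<forall>D\<in>\<Q>. \<exists>l\<in>D. (x \<in> S (fst l)) = snd l) \<and>
      (\<forall>V\<in>\<V>. (x \<in> S (pre V)) = (x \<in> V)) \<and> x \<in> S C}" (is "_ = ?R")
  proof (intro equalityI subsetI)
    fix x assume "x \<in> f ` C"
    then obtain z where z: "z \<in> C" "x = f z" by blast
    have zZ: "z \<in> space Z" using z(1) sets.sets_into_space[OF C] by blast
    have "\<exists>l\<in>D. (x \<in> S (fst l)) = snd l" if "D \<in> \<Q>" for D
    proof -
      obtain l where l: "l \<in> D" "(z \<in> fst l) = snd l" using codingD(5)[OF cod zZ \<open>D \<in> \<Q>\<close>] by blast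
      then have "fst l \<in> \<U>" using subsetD[OF codingD(4)[OF cod \<open>D \<in> \<Q>\<close>], of l] by (simp add: mem_Times_iff)
      then show ?thesis using Siff[OF z(1)] l z(2) by auto
    qed
    moreover have "(x \<in> S (pre V)) = (x \<in> V)" if "V \<in> \<V>" for V
      using Siff[OF z(1), of "pre V"] sub that zZ z(2) by (auto simp: pre_def)
    moreover have "x \<in> S C" using Siff[OF z(1), of C] sub z by auto
    moreover have "x \<in> space X" using measurable_space[OF f zZ] z(2) by simp
    ultimately show "x \<in> ?R" by blast
  next
    fix x assume x: "x \<in> ?R"
    obtain z where z: "z \<in> space Z" "\<forall>B\<in>\<U>. (x \<in> S B) = (z \<in> B)"
      using codingD(6)[OF cod, of "\<lambda>B. x \<in> S B"] x by auto
    have "z \<in> C" using z(2) sub x by auto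
    moreover have "f z = x"
    proof (rule separatingD(3)[OF V])
      show "f z \<in> space X" "x \<in> space X" using measurable_space[OF f z(1)] x by auto
      show "f z \<in> V \<longleftrightarrow> x \<in> V" if "V \<in> \<V>" for V
      proof -
        have "(x \<in> S (pre V)) = (z \<in> pre V)" using z(2) sub that by blast
        moreover have "(x \<in> S (pre V)) = (x \<in> V)" using x that by simp
        ultimately show ?thesis using z(1) by (simp add: pre_def)
      qed
    qed
    ultimately show "x \<in> f ` C" by blast
  qed
  also have "?R \<in> sets X"
  proof -
    have iff: "{x \<in> space X. (x \<in> T) = b} \<in> sets X" if "T \<in> sets X" for T b
      using meas[OF that] sets.sets_Collect_neg[OF meas[OF that]] by (cases b) auto
    have 1: "{x \<in> space X. \<forall>D\<in>\<Q>. \<exists>l\<in>D. (x \<in> S (fst l)) = snd l} \<in> sets X"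
    proof (intro sets.sets_Collect_countable_All' sets.sets_Collect_countable_Ex' iff)
      fix D assume D: "D \<in> \<Q>"
      show "countable D"
        by (rule countable_subset[OF codingD(4)[OF cod D]]) (simp add: codingD(1)[OF cod])
      show "S (fst l) \<in> sets X" if "l \<in> D" for l
        using subsetD[OF codingD(4)[OF cod D] that] S by (simp add: mem_Times_iff)
    qed (rule codingD(3)[OF cod])
    have 2: "{x \<in> space X. \<forall>V\<in>\<V>. (x \<in> S (pre V)) = (x \<in> V)} \<in> sets X"
    proof (intro sets.sets_Collect_countable_All')
      fix V assume V': "V \<in> \<V>"
      have "pre V \<in> \<U>" using sub V' by blast
      then have "S (pre V) \<in> sets X" "V \<in> sets X" using S V' subsetD[OF separatingD(2)[OF V]] by simp_all
      note m = meas[OF this(1)] meas[OF this(2)]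
      have "{x \<in> space X. (x \<in> S (pre V)) = (x \<in> V)} =
        {x \<in> space X. (x \<in> S (pre V) \<and> x \<in> V) \<or> (\<not> x \<in> S (pre V) \<and> \<not> x \<in> V)}" by auto
      also have "\<dots> \<in> sets X"
        using m by (intro sets.sets_Collect_disj sets.sets_Collect_conj sets.sets_Collect_neg)
      finally show "{x \<in> space X. (x \<in> S (pre V)) = (x \<in> V)} \<in> sets X" .
    qed (rule separatingD(1)[OF V])
    have "S C \<in> sets X" using S sub by simp
    show ?thesis by (intro sets.sets_Collect_conj 1 2 meas \<open>S C \<in> sets X\<close>)
  qed
  finally show ?thesis .
qed

lemma uncountable_UNIV_nat_bool: "uncountable (UNIV :: (nat \<Rightarrow> bool) set)"
proof
  assume "countable (UNIV :: (nat \<Rightarrow> bool) set)"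
  then have "range (from_nat_into (UNIV :: (nat \<Rightarrow> bool) set)) = UNIV" by (intro range_from_nat_into) simp
  then obtain n where "from_nat_into UNIV n = (\<lambda>n. \<not> from_nat_into UNIV n n)" by (metis rangeE UNIV_I)
  then show False by meson
qed

text \<open>If \<open>R\<close> were not covered by countably many Borel sets on which \<open>f\<close> is injective, a binary tree of
  inseparable pieces would yield a Cantor set of points in one fibre of \<open>f\<close>.\<close>

theorem countable_to_one_decomposition:
  assumes Z: "coded Z" and f: "f \<in> Z \<rightarrow>\<^sub>M X" and V: "separating X \<V>"
    and R: "R \<in> sets Z" and fib: "\<And>x. countable {z \<in> R. f z = x}"
  obtains C :: "nat \<Rightarrow> 'a set" where "\<And>n. C n \<in> sets Z" "\<And>n. inj_on f (C n)" "R = (\<Union>n. C n)"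
proof -
  define pre where "pre V = f -` V \<inter> space Z" for V
  have "countable ({R} \<union> pre ` \<V>)" using separatingD(1)[OF V] by simp
  moreover have "{R} \<union> pre ` \<V> \<subseteq> sets Z"
    using R measurable_sets[OF f] separatingD(2)[OF V] by (auto simp: pre_def)
  ultimately obtain \<U> \<Q> where sub: "{R} \<union> pre ` \<V> \<subseteq> \<U>" and cod: "coding Z \<U> \<Q>"
    by (rule codedD[OF Z])
  obtain e :: "nat \<Rightarrow> 'a set" and q :: "nat \<Rightarrow> ('a set \<times> bool) set" where eq0: "\<U> \<subseteq> range e" "\<forall>n. e n \<in> sets Z" "\<Q> \<subseteq> range q" "\<forall>n. countable (q n)"
    "\<forall>n. \<forall>l\<in>q n. fst l \<in> sets Z" "\<forall>n. \<forall>z\<in>space Z. \<exists>l\<in>q n. (z \<in> fst l) = snd l"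
    by (rule coding_enum[OF cod])
  note eq = eq0(1) eq0(2)[rule_format] eq0(3) eq0(4-6)[rule_format]
  define \<N> where "\<N> = {\<Union>\<C> | \<C>. countable \<C> \<and> \<C> \<subseteq> {C \<in> sets Z. inj_on f C}}"
  have \<N>_sets: "\<N> \<subseteq> sets Z"
  proof
    fix N assume "N \<in> \<N>"
    then obtain \<C> where \<C>: "N = \<Union>\<C>" "countable \<C>" "\<C> \<subseteq> {C \<in> sets Z. inj_on f C}" by (auto simp: \<N>_def)
    have "\<C> \<subseteq> sets Z" using \<C>(3) by blast
    then show "N \<in> sets Z" unfolding \<C>(1) using \<C>(2) by (intro sets.countable_Union)
  qed
  have \<N>_inj: "C \<in> \<N>" if "C \<in> sets Z" "inj_on f C" for C
    unfolding \<N>_def using that by (intro CollectI exI[of _ "{C}"]) simp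
  interpret small_sets Z X f \<N>
  proof
    fix \<A> assume \<A>: "countable \<A>" "\<A> \<subseteq> \<N>"
    then have "\<forall>A\<in>\<A>. \<exists>\<C>. A = \<Union>\<C> \<and> countable \<C> \<and> \<C> \<subseteq> {C \<in> sets Z. inj_on f C}" by (auto simp: \<N>_def)
    from bchoice[OF this] obtain \<C>
      where \<C>: "\<forall>A\<in>\<A>. A = \<Union>(\<C> A) \<and> countable (\<C> A) \<and> \<C> A \<subseteq> {C \<in> sets Z. inj_on f C}" ..
    have "(\<lambda>A. \<Union>(\<C> A)) ` \<A> = id ` \<A>" using \<C> by (intro image_cong) simp_all
    then have "\<Union>\<A> = (\<Union>A\<in>\<A>. \<Union>(\<C> A))" by simp
    also have "\<dots> = \<Union>(\<Union>(\<C> ` \<A>))" by blast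
    finally have "\<Union>\<A> = \<Union>(\<Union>(\<C> ` \<A>))" .
    moreover have "countable (\<Union>(\<C> ` \<A>))" using \<A>(1) \<C> by simp
    moreover have "\<Union>(\<C> ` \<A>) \<subseteq> {C \<in> sets Z. inj_on f C}" using \<C> by (intro UN_least) simp
    ultimately show "\<Union>\<A> \<in> \<N>" unfolding \<N>_def by (intro CollectI exI[of _ "\<Union>(\<C> ` \<A>)"] conjI)
  qed (rule f)
  have empty: "{} \<in> \<N>" by (rule \<N>_inj) auto
  define I where "I n = {u :: bool list. length u = n}" for n
  have fI: "finite (I n)" for n unfolding I_def using finite_lists_length_eq[of "UNIV :: bool set" n] by simp
  define A0 where "A0 = (\<lambda>u :: bool list. R)"
  \<comment> \<open>Level 0 has the empty list as its only index, so the intersection of separators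
    is a single set, which must be empty. Separation then says that \<open>R\<close> is covered by a
    member of \<N>.\<close>
  have "separated X f \<N> (I 0) A0"
  proof (rule ccontr)
    assume ns: "\<not> separated X f \<N> (I 0) A0"
    define Pr where "Pr n A \<longleftrightarrow> (\<forall>u\<in>I n. A u \<in> sets Z) \<and> \<not> separated X f \<N> (I n) A \<and> (n = 0 \<longrightarrow> A = A0)" for n A
    \<comment> \<open>The first conjunct makes every branch converge. The second has a basic set
      tell the two children of each node apart, so that different branches have different
      limits.\<close>
    define Qr where "Qr n A A' \<longleftrightarrow>
      (\<forall>u\<in>I (Suc n). A' u \<subseteq> A (butlast u) \<and> (A' u \<subseteq> e n \<or> A' u \<inter> e n = {}) \<and>
      (\<exists>l\<in>q n. if snd l then A' u \<subseteq> fst l else A' u \<inter> fst l = {})) \<and>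
      (\<forall>u\<in>I n. \<exists>B\<in>\<U>. A' (u @ [True]) \<subseteq> B \<and> A' (u @ [False]) \<inter> B = {})" for n A A'
    have "\<exists>A. \<forall>n. Pr n (A n) \<and> Qr n (A n) (A (Suc n))"
    proof (rule dependent_nat_choice)
      show "\<exists>A. Pr 0 A" using ns R by (intro exI[of _ A0]) (simp add: Pr_def A0_def)
      fix A n assume "Pr n A"
      then have A: "\<And>u. length u = n \<Longrightarrow> A u \<in> sets Z" "\<not> separated X f \<N> {u. length u = n} A"
        by (simp_all add: Pr_def I_def)
      obtain \<beta> where \<beta>0: "\<forall>u. length u = n \<longrightarrow> \<beta> u \<in> \<U>" "\<not> separated X f \<N> {u. length u = Suc n}
          (\<lambda>u. if last u then A (butlast u) \<inter> \<beta> (butlast u) else A (butlast u) - \<beta> (butlast u))"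
        by (rule separated_split[OF \<N>_sets \<N>_inj A(1) codingD(1,2,7)[OF cod] A(2)])
      note \<beta> = \<beta>0(1)[rule_format] \<beta>0(2)
      define A1 where "A1 u = (if last u then A (butlast u) \<inter> \<beta> (butlast u) else A (butlast u) - \<beta> (butlast u))" for u
      have A1: "A1 u \<in> sets Z" if "u \<in> I (Suc n)" for u
      proof -
        have "length (butlast u) = n" using that by (simp add: I_def)
        then have "A (butlast u) \<in> sets Z" "\<beta> (butlast u) \<in> sets Z"
          using A(1) \<beta>(1) subsetD[OF codingD(2)[OF cod]] by simp_all
        then show ?thesis by (simp add: A1_def sets.Int sets.Diff)
      qed
      have A1ns: "\<not> separated X f \<N> (I (Suc n)) A1" using \<beta>(2) unfolding I_def A1_def .
      obtain A' where A'0: "\<forall>i\<in>I (Suc n). A' i \<in> sets Z \<and> A' i \<subseteq> A1 i \<and> (A' i \<subseteq> e n \<or> A' i \<inter> e n = {}) \<and>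
          (\<exists>l\<in>q n. if snd l then A' i \<subseteq> fst l else A' i \<inter> fst l = {})"
        and A'ns: "\<not> separated X f \<N> (I (Suc n)) A'"
        by (rule separated_refine[OF fI A1 eq(2)[of n] eq(4)[of n] eq(5)[of _ n] eq(6)[of _ n] A1ns])
      have A': "A' i \<in> sets Z" "A' i \<subseteq> A1 i" "A' i \<subseteq> e n \<or> A' i \<inter> e n = {}"
          "\<exists>l\<in>q n. if snd l then A' i \<subseteq> fst l else A' i \<inter> fst l = {}" if "i \<in> I (Suc n)" for i
        using bspec[OF A'0 that] by blast+
      have "Qr n A A'"
        unfolding Qr_def
      proof (intro conjI ballI)
        fix u assume u: "u \<in> I (Suc n)"
        show "A' u \<subseteq> A (butlast u)" using A'(2)[OF u] by (auto simp: A1_def split: if_splits)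
        show "A' u \<subseteq> e n \<or> A' u \<inter> e n = {}"
          "\<exists>l\<in>q n. if snd l then A' u \<subseteq> fst l else A' u \<inter> fst l = {}" by (rule A'(3,4)[OF u])+
      next
        fix u assume u: "u \<in> I n"
        then have "A' (u @ [True]) \<subseteq> A1 (u @ [True])" "A' (u @ [False]) \<subseteq> A1 (u @ [False])"
          by (intro A'(2), simp add: I_def)+
        then have "A' (u @ [True]) \<subseteq> \<beta> u" "A' (u @ [False]) \<inter> \<beta> u = {}" by (auto simp: A1_def)
        moreover have "\<beta> u \<in> \<U>" using u \<beta>(1) by (simp add: I_def)
        ultimately show "\<exists>B\<in>\<U>. A' (u @ [True]) \<subseteq> B \<and> A' (u @ [False]) \<inter> B = {}" by blast
      qed
      then show "\<exists>A'. Pr (Suc n) A' \<and> Qr n A A'"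
        using A'(1) A'ns unfolding Pr_def by (intro exI[of _ A']) simp
    qed
    then obtain A where "\<forall>n. Pr n (A n) \<and> Qr n (A n) (A (Suc n))" ..
    then have A: "\<And>n. Pr n (A n)" "\<And>n. Qr n (A n) (A (Suc n))" by simp_all
    have sets: "u \<in> I n \<Longrightarrow> A n u \<in> sets Z" and nsep: "\<not> separated X f \<N> (I n) (A n)" for n u
      using A(1)[of n] unfolding Pr_def by blast+
    have sp: "A n u \<subseteq> space Z" if "u \<in> I n" for n u using sets[OF that] by (rule sets.sets_into_space)
    have ne: "A n u \<noteq> {}" if "u \<in> I n" for n u
      using nsep[of n] separated_of_empty[OF that _ empty, of "A n"] sp by blast
    define s where "s \<alpha> n = map \<alpha> [0..<n]" for \<alpha> :: "nat \<Rightarrow> bool" and n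
    have sI: "s \<alpha> n \<in> I n" for \<alpha> n by (simp add: s_def I_def)
    have sS: "s \<alpha> (Suc n) = s \<alpha> n @ [\<alpha> n]" for \<alpha> n by (simp add: s_def)
    define a where "a \<alpha> n = A n (s \<alpha> n)" for \<alpha> n
    have aS: "a \<alpha> (Suc n) \<subseteq> a \<alpha> n" "a \<alpha> (Suc n) \<subseteq> e n \<or> a \<alpha> (Suc n) \<inter> e n = {}"
       "\<exists>l\<in>q n. if snd l then a \<alpha> (Suc n) \<subseteq> fst l else a \<alpha> (Suc n) \<inter> fst l = {}" for \<alpha> n
    proof -
      have "butlast (s \<alpha> (Suc n)) = s \<alpha> n" by (simp add: sS)
      then show "a \<alpha> (Suc n) \<subseteq> a \<alpha> n" "a \<alpha> (Suc n) \<subseteq> e n \<or> a \<alpha> (Suc n) \<inter> e n = {}"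
       "\<exists>l\<in>q n. if snd l then a \<alpha> (Suc n) \<subseteq> fst l else a \<alpha> (Suc n) \<inter> fst l = {}"
        using bspec[OF conjunct1[OF A(2)[of n, unfolded Qr_def]] sI[of \<alpha> "Suc n"]] unfolding a_def
        by simp_all
    qed
    have amono: "a \<alpha> m \<subseteq> a \<alpha> n" if "n \<le> m" for m n \<alpha>
      using lift_Suc_antimono_le[of "a \<alpha>", OF aS(1) that] .
    have asp: "a \<alpha> n \<subseteq> space Z" and ane: "a \<alpha> n \<noteq> {}" for \<alpha> n
      using sp[OF sI] ne[OF sI] by (simp_all add: a_def)
    have "\<exists>z. z \<in> space Z \<and> (\<forall>B\<in>\<U>. (z \<in> B \<longleftrightarrow> (\<exists>n. a \<alpha> n \<subseteq> B)) \<and> (z \<notin> B \<longleftrightarrow> (\<exists>n. a \<alpha> n \<inter> B = {})))" for \<alpha>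
    proof -
      have 2: "\<exists>n. a \<alpha> n \<subseteq> B \<or> a \<alpha> n \<inter> B = {}" if "B \<in> \<U>" for B
      proof -
        obtain n where "B = e n" using eq(1) \<open>B \<in> \<U>\<close> by blast
        then show ?thesis using aS(2)[of \<alpha> n] by blast
      qed
      have 3: "\<exists>n. \<exists>l\<in>D. if snd l then a \<alpha> n \<subseteq> fst l else a \<alpha> n \<inter> fst l = {}" if "D \<in> \<Q>" for D
      proof -
        obtain n where "D = q n" using eq(3) \<open>D \<in> \<Q>\<close> by blast
        then show ?thesis using aS(3)[of n \<alpha>] by blast
      qed
      show ?thesis by (rule coding_limit[OF cod, of "a \<alpha>", OF aS(1) ane asp 2 3])
    qed
    then have "\<forall>\<alpha>. \<exists>z. z \<in> space Z \<and>
        (\<forall>B\<in>\<U>. (z \<in> B \<longleftrightarrow> (\<exists>n. a \<alpha> n \<subseteq> B)) \<and> (z \<notin> B \<longleftrightarrow> (\<exists>n. a \<alpha> n \<inter> B = {})))" ..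
    from choice[OF this] obtain z where
      "\<forall>\<alpha>. z \<alpha> \<in> space Z \<and> (\<forall>B\<in>\<U>. (z \<alpha> \<in> B \<longleftrightarrow> (\<exists>n. a \<alpha> n \<subseteq> B)) \<and> (z \<alpha> \<notin> B \<longleftrightarrow> (\<exists>n. a \<alpha> n \<inter> B = {})))" ..
    then have z: "\<And>\<alpha>. z \<alpha> \<in> space Z" "\<And>\<alpha> B. B \<in> \<U> \<Longrightarrow> z \<alpha> \<in> B \<longleftrightarrow> (\<exists>n. a \<alpha> n \<subseteq> B)"
        "\<And>\<alpha> B. B \<in> \<U> \<Longrightarrow> z \<alpha> \<notin> B \<longleftrightarrow> (\<exists>n. a \<alpha> n \<inter> B = {})" by meson+
    have RU: "R \<in> \<U>" using sub by simp
    have zR: "z \<alpha> \<in> R" for \<alpha>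
    proof -
      have "a \<alpha> 0 \<subseteq> R" using A(1)[of 0] by (simp add: Pr_def a_def A0_def)
      then show ?thesis using z(2)[OF RU] by blast
    qed
    have s_neq: "s \<alpha> n \<noteq> s \<beta> n" if "m < n" "\<alpha> m \<noteq> \<beta> m" for \<alpha> \<beta> m n
      using that by (auto simp: s_def)
    have ff: "f (z \<alpha>) \<in> V \<longrightarrow> f (z \<beta>) \<in> V" if V': "V \<in> \<V>" for V \<alpha> \<beta>
    proof (intro impI, rule ccontr)
      assume as: "f (z \<alpha>) \<in> V" "f (z \<beta>) \<notin> V"
      then have "\<alpha> \<noteq> \<beta>" by blast
      then obtain k where k: "\<alpha> k \<noteq> \<beta> k" by blast
      have pV: "pre V \<in> \<U>" using sub V' by blast
      have "z \<alpha> \<in> pre V" "z \<beta> \<notin> pre V" using as z(1) by (simp_all add: pre_def)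
      then obtain n m where nm: "a \<alpha> n \<subseteq> pre V" "a \<beta> m \<inter> pre V = {}"
        using z(2)[OF pV, of \<alpha>] z(3)[OF pV, of \<beta>] by blast
      \<comment> \<open>At least \<open>Suc k\<close>, so that the two branches pass through
        different nodes of level \<open>N\<close>; \<open>separated_of_disjoint_images\<close> needs
        distinct indices.\<close>
      define N where "N = max (Suc k) (max n m)"
      have N: "k < N" "n \<le> N" "m \<le> N" by (auto simp: N_def)
      have "separated X f \<N> (I N) (A N)"
      proof (rule separated_of_disjoint_images[where i = "s \<alpha> N" and j = "s \<beta> N" and V = V])
        show "V \<in> sets X" using subsetD[OF separatingD(2)[OF V] V'] .
        show "A N (s \<alpha> N) \<subseteq> f -` V" using nm(1) amono[OF N(2), of \<alpha>] by (auto simp: pre_def a_def)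
        show "A N (s \<beta> N) \<inter> f -` V = {}"
          using nm(2) amono[OF N(3), of \<beta>] asp[of \<beta> N] by (auto simp: pre_def a_def)
        show "s \<alpha> N \<noteq> s \<beta> N" by (rule s_neq[where \<alpha> = \<alpha> and \<beta> = \<beta>, OF N(1) k])
      qed (rule sI empty sp, assumption?)+
      then show False using nsep by blast
    qed
    have fz: "f (z \<alpha>) = f (z \<beta>)" for \<alpha> \<beta>
    proof (rule separatingD(3)[OF V])
      show "f (z \<alpha>) \<in> V \<longleftrightarrow> f (z \<beta>) \<in> V" if "V \<in> \<V>" for V
        using ff[OF that, of \<alpha> \<beta>] ff[OF that, of \<beta> \<alpha>] by blast
    qed (rule measurable_space[OF f z(1)])+
    have zneq: "z \<alpha> \<noteq> z \<beta>" if n: "\<alpha> n" "\<not> \<beta> n" "\<And>i. i < n \<Longrightarrow> \<alpha> i = \<beta> i" for \<alpha> \<beta> n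
    proof -
      have "s \<alpha> n = s \<beta> n" using n(3) by (simp add: s_def)
      then have "s \<alpha> (Suc n) = s \<alpha> n @ [True]" "s \<beta> (Suc n) = s \<alpha> n @ [False]" using n by (simp_all add: sS)
      moreover obtain B where B: "B \<in> \<U>" "A (Suc n) (s \<alpha> n @ [True]) \<subseteq> B" "A (Suc n) (s \<alpha> n @ [False]) \<inter> B = {}"
        using A(2)[of n] sI[of \<alpha> n] unfolding Qr_def by blast
      ultimately have "a \<alpha> (Suc n) \<subseteq> B" "a \<beta> (Suc n) \<inter> B = {}" by (simp_all add: a_def)
      then have "z \<alpha> \<in> B" "z \<beta> \<notin> B" using z(2,3)[OF B(1)] by blast+
      then show ?thesis by metis
    qed
    have "inj z"
    proof (rule injI, rule ccontr)
      fix \<alpha> \<beta> assume zz: "z \<alpha> = z \<beta>" and "\<alpha> \<noteq> \<beta>"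
      then have ex: "\<exists>n. \<alpha> n \<noteq> \<beta> n" by blast
      define n where "n = (LEAST n. \<alpha> n \<noteq> \<beta> n)"
      have n: "\<alpha> n \<noteq> \<beta> n" unfolding n_def by (rule LeastI_ex[OF ex])
      have "\<alpha> i = \<beta> i" if "i < n" for i using not_less_Least[of i "\<lambda>n. \<alpha> n \<noteq> \<beta> n"] that by (simp add: n_def)
      then show False using zneq[of \<alpha> n \<beta>] zneq[of \<beta> n \<alpha>] n zz by metis
    qed
    moreover have "countable (range z)"
      by (rule countable_subset[OF _ fib[of "f (z undefined)"]]) (use zR fz in blast)
    ultimately show False using uncountable_UNIV_nat_bool countable_image_inj_on by blast
  qed
  then obtain N B where NB: "N \<in> \<N>" "(\<forall>i\<in>I 0. B i \<in> sets X \<and> f ` (A0 i - N) \<subseteq> B i) \<and> (\<Inter>i\<in>I 0. B i) = {}"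
    unfolding separated_def by (elim bexE exE)
  have "f ` (R - N) \<subseteq> {}" using NB(2) by (auto simp: I_def A0_def)
  then have RN: "R \<subseteq> N" by blast
  obtain \<C> where \<C>: "N = \<Union>\<C>" "countable \<C>" "\<C> \<subseteq> {C \<in> sets Z. inj_on f C}"
    using NB(1) by (auto simp: \<N>_def)
  define C where "C n = R \<inter> from_nat_into (insert {} \<C>) n" for n
  have rng: "range (from_nat_into (insert {} \<C>)) = insert {} \<C>"
    using \<C>(2) by (intro range_from_nat_into) simp_all
  have mem: "from_nat_into (insert {} \<C>) n \<in> sets Z \<and> inj_on f (from_nat_into (insert {} \<C>) n)" for n
  proof -
    have "from_nat_into (insert {} \<C>) n \<in> insert {} \<C>" using rng by blast
    then show ?thesis using \<C>(3) by (elim insertE) auto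
  qed
  show thesis
  proof
    show "C n \<in> sets Z" for n using mem R by (simp add: C_def sets.Int)
    show "inj_on f (C n)" for n unfolding C_def by (rule inj_on_subset[OF conjunct2[OF mem]]) blast
    have "(\<Union>n. C n) = R \<inter> \<Union>(range (from_nat_into (insert {} \<C>)))" by (auto simp: C_def)
    also have "\<dots> = R" unfolding rng using RN \<C>(1) by auto
    finally show "R = (\<Union>n. C n)" ..
  qed
qed

section \<open>The Feldman--Moore involutions\<close>

text \<open>The clauses of the factors are transported to cylinders. A valuation of the cylinders
  restricts to one on each factor, and the points realising these two are the coordinates of the
  required point.\<close>

lemma coding_pair:
  assumes c1: "coding X \<U>\<^sub>1 \<Q>\<^sub>1" and c2: "coding Y \<U>\<^sub>2 \<Q>\<^sub>2"
  shows "\<exists>\<Q>. coding (X \<Otimes>\<^sub>M Y) ((\<lambda>B. B \<times> space Y) ` \<U>\<^sub>1 \<union> (\<lambda>B. space X \<times> B) ` \<U>\<^sub>2) \<Q>"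
proof -
  define i where "i B = B \<times> space Y" for B :: "'a set"
  define j where "j B = space X \<times> B" for B :: "'b set"
  define \<Q> where "\<Q> = (\<lambda>C. map_prod i id ` C) ` \<Q>\<^sub>1 \<union> (\<lambda>C. map_prod j id ` C) ` \<Q>\<^sub>2"
  have "coding (X \<Otimes>\<^sub>M Y) (i ` \<U>\<^sub>1 \<union> j ` \<U>\<^sub>2) \<Q>"
  proof (rule codingI)
    show "countable (i ` \<U>\<^sub>1 \<union> j ` \<U>\<^sub>2)" "countable \<Q>"
      using codingD(1,3)[OF c1] codingD(1,3)[OF c2] by (simp_all add: \<Q>_def)
    have "i B \<in> sets (X \<Otimes>\<^sub>M Y)" if "B \<in> \<U>\<^sub>1" for B
      using subsetD[OF codingD(2)[OF c1] that] by (simp add: i_def)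
    moreover have "j B \<in> sets (X \<Otimes>\<^sub>M Y)" if "B \<in> \<U>\<^sub>2" for B
      using subsetD[OF codingD(2)[OF c2] that] by (simp add: j_def)
    ultimately show "i ` \<U>\<^sub>1 \<union> j ` \<U>\<^sub>2 \<subseteq> sets (X \<Otimes>\<^sub>M Y)" by blast
  next
    fix C assume "C \<in> \<Q>"
    then consider C' where "C' \<in> \<Q>\<^sub>1" "C = map_prod i id ` C'" | C' where "C' \<in> \<Q>\<^sub>2" "C = map_prod j id ` C'"
      unfolding \<Q>_def by blast
    then show "C \<subseteq> (i ` \<U>\<^sub>1 \<union> j ` \<U>\<^sub>2) \<times> UNIV"
    proof cases
      case 1
      have "map_prod i id ` C' \<subseteq> map_prod i id ` (\<U>\<^sub>1 \<times> UNIV)"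
        by (rule image_mono[OF codingD(4)[OF c1 1(1)]])
      then show ?thesis unfolding 1(2) by auto
    next
      case 2
      have "map_prod j id ` C' \<subseteq> map_prod j id ` (\<U>\<^sub>2 \<times> UNIV)"
        by (rule image_mono[OF codingD(4)[OF c2 2(1)]])
      then show ?thesis unfolding 2(2) by auto
    qed
  next
    fix z C assume z: "z \<in> space (X \<Otimes>\<^sub>M Y)" and "C \<in> \<Q>"
    then obtain x y where xy: "z = (x, y)" "x \<in> space X" "y \<in> space Y" by (auto simp: space_pair_measure)
    from \<open>C \<in> \<Q>\<close> consider C' where "C' \<in> \<Q>\<^sub>1" "C = map_prod i id ` C'" | C' where "C' \<in> \<Q>\<^sub>2" "C = map_prod j id ` C'"
      unfolding \<Q>_def by blast
    then show "\<exists>l\<in>C. (z \<in> fst l) = snd l"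
    proof cases
      case 1
      obtain l where "l \<in> C'" "(x \<in> fst l) = snd l" using codingD(5)[OF c1 xy(2) 1(1)] by blast
      then show ?thesis using xy 1(2) by (intro bexI[of _ "map_prod i id l"]) (simp_all add: i_def)
    next
      case 2
      obtain l where "l \<in> C'" "(y \<in> fst l) = snd l" using codingD(5)[OF c2 xy(3) 2(1)] by blast
      then show ?thesis using xy 2(2) by (intro bexI[of _ "map_prod j id l"]) (simp_all add: j_def)
    qed
  next
    fix v assume v: "\<And>C. C \<in> \<Q> \<Longrightarrow> \<exists>l\<in>C. v (fst l) = snd l"
    have "\<exists>x\<in>space X. \<forall>B\<in>\<U>\<^sub>1. v (i B) = (x \<in> B)"
    proof (rule codingD(6)[OF c1, of "\<lambda>B. v (i B)"])
      fix C assume "C \<in> \<Q>\<^sub>1"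
      then have "\<exists>l\<in>map_prod i id ` C. v (fst l) = snd l" by (intro v) (simp add: \<Q>_def)
      then show "\<exists>l\<in>C. v (i (fst l)) = snd l" by simp
    qed
    moreover have "\<exists>y\<in>space Y. \<forall>B\<in>\<U>\<^sub>2. v (j B) = (y \<in> B)"
    proof (rule codingD(6)[OF c2, of "\<lambda>B. v (j B)"])
      fix C assume "C \<in> \<Q>\<^sub>2"
      then have "\<exists>l\<in>map_prod j id ` C. v (fst l) = snd l" by (intro v) (simp add: \<Q>_def)
      then show "\<exists>l\<in>C. v (j (fst l)) = snd l" by simp
    qed
    ultimately obtain x y where "x \<in> space X" "\<forall>B\<in>\<U>\<^sub>1. v (i B) = (x \<in> B)"
        "y \<in> space Y" "\<forall>B\<in>\<U>\<^sub>2. v (j B) = (y \<in> B)" by blast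
    then show "\<exists>z\<in>space (X \<Otimes>\<^sub>M Y). \<forall>B\<in>i ` \<U>\<^sub>1 \<union> j ` \<U>\<^sub>2. v B = (z \<in> B)"
      by (intro bexI[of _ "(x, y)"]) (auto simp: i_def j_def space_pair_measure)
  next
    fix z w assume zw: "z \<in> space (X \<Otimes>\<^sub>M Y)" "w \<in> space (X \<Otimes>\<^sub>M Y)"
      "\<And>B. B \<in> i ` \<U>\<^sub>1 \<union> j ` \<U>\<^sub>2 \<Longrightarrow> z \<in> B \<longleftrightarrow> w \<in> B"
    obtain x y x' y' where xy: "z = (x, y)" "x \<in> space X" "y \<in> space Y" "w = (x', y')" "x' \<in> space X" "y' \<in> space Y"
      using zw(1,2) by (auto simp: space_pair_measure)
    have "x = x'"
      by (rule codingD(7)[OF c1 xy(2,5)]) (use zw(3)[of "i _"] xy in \<open>auto simp: i_def\<close>)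
    moreover have "y = y'"
      by (rule codingD(7)[OF c2 xy(3,6)]) (use zw(3)[of "j _"] xy in \<open>auto simp: j_def\<close>)
    ultimately show "z = w" using xy by simp
  qed
  then show ?thesis unfolding i_def j_def by (rule exI)
qed

lemma coded_pair:
  assumes X: "coded X" and Y: "coded Y"
  shows "coded (X \<Otimes>\<^sub>M Y)"
proof -
  obtain \<U>\<^sub>1 \<Q>\<^sub>1 where c1: "{} \<subseteq> \<U>\<^sub>1" "coding X \<U>\<^sub>1 \<Q>\<^sub>1" by (rule codedD[OF X, of "{}"]) simp_all
  obtain \<U>\<^sub>2 \<Q>\<^sub>2 where c2: "{} \<subseteq> \<U>\<^sub>2" "coding Y \<U>\<^sub>2 \<Q>\<^sub>2" by (rule codedD[OF Y, of "{}"]) simp_all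
  define \<U> where "\<U> = (\<lambda>B. B \<times> space Y) ` \<U>\<^sub>1 \<union> (\<lambda>B. space X \<times> B) ` \<U>\<^sub>2"
  obtain \<Q> where c: "coding (X \<Otimes>\<^sub>M Y) \<U> \<Q>" unfolding \<U>_def using coding_pair[OF c1(2) c2(2)] ..
  show ?thesis
  proof (rule codedI[OF c])
    show "sets (X \<Otimes>\<^sub>M Y) = sigma_sets (space (X \<Otimes>\<^sub>M Y)) {a \<times> b | a b. a \<in> sets X \<and> b \<in> sets Y}"
      unfolding sets_pair_measure space_pair_measure ..
  next
    fix G assume "G \<in> {a \<times> b | a b. a \<in> sets X \<and> b \<in> sets Y}"
    then obtain a b where G: "G = a \<times> b" "a \<in> sets X" "b \<in> sets Y" by blast
    have ab: "a \<subseteq> space X" "b \<subseteq> space Y" using G(2,3) sets.sets_into_space by auto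
    have "countable (insert a \<U>\<^sub>1)" "insert a \<U>\<^sub>1 \<subseteq> sets X" using codingD(1,2)[OF c1(2)] G(2) by simp_all
    then obtain \<V>\<^sub>1 \<R>\<^sub>1 where d1: "insert a \<U>\<^sub>1 \<subseteq> \<V>\<^sub>1" "coding X \<V>\<^sub>1 \<R>\<^sub>1" by (rule codedD[OF X])
    have "countable (insert b \<U>\<^sub>2)" "insert b \<U>\<^sub>2 \<subseteq> sets Y" using codingD(1,2)[OF c2(2)] G(3) by simp_all
    then obtain \<V>\<^sub>2 \<R>\<^sub>2 where d2: "insert b \<U>\<^sub>2 \<subseteq> \<V>\<^sub>2" "coding Y \<V>\<^sub>2 \<R>\<^sub>2" by (rule codedD[OF Y])
    define \<V> where "\<V> = (\<lambda>B. B \<times> space Y) ` \<V>\<^sub>1 \<union> (\<lambda>B. space X \<times> B) ` \<V>\<^sub>2"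
    obtain \<R> where d: "coding (X \<Otimes>\<^sub>M Y) \<V> \<R>" unfolding \<V>_def using coding_pair[OF d1(2) d2(2)] ..
    have sub: "\<U> \<subseteq> \<V>" unfolding \<U>_def \<V>_def using d1(1) d2(1) by (intro Un_mono image_mono) auto
    have m: "a \<times> space Y \<in> \<V>" "space X \<times> b \<in> \<V>" using d1(1) d2(1) by (auto simp: \<V>_def)
    \<comment> \<open>A rectangle is an intersection of cylinders, whereas
      \<open>coding_insert\<close> accepts unions of literals. So the complement is added first, as
      a union of two negated cylinders, and then the rectangle as its negation.\<close>
    define G' where "G' = space (X \<Otimes>\<^sub>M Y) - G"
    have Gs: "G \<in> sets (X \<Otimes>\<^sub>M Y)" "G' \<in> sets (X \<Otimes>\<^sub>M Y)" using G by (simp_all add: G'_def)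
    obtain \<R>' where d': "coding (X \<Otimes>\<^sub>M Y) (insert G' \<V>) \<R>'"
      using coding_insert[OF d, of "{(a \<times> space Y, False), (space X \<times> b, False)}" G'] m Gs ab
      by (auto simp: G'_def G(1) space_pair_measure)
    obtain \<R>'' where "coding (X \<Otimes>\<^sub>M Y) (insert G (insert G' \<V>)) \<R>''"
      using coding_insert[OF d', of "{(G', False)}" G] Gs by (auto simp: G'_def)
    moreover have "\<U> \<subseteq> insert G (insert G' \<V>)" using sub by (simp add: subset_insertI2)
    ultimately show "\<exists>\<U>' \<Q>'. \<U> \<subseteq> \<U>' \<and> G \<in> \<U>' \<and> coding (X \<Otimes>\<^sub>M Y) \<U>' \<Q>'"
      by (intro exI[of _ "insert G (insert G' \<V>)"] exI[of _ \<R>'']) simp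
  qed
qed

text \<open>\<open>K\<close> is the graph of a partial injection from \<open>W\<close> into its
  complement, so exchanging the two ends of each pair and fixing all other points is well defined
  and involutive. Preimages under this map are built from projections of Borel subsets of
  \<open>K\<close>, which are Borel by \<open>inj_image_sets\<close>.\<close>

lemma swap_involution:
  fixes X :: "'a measure"
  assumes X: "coded X" and V: "separating X \<V>" and K: "K \<in> sets (X \<Otimes>\<^sub>M X)" "inj_on fst K" "inj_on snd K"
    and W: "W \<in> sets X" "K \<subseteq> W \<times> (space X - W)"
  obtains g where "g \<in> X \<rightarrow>\<^sub>M X" "\<forall>x\<in>space X. g (g x) = x" "\<forall>(x, y)\<in>K. g x = y"
    "\<forall>x\<in>space X. g x = x \<or> (x, g x) \<in> K \<or> (g x, x) \<in> K"
proof -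
  define g where "g x = (if \<exists>y. (x, y) \<in> K then SOME y. (x, y) \<in> K
    else if \<exists>y. (y, x) \<in> K then SOME y. (y, x) \<in> K else x)" for x
  have g1: "g x = y" if "(x, y) \<in> K" for x y
  proof -
    have "(x, SOME y. (x, y) \<in> K) \<in> K" using that by (rule someI)
    then have "(SOME y. (x, y) \<in> K) = y" using inj_onD[OF K(2) _ _ that, of "(x, SOME y. (x, y) \<in> K)"] by simp
    then show ?thesis using that by (auto simp: g_def)
  qed
  have g2: "g y = x" if "(x, y) \<in> K" for x y
  proof -
    have "y \<notin> W" using W that by auto
    then have n: "\<not> (\<exists>z. (y, z) \<in> K)" using W by auto
    have "(SOME z. (z, y) \<in> K, y) \<in> K" using that by (rule someI)
    then have "(SOME z. (z, y) \<in> K) = x" using inj_onD[OF K(3) _ _ that, of "(SOME z. (z, y) \<in> K, y)"] by simp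
    then show ?thesis using that n by (auto simp: g_def)
  qed
  have g3: "g x = x" if "x \<notin> fst ` K" "x \<notin> snd ` K" for x
    using that by (force simp: g_def)
  have ex: "\<exists>y. (x, y) \<in> K \<or> (y, x) \<in> K" if "x \<in> fst ` K \<or> x \<in> snd ` K" for x
    using that by force
  have WX: "W \<subseteq> space X" using W(1) by (rule sets.sets_into_space)
  have KX: "K \<subseteq> space X \<times> space X" using W(2) WX by blast
  have XX: "coded (X \<Otimes>\<^sub>M X)" by (rule coded_pair[OF X X])
  have im: "fst ` L \<in> sets X" "snd ` L \<in> sets X" if "L \<in> sets (X \<Otimes>\<^sub>M X)" "L \<subseteq> K" for L
    using inj_image_sets[OF XX measurable_fst V that(1) inj_on_subset[OF K(2) that(2)]]
      inj_image_sets[OF XX measurable_snd V that(1) inj_on_subset[OF K(3) that(2)]] by simp_all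
  have gX: "g x \<in> space X" if x: "x \<in> space X" for x
  proof (cases "x \<in> fst ` K \<or> x \<in> snd ` K")
    case True
    then obtain y where y: "(x, y) \<in> K \<or> (y, x) \<in> K" using ex by blast
    then show ?thesis using g1[of x y] g2[of y x] KX by auto
  next
    case False
    then show ?thesis using g3 x by simp
  qed
  show thesis
  proof
    show "g \<in> X \<rightarrow>\<^sub>M X"
    proof (rule measurableI)
      fix B assume B: "B \<in> sets X"
      have "g -` B \<inter> space X = fst ` (K \<inter> space X \<times> B) \<union> snd ` (K \<inter> B \<times> space X) \<union>
          (B - (fst ` K \<union> snd ` K))" (is "?L = ?R")
      proof (intro equalityI subsetI)
        fix x assume x: "x \<in> ?L"
        show "x \<in> ?R"
        proof (cases "x \<in> fst ` K \<or> x \<in> snd ` K")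
          case True
          then obtain y where y: "(x, y) \<in> K \<or> (y, x) \<in> K" using ex by blast
          then show ?thesis
          proof
            assume "(x, y) \<in> K"
            then have "(x, y) \<in> K \<inter> space X \<times> B" using x g1[of x y] by simp
            then show ?thesis by (metis UnI1 fst_conv imageI)
          next
            assume "(y, x) \<in> K"
            then have "(y, x) \<in> K \<inter> B \<times> space X" using x g2[of y x] by simp
            then show ?thesis by (metis UnI1 UnI2 snd_conv imageI)
          qed
        next
          case False
          then show ?thesis using g3 x by simp
        qed
      next
        fix x assume "x \<in> ?R"
        then consider y where "(x, y) \<in> K" "y \<in> B" | y where "(y, x) \<in> K" "y \<in> B"
          | "x \<in> B" "x \<notin> fst ` K" "x \<notin> snd ` K" by auto
        then show "x \<in> ?L"
        proof cases
          case 1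
          then show ?thesis using g1[OF 1(1)] subsetD[OF KX 1(1)] by simp
        next
          case 2
          then show ?thesis using g2[OF 2(1)] subsetD[OF KX 2(1)] by simp
        next
          case 3
          then show ?thesis using g3 subsetD[OF sets.sets_into_space[OF B]] by simp
        qed
      qed
      moreover have "fst ` (K \<inter> space X \<times> B) \<in> sets X" "snd ` (K \<inter> B \<times> space X) \<in> sets X"
          "fst ` K \<in> sets X" "snd ` K \<in> sets X"
        using K(1) B by (auto intro!: im)
      ultimately show "g -` B \<inter> space X \<in> sets X" using B by simp
    qed (rule gX)
    show "\<forall>x\<in>space X. g (g x) = x"
    proof
      fix x assume x: "x \<in> space X"
      show "g (g x) = x"
      proof (cases "x \<in> fst ` K \<or> x \<in> snd ` K")
        case True
        then obtain y where y: "(x, y) \<in> K \<or> (y, x) \<in> K" using ex by blast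
        then show ?thesis using g1[of x y] g2[of x y] g1[of y x] g2[of y x] by auto
      next
        case False
        then show ?thesis using g3 x by simp
      qed
    qed
    show "\<forall>(x, y)\<in>K. g x = y" using g1 by blast
    show "\<forall>x\<in>space X. g x = x \<or> (x, g x) \<in> K \<or> (g x, x) \<in> K"
    proof
      fix x assume x: "x \<in> space X"
      show "g x = x \<or> (x, g x) \<in> K \<or> (g x, x) \<in> K"
      proof (cases "x \<in> fst ` K \<or> x \<in> snd ` K")
        case True
        then obtain y where y: "(x, y) \<in> K \<or> (y, x) \<in> K" using ex by blast
        then show ?thesis using g1[of x y] g2[of y x] by auto
      next
        case False
        then show ?thesis using g3 by simp
      qed
    qed
  qed
qed

text \<open>Both projections are countable-to-one on \<open>E\<close>, so \<open>E\<close> is a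
  countable union of Borel sets on which both are injective. Cutting these further by
  \<open>W\<close> times its complement, for \<open>W\<close> from a separating family, covers
  everything off the diagonal with sets to which \<open>swap_involution\<close> applies.\<close>

theorem feldman_moore:
  fixes X :: "'a measure"
  assumes X: "standard_borel X" and E: "countable_borel_equiv X E"
  obtains g :: "nat \<Rightarrow> 'a \<Rightarrow> 'a" where "\<forall>i. g i \<in> X \<rightarrow>\<^sub>M X" "\<forall>i. \<forall>x\<in>space X. g i (g i x) = x"
    "\<forall>x\<in>space X. E `` {x} = range (\<lambda>i. g i x)"
proof -
  have eq: "equiv (space X) E" and Es: "E \<in> sets (X \<Otimes>\<^sub>M X)" and ct: "\<And>x. x \<in> space X \<Longrightarrow> countable (E `` {x})"
    using E by (auto simp: countable_borel_equiv_def borel_equiv_def)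
  have EX: "E \<subseteq> space X \<times> space X" using eq by (auto simp: equiv_def refl_on_def)
  have symE: "(y, x) \<in> E" if "(x, y) \<in> E" for x y using eq that by (auto simp: equiv_def sym_def)
  have cX: "coded X" by (rule standard_borel_coded[OF X]) simp
  obtain \<U> \<Q> where "{} \<subseteq> \<U>" "coding X \<U> \<Q>" by (rule codedD[OF cX, of "{}"]) simp_all
  then have V: "separating X \<U>" by (intro coding_separating)
  have XX: "coded (X \<Otimes>\<^sub>M X)" by (rule coded_pair[OF cX cX])
  have cl: "countable (E `` {x})" for x
    using ct[of x] EX by (cases "x \<in> space X") (auto simp: Image_def intro: countable_subset[of _ "{}"])
  have f1: "countable {z \<in> E. fst z = x}" for x
    by (rule countable_subset[of _ "Pair x ` (E `` {x})"]) (use cl[of x] in auto)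
  have f2: "countable {z \<in> E. snd z = x}" for x
    by (rule countable_subset[of _ "(\<lambda>y. (y, x)) ` (E `` {x})"]) (use cl[of x] symE in auto)
  obtain C where C: "\<And>n::nat. C n \<in> sets (X \<Otimes>\<^sub>M X)" "\<And>n. inj_on fst (C n)" "E = (\<Union>n. C n)"
    by (rule countable_to_one_decomposition[OF XX measurable_fst V Es f1]) blast
  obtain D where D: "\<And>n::nat. D n \<in> sets (X \<Otimes>\<^sub>M X)" "\<And>n. inj_on snd (D n)" "E = (\<Union>n. D n)"
    by (rule countable_to_one_decomposition[OF XX measurable_snd V Es f2]) blast
  \<comment> \<open>Both orientations are kept, since a basic set separating \<open>x\<close> from
    \<open>y\<close> may contain either one of them.\<close>
  define W where "W V b = (if b then V else space X - V)" for V b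
  define K where "K = (\<lambda>(n, m, V, b). C n \<inter> D m \<inter> W V b \<times> (space X - W V b))"
  define J where "J = (UNIV :: nat set) \<times> (UNIV :: nat set) \<times> \<U> \<times> (UNIV :: bool set)"
  have "countable J" unfolding J_def using separatingD(1)[OF V] by (intro countable_SIGMA) simp_all
  have "\<exists>g. g \<in> X \<rightarrow>\<^sub>M X \<and> (\<forall>x\<in>space X. g (g x) = x) \<and> (\<forall>(x, y)\<in>K j. g x = y) \<and>
    (\<forall>x\<in>space X. g x = x \<or> (x, g x) \<in> K j \<or> (g x, x) \<in> K j)" if "j \<in> J" for j
  proof -
    obtain n m V b where j: "j = (n, m, V, b)" "V \<in> \<U>" using \<open>j \<in> J\<close> unfolding J_def by blast
    have WX: "W V b \<in> sets X" using j(2) subsetD[OF separatingD(2)[OF \<open>separating X \<U>\<close>]] by (simp add: W_def)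
    have Kj: "K j = C n \<inter> D m \<inter> W V b \<times> (space X - W V b)" by (simp add: K_def j)
    have "K j \<in> sets (X \<Otimes>\<^sub>M X)" unfolding Kj using C(1) D(1) WX by (intro sets.Int pair_measureI) simp_all
    moreover have "inj_on fst (K j)" unfolding Kj by (rule inj_on_subset[OF C(2)[of n]]) blast
    moreover have "inj_on snd (K j)" unfolding Kj by (rule inj_on_subset[OF D(2)[of m]]) blast
    moreover have "K j \<subseteq> W V b \<times> (space X - W V b)" unfolding Kj by blast
    ultimately obtain g where "g \<in> X \<rightarrow>\<^sub>M X" "\<forall>x\<in>space X. g (g x) = x" "\<forall>(x, y)\<in>K j. g x = y"
        "\<forall>x\<in>space X. g x = x \<or> (x, g x) \<in> K j \<or> (g x, x) \<in> K j"
      by (rule swap_involution[OF cX \<open>separating X \<U>\<close> _ _ _ WX])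
    then show ?thesis by (intro exI[of _ g] conjI)
  qed
  then have "\<forall>j\<in>J. \<exists>g. g \<in> X \<rightarrow>\<^sub>M X \<and> (\<forall>x\<in>space X. g (g x) = x) \<and> (\<forall>(x, y)\<in>K j. g x = y) \<and>
    (\<forall>x\<in>space X. g x = x \<or> (x, g x) \<in> K j \<or> (g x, x) \<in> K j)" ..
  from bchoice[OF this] obtain h where h: "\<forall>j\<in>J. h j \<in> X \<rightarrow>\<^sub>M X \<and> (\<forall>x\<in>space X. h j (h j x) = x) \<and>
    (\<forall>(x, y)\<in>K j. h j x = y) \<and> (\<forall>x\<in>space X. h j x = x \<or> (x, h j x) \<in> K j \<or> (h j x, x) \<in> K j)" ..
  \<comment> \<open>The identity takes care of the diagonal pairs, which no \<open>K j\<close>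
    contains.\<close>
  define G where "G = insert (\<lambda>x. x) (h ` J)"
  define g where "g = from_nat_into G"
  have rg: "range g = G" unfolding g_def G_def using \<open>countable J\<close> by (intro range_from_nat_into) simp_all
  have g_cases: "g i = (\<lambda>x. x) \<or> (\<exists>j\<in>J. g i = h j)" for i
  proof -
    have "g i \<in> G" using rg by blast
    then show ?thesis by (auto simp: G_def)
  qed
  have KE: "K j \<subseteq> E" for j using C(3) by (cases j) (auto simp: K_def)
  show thesis
  proof
    show "\<forall>i. g i \<in> X \<rightarrow>\<^sub>M X"
    proof
      fix i show "g i \<in> X \<rightarrow>\<^sub>M X" using g_cases[of i] h by (elim disjE bexE) simp_all
    qed
    show "\<forall>i. \<forall>x\<in>space X. g i (g i x) = x"
    proof (intro allI ballI)
      fix i x assume "x \<in> space X"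
      then show "g i (g i x) = x" using g_cases[of i] h by (elim disjE bexE) simp_all
    qed
    show "\<forall>x\<in>space X. E `` {x} = range (\<lambda>i. g i x)"
    proof (intro ballI equalityI subsetI)
      fix x y assume x: "x \<in> space X" and "y \<in> E `` {x}"
      then have xy: "(x, y) \<in> E" by simp
      then have y: "y \<in> space X" using EX by blast
      have "\<exists>k\<in>G. k x = y"
      proof (cases "x = y")
        case True
        then show ?thesis by (simp add: G_def)
      next
        case False
        then obtain B where B: "B \<in> \<U>" "x \<in> B \<longleftrightarrow> y \<notin> B" using separatingD(3)[OF V x y] by blast
        obtain n m where "(x, y) \<in> C n" "(x, y) \<in> D m" using xy C(3) D(3) by blast
        then have "(x, y) \<in> K (n, m, B, x \<in> B)" using B(2) x y by (auto simp: K_def W_def)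
        moreover have "(n, m, B, x \<in> B) \<in> J" using B(1) by (simp add: J_def)
        ultimately show ?thesis using h unfolding G_def by (intro bexI[of _ "h (n, m, B, x \<in> B)"]) auto
      qed
      then show "y \<in> range (\<lambda>i. g i x)" unfolding rg[symmetric] by auto
    next
      fix x y assume x: "x \<in> space X" and "y \<in> range (\<lambda>i. g i x)"
      then obtain i where y: "y = g i x" by blast
      have "(x, x) \<in> E" using eq x by (auto simp: equiv_def refl_on_def)
      moreover have "(x, h j x) \<in> E" if "j \<in> J" for j
        using h that x KE[of j] symE[of "h j x" x] \<open>(x, x) \<in> E\<close> by (metis subsetD)
      ultimately have "(x, g i x) \<in> E" using g_cases[of i] by (elim disjE bexE) simp_all
      then show "y \<in> E `` {x}" using y by simp
    qed
  qed
qed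

section \<open>Borel selectors\<close>

lemma standard_borel_separatingE:
  assumes "standard_borel X"
  obtains \<V> where "separating X \<V>"
proof -
  have "coded X" by (rule standard_borel_coded[OF assms]) simp
  then obtain \<U> \<Q> where "{} \<subseteq> \<U>" "coding X \<U> \<Q>" by (rule codedD[of X "{}"]) simp_all
  then show thesis using that[OF coding_separating] by blast
qed

lemma pred_eq_of_separating:
  assumes V: "separating X \<V>" and f: "f \<in> M \<rightarrow>\<^sub>M X" and h: "h \<in> M \<rightarrow>\<^sub>M X"
  shows "Measurable.pred M (\<lambda>x. f x = h x)"
proof -
  have "{x \<in> space M. f x = h x} = {x \<in> space M. \<forall>V\<in>\<V>. x \<in> f -` V \<inter> space M \<longleftrightarrow> x \<in> h -` V \<inter> space M}"
    using separatingD(3)[OF V] measurable_space[OF f] measurable_space[OF h] by auto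
  also have "\<dots> \<in> sets M"
  proof (rule sets.sets_Collect_countable_All'[OF _ separatingD(1)[OF V]])
    fix V assume "V \<in> \<V>"
    then have "V \<in> sets X" using subsetD[OF separatingD(2)[OF V]] by blast
    then have [measurable]: "f -` V \<inter> space M \<in> sets M" "h -` V \<inter> space M \<in> sets M"
      using f h by (auto intro: measurable_sets)
    show "{x \<in> space M. x \<in> f -` V \<inter> space M \<longleftrightarrow> x \<in> h -` V \<inter> space M} \<in> sets M"
      by measurable
  qed
  finally show ?thesis by (simp add: pred_def)
qed

text \<open>The least \<open>n\<close> for which \<open>V n\<close> meets the class in one point
  depends only on the class. The index \<open>K x\<close> used to find this point may vary inside
  the class, but the point found is the same.\<close>

lemma borel_selector:
  fixes g :: "nat \<Rightarrow> 'a \<Rightarrow> 'a" and V :: "nat \<Rightarrow> 'a set"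
  assumes sep: "separating X \<V>" and eq: "equiv (space X) E"
    and g: "\<And>i. g i \<in> X \<rightarrow>\<^sub>M X" and cls: "\<And>x. x \<in> space X \<Longrightarrow> E `` {x} = range (\<lambda>i. g i x)"
    and V: "\<And>n. V n \<in> sets X" and one: "\<And>x. x \<in> space X \<Longrightarrow> \<exists>n. is_singleton (V n \<inter> E `` {x})"
  obtains s where "s \<in> X \<rightarrow>\<^sub>M X" "\<forall>x\<in>space X. (x, s x) \<in> E" "\<forall>(x, y)\<in>E. s x = s y"
proof -
  note [measurable] = g V pred_eq_of_separating[OF sep g g]
  define Pr where "Pr n x \<longleftrightarrow> (\<exists>i. g i x \<in> V n) \<and> (\<forall>i j. g i x \<in> V n \<longrightarrow> g j x \<in> V n \<longrightarrow> g i x = g j x)" for n x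
  define N where "N x = (LEAST n. Pr n x)" for x
  define K where "K x = (LEAST k. g k x \<in> V (N x))" for x
  define s where "s x = g (K x) x" for x
  have Pr_iff: "Pr n x \<longleftrightarrow> is_singleton (V n \<inter> E `` {x})" if "x \<in> space X" for n x
  proof -
    have "is_singleton A \<longleftrightarrow> A \<noteq> {} \<and> (\<forall>y\<in>A. \<forall>z\<in>A. y = z)" for A :: "'a set"
      by (metis is_singletonE is_singletonI' insert_not_empty singletonD)
    moreover have "V n \<inter> range (\<lambda>i. g i x) \<noteq> {} \<longleftrightarrow> (\<exists>i. g i x \<in> V n)" by blast
    moreover have "(\<forall>y\<in>V n \<inter> range (\<lambda>i. g i x). \<forall>z\<in>V n \<inter> range (\<lambda>i. g i x). y = z) \<longleftrightarrow>
        (\<forall>i j. g i x \<in> V n \<longrightarrow> g j x \<in> V n \<longrightarrow> g i x = g j x)" by fast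
    ultimately show ?thesis unfolding Pr_def cls[OF that] by simp
  qed
  have [measurable]: "N \<in> X \<rightarrow>\<^sub>M count_space UNIV" unfolding N_def Pr_def by measurable
  have "(\<lambda>x. g k x \<in> V (N x)) \<in> X \<rightarrow>\<^sub>M count_space UNIV" for k
    by (rule measurable_compose_countable[where f = "\<lambda>n x. g k x \<in> V n"]) measurable
  then have K: "K \<in> X \<rightarrow>\<^sub>M count_space UNIV" unfolding K_def by (rule measurable_Least)
  have PrN: "Pr (N x) x" if "x \<in> space X" for x
    unfolding N_def by (rule LeastI_ex) (use one[OF that] Pr_iff[OF that] in blast)
  have sV: "s x \<in> V (N x) \<inter> E `` {x}" if x: "x \<in> space X" for x
  proof -
    have "\<exists>k. g k x \<in> V (N x)" using PrN[OF x] by (simp add: Pr_def)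
    then have "g (K x) x \<in> V (N x)" unfolding K_def by (rule LeastI_ex)
    then show ?thesis using cls[OF x] by (simp add: s_def)
  qed
  show thesis
  proof
    show "s \<in> X \<rightarrow>\<^sub>M X" unfolding s_def using g K by (rule measurable_compose_countable)
    show "\<forall>x\<in>space X. (x, s x) \<in> E" using sV by auto
    show "\<forall>(x, y)\<in>E. s x = s y"
    proof (intro ballI, clarify)
      fix x y assume xy: "(x, y) \<in> E"
      then have sp: "x \<in> space X" "y \<in> space X" using eq by (auto simp: equiv_def refl_on_def)
      have same: "E `` {x} = E `` {y}" using equiv_class_eq[OF eq xy] .
      have "N x = N y" unfolding N_def using Pr_iff sp same by simp
      moreover have "is_singleton (V (N x) \<inter> E `` {x})" using PrN[OF sp(1)] Pr_iff[OF sp(1)] by simp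
      ultimately show "s x = s y"
        using sV[OF sp(1)] sV[OF sp(2)] same unfolding is_singleton_def by (metis singletonD)
    qed
  qed
qed

lemma smooth_of_selector:
  assumes X: "standard_borel X" and eq: "equiv (space X) E"
    and s: "s \<in> X \<rightarrow>\<^sub>M X" "\<forall>x\<in>space X. (x, s x) \<in> E" "\<forall>(x, y)\<in>E. s x = s y"
  shows "smooth X E"
proof (rule smoothI[OF X s(1)])
  fix x y assume xy: "x \<in> space X" "y \<in> space X"
  show "(x, y) \<in> E \<longleftrightarrow> s x = s y"
  proof
    assume "s x = s y"
    then have "(x, s x) \<in> E" "(s x, y) \<in> E" using s(2) xy equivE[OF eq] by (auto dest: symD)
    then show "(x, y) \<in> E" using equivE[OF eq] by (meson transD)
  qed (use s(3) in auto)
qed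

text \<open>The nonempty fibres of the reducing map are exactly the classes, so it is
  countable-to-one. The Lusin-Novikov pieces on which it is injective meet each class in at most one
  point, and they cover the space, so some piece meets it in exactly one.\<close>

lemma smooth_selector:
  fixes X :: "'a measure"
  assumes X: "standard_borel X" and E: "countable_borel_equiv X E" and sm: "smooth X E"
  obtains s where "s \<in> X \<rightarrow>\<^sub>M X" "\<forall>x\<in>space X. (x, s x) \<in> E" "\<forall>(x, y)\<in>E. s x = s y"
proof -
  have eq: "equiv (space X) E" and ct: "\<And>x. x \<in> space X \<Longrightarrow> countable (E `` {x})"
    using E by (auto simp: countable_borel_equiv_def borel_equiv_def)
  obtain g :: "nat \<Rightarrow> 'a \<Rightarrow> 'a" where g: "\<forall>i. g i \<in> X \<rightarrow>\<^sub>M X" "\<forall>i. \<forall>x\<in>space X. g i (g i x) = x"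
    "\<forall>x\<in>space X. E `` {x} = range (\<lambda>i. g i x)" by (rule feldman_moore[OF X E])
  obtain \<V> where V: "separating X \<V>" by (rule standard_borel_separatingE[OF X])
  obtain Y :: "real measure" and f where f: "standard_borel Y" "f \<in> X \<rightarrow>\<^sub>M Y"
    "\<forall>x\<in>space X. \<forall>y\<in>space X. (x, y) \<in> E \<longleftrightarrow> f x = f y"
    using sm unfolding smooth_def by blast
  obtain \<W> where W: "separating Y \<W>" by (rule standard_borel_separatingE[OF f(1)])
  have cX: "coded X" by (rule standard_borel_coded[OF X]) simp
  have fib: "countable {z \<in> space X. f z = x}" for x
  proof (cases "\<exists>y\<in>space X. f y = x")
    case True
    then obtain y where y: "y \<in> space X" "f y = x" by blast
    then have "{z \<in> space X. f z = x} \<subseteq> E `` {y}" using f(3) by auto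
    then show ?thesis using ct[OF y(1)] countable_subset by blast
  next
    case False
    then have empty: "{z \<in> space X. f z = x} = {}" by blast
    show ?thesis unfolding empty by simp
  qed
  obtain C where C: "\<And>n::nat. C n \<in> sets X" "\<And>n. inj_on f (C n)" "space X = (\<Union>n. C n)"
    by (rule countable_to_one_decomposition[OF cX f(2) W sets.top fib]) blast
  have one: "\<exists>n. is_singleton (C n \<inter> E `` {x})" if x: "x \<in> space X" for x
  proof -
    obtain n where n: "x \<in> C n" using C(3) x by blast
    have "y = x" if y: "y \<in> C n" "(x, y) \<in> E" for y
    proof -
      have "y \<in> space X" using y(1) C(3) by blast
      then have "f x = f y" using f(3) x y(2) by blast
      then show ?thesis using inj_onD[OF C(2) _ y(1) n] by simp
    qed
    moreover have "(x, x) \<in> E" using x eq by (auto simp: equiv_def refl_on_def)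
    ultimately have "C n \<inter> E `` {x} = {x}" using n by auto
    then show ?thesis by (intro exI[of _ n]) simp
  qed
  show thesis
    by (rule borel_selector[OF V eq g(1)[rule_format] g(3)[rule_format] C(1) one]) (assumption | rule that)+
qed

text \<open>Alternately apply all operations and refine to a coding containing the results. An
  indexed family of binary operations covers intersections, complements and preimages together, as
  the second argument may be ignored.\<close>

lemma coding_closed_under:
  fixes h :: "nat \<Rightarrow> 'a set \<Rightarrow> 'a set \<Rightarrow> 'a set"
  assumes X: "coded X" and F: "countable \<F>" "\<F> \<subseteq> sets X"
    and h: "\<And>i A B. A \<in> sets X \<Longrightarrow> B \<in> sets X \<Longrightarrow> h i A B \<in> sets X"
  obtains \<U> \<Q> where "\<F> \<subseteq> \<U>" "coding X \<U> \<Q>" "\<forall>i. \<forall>A\<in>\<U>. \<forall>B\<in>\<U>. h i A B \<in> \<U>"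
proof -
  define step where "step \<A> = \<A> \<union> (\<lambda>(i, A, B). h i A B) ` (UNIV \<times> \<A> \<times> \<A>)" for \<A>
  have step: "countable (step \<A>)" "step \<A> \<subseteq> sets X" if "coding X \<A> \<Q>" for \<A> \<Q>
  proof -
    show "countable (step \<A>)" unfolding step_def using codingD(1)[OF that] by simp
    have "h i A B \<in> sets X" if "A \<in> \<A>" "B \<in> \<A>" for i A B
      using that subsetD[OF codingD(2)[OF \<open>coding X \<A> \<Q>\<close>]] h by blast
    then show "step \<A> \<subseteq> sets X" unfolding step_def using codingD(2)[OF that] by auto
  qed
  have "\<exists>u. \<forall>n. (\<F> \<subseteq> fst (u n) \<and> coding X (fst (u n)) (snd (u n))) \<and> step (fst (u n)) \<subseteq> fst (u (Suc n))"
  proof (rule dependent_nat_choice)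
    obtain \<U> \<Q> where "\<F> \<subseteq> \<U>" "coding X \<U> \<Q>" by (rule codedD[OF X F])
    then show "\<exists>u. \<F> \<subseteq> fst u \<and> coding X (fst u) (snd u)" by (intro exI[of _ "(\<U>, \<Q>)"]) simp
  next
    fix u :: "'a set set \<times> ('a set \<times> bool) set set" and n :: nat
    assume u: "\<F> \<subseteq> fst u \<and> coding X (fst u) (snd u)"
    obtain \<U> \<Q> where U: "step (fst u) \<subseteq> \<U>" "coding X \<U> \<Q>" by (rule codedD[OF X step[OF conjunct2[OF u]]])
    moreover have "\<F> \<subseteq> \<U>" using U(1) conjunct1[OF u] by (auto simp: step_def)
    ultimately show "\<exists>u'. (\<F> \<subseteq> fst u' \<and> coding X (fst u') (snd u')) \<and> step (fst u) \<subseteq> fst u'"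
      by (intro exI[of _ "(\<U>, \<Q>)"]) simp
  qed
  then obtain u where u0: "\<forall>n. (\<F> \<subseteq> fst (u n) \<and> coding X (fst (u n)) (snd (u n))) \<and> step (fst (u n)) \<subseteq> fst (u (Suc n))" ..
  define \<U> where "\<U> n = fst (u n)" for n
  define \<Q> where "\<Q> n = snd (u n)" for n
  have u: "\<F> \<subseteq> \<U> n" "coding X (\<U> n) (\<Q> n)" "step (\<U> n) \<subseteq> \<U> (Suc n)" for n
    using u0 by (simp_all add: \<U>_def \<Q>_def)
  have "\<U> n \<subseteq> \<U> (Suc n)" for n using u(3)[of n] by (simp add: step_def)
  then have mono: "\<U> m \<subseteq> \<U> n" if "m \<le> n" for m n using that by (rule lift_Suc_mono_le)
  show thesis
  proof
    \<comment> \<open>Stage 0 lies below all stages and serves as the common base of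
      \<open>coding_UN\<close>.\<close>
    show "coding X (\<Union>n\<in>UNIV. \<U> n) (\<Union>n\<in>UNIV. \<Q> n)"
      by (rule coding_UN[OF _ _ u(2) mono[OF le0] u(2)]) simp_all
    show "\<F> \<subseteq> (\<Union>n\<in>UNIV. \<U> n)" using u(1)[of 0] by blast
    show "\<forall>i. \<forall>A\<in>(\<Union>n\<in>UNIV. \<U> n). \<forall>B\<in>(\<Union>n\<in>UNIV. \<U> n). h i A B \<in> (\<Union>n\<in>UNIV. \<U> n)"
    proof (intro allI ballI)
      fix i A B assume "A \<in> (\<Union>n\<in>UNIV. \<U> n)" "B \<in> (\<Union>n\<in>UNIV. \<U> n)"
      then obtain n m where "A \<in> \<U> n" "B \<in> \<U> m" by blast
      then have "A \<in> \<U> (max n m)" "B \<in> \<U> (max n m)"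
        using subsetD[OF mono[of n "max n m"]] subsetD[OF mono[of m "max n m"]] by simp_all
      then have "h i A B \<in> step (\<U> (max n m))"
        unfolding step_def by (intro UnI2 image_eqI[of _ _ "(i, A, B)"]) simp_all
      then show "h i A B \<in> (\<Union>n\<in>UNIV. \<U> n)" using subsetD[OF u(3)] by blast
    qed
  qed
qed

text \<open>A strictly increasing sequence visits each set twice in succession, whence the
  \<open>n div 2\<close>. The value at the even visit goes into \<open>L\<close> and that at the odd
  visit stays out.\<close>

lemma countable_infinite_nat_sets_bisected:
  fixes \<A> :: "nat set set"
  assumes "countable \<A>" "\<And>A. A \<in> \<A> \<Longrightarrow> infinite A"
  obtains L where "\<forall>A\<in>\<A>. A \<inter> L \<noteq> {} \<and> A - L \<noteq> {}"
proof -
  define I where "I = from_nat_into (insert UNIV \<A>)"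
  have rng: "range I = insert UNIV \<A>" unfolding I_def using assms(1) by (intro range_from_nat_into) simp_all
  have inf: "infinite (I n)" for n
  proof -
    have "I n \<in> insert UNIV \<A>" using rng by blast
    then show ?thesis using assms(2) by auto
  qed
  have "\<exists>t. \<forall>n. t n \<in> I (n div 2) \<and> t n < t (Suc n)"
  proof (rule dependent_nat_choice)
    show "\<exists>x. x \<in> I (0 div 2)" using inf[of 0] by (metis div_0 ex_in_conv finite.emptyI)
    show "\<exists>y. y \<in> I (Suc n div 2) \<and> x < y" for x n
      using inf[of "Suc n div 2"] unfolding infinite_nat_iff_unbounded by blast
  qed
  then obtain t where t: "\<And>n. t n \<in> I (n div 2)" "\<And>n. t n < t (Suc n)" by blast
  have "strict_mono t" using t(2) by (simp add: strict_mono_Suc_iff)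
  then have inj: "t m = t n \<longleftrightarrow> m = n" for m n by (simp add: strict_mono_eq)
  define L where "L = range (\<lambda>n. t (2 * n))"
  show thesis
  proof (rule that[of L], intro ballI conjI)
    fix A assume "A \<in> \<A>"
    then obtain n where n: "A = I n" using rng by (metis insertI2 imageE)
    have "t (2 * n) \<in> A \<inter> L" using t(1)[of "2 * n"] n by (simp add: L_def)
    then show "A \<inter> L \<noteq> {}" by blast
    have "t (2 * n + 1) \<in> A" using t(1)[of "2 * n + 1"] n by simp
    moreover have "t (2 * n + 1) \<notin> L"
    proof
      assume "t (2 * n + 1) \<in> L"
      then obtain m where "2 * n + 1 = 2 * m" using inj by (auto simp: L_def)
      then show False by presburger
    qed
    ultimately show "A - L \<noteq> {}" by blast
  qed
qed

section \<open>Baire category on the closure of an orbit\<close>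

text \<open>The sets in \<open>\<U>\<close> serve as a base of a Polish topology in which the \<open>g i\<close> are homeomorphisms; \<open>P\<close>
  is the closure of the orbit \<open>C\<close>. Since \<open>B \<inter> P\<close> is nonempty iff \<open>B \<inter> C\<close> is, for \<open>B \<in> \<U>\<close>, nonempty
  relatively open sets are expressed through \<open>C\<close>.\<close>

locale dense_orbit =
  fixes X :: "'a measure" and \<U> \<B> :: "'a set set" and \<Q> and g :: "nat \<Rightarrow> 'a \<Rightarrow> 'a" and E C
  assumes cod: "coding X \<U> \<Q>" and gen: "sets X = sigma_sets (space X) \<B>" "\<B> \<subseteq> \<U>"
    and Int: "\<And>A B. A \<in> \<U> \<Longrightarrow> B \<in> \<U> \<Longrightarrow> A \<inter> B \<in> \<U>"
    and Compl: "\<And>A. A \<in> \<U> \<Longrightarrow> space X - A \<in> \<U>"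
    and pre: "\<And>i A. A \<in> \<U> \<Longrightarrow> g i -` A \<inter> space X \<in> \<U>"
    and ne: "\<U> \<noteq> {}"
    and eq: "equiv (space X) E"
    and g: "\<And>i. g i \<in> X \<rightarrow>\<^sub>M X" and invol: "\<And>i x. x \<in> space X \<Longrightarrow> g i (g i x) = x"
    and cls: "\<And>x. x \<in> space X \<Longrightarrow> E `` {x} = range (\<lambda>i. g i x)"
    and C: "\<exists>x\<in>space X. C = E `` {x}"
    and dense: "\<And>B. B \<in> \<U> \<Longrightarrow> \<not> is_singleton (B \<inter> C)"
begin

definition P where "P = {x \<in> space X. \<forall>B\<in>\<U>. x \<in> B \<longrightarrow> B \<inter> C \<noteq> {}}"

definition nowhere_dense where
  "nowhere_dense K \<longleftrightarrow> (\<forall>U\<in>\<U>. U \<inter> C \<noteq> {} \<longrightarrow> (\<exists>V\<in>\<U>. V \<subseteq> U \<and> V \<inter> C \<noteq> {} \<and> V \<inter> P \<inter> K = {}))"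

definition meager where
  "meager K \<longleftrightarrow> (\<exists>F :: nat \<Rightarrow> 'a set. (\<forall>n. nowhere_dense (F n)) \<and> K \<inter> P \<subseteq> (\<Union>n. F n))"

lemma nowhere_denseD:
  assumes "nowhere_dense K" "U \<in> \<U>" "U \<inter> C \<noteq> {}"
  obtains V where "V \<in> \<U>" "V \<subseteq> U" "V \<inter> C \<noteq> {}" "V \<inter> P \<inter> K = {}"
  using assms(1)[unfolded nowhere_dense_def, rule_format, OF assms(2,3)]
  by (elim bexE conjE) (rule that)

lemma Usets: "B \<in> \<U> \<Longrightarrow> B \<in> sets X"
  using codingD(2)[OF cod] by (rule subsetD)

lemma Uspace: "B \<in> \<U> \<Longrightarrow> B \<subseteq> space X"
  using Usets sets.sets_into_space by blast

lemma empty_U: "{} \<in> \<U>"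
proof -
  obtain B where "B \<in> \<U>" using ne by blast
  then have "B \<inter> (space X - B) \<in> \<U>" by (intro Int Compl)
  then show ?thesis by simp
qed

lemma space_U: "space X \<in> \<U>"
  using Compl[OF empty_U] by simp

lemma EX: "E \<subseteq> space X \<times> space X"
  using eq by (auto simp: equiv_def refl_on_def)

lemma gspace: "x \<in> space X \<Longrightarrow> g i x \<in> space X"
  using measurable_space[OF g] .

lemma C_space: "c \<in> C \<Longrightarrow> c \<in> space X"
  using C EX by auto

lemma C_E: "c \<in> C \<Longrightarrow> d \<in> C \<Longrightarrow> (c, d) \<in> E"
  using C quotientI[of _ "space X" E] quotient_eq_iff[OF eq, of C C c d] by blast

lemma gC: "c \<in> C \<Longrightarrow> g i c \<in> C"
proof -
  assume c: "c \<in> C"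
  obtain x where x: "x \<in> space X" "C = E `` {x}" using C by blast
  have "(c, g i c) \<in> E" using cls[OF C_space[OF c]] by auto
  then show ?thesis using c x eq by (auto simp: equiv_def dest: transD)
qed

lemma C_ne: "C \<noteq> {}"
  using C eq by (auto simp: equiv_def refl_on_def)

lemma preC:
  assumes "U \<in> \<U>" "U \<inter> C \<noteq> {}"
  shows "(g i -` U \<inter> space X) \<inter> C \<noteq> {}"
proof -
  obtain c where c: "c \<in> U" "c \<in> C" using assms(2) by blast
  then have "g i c \<in> (g i -` U \<inter> space X) \<inter> C"
    using gC[OF c(2)] C_space invol by auto
  then show ?thesis by blast
qed

lemma gP: "x \<in> P \<Longrightarrow> g i x \<in> P"
  unfolding P_def
proof (intro CollectI conjI ballI impI)
  assume x: "x \<in> {x \<in> space X. \<forall>B\<in>\<U>. x \<in> B \<longrightarrow> B \<inter> C \<noteq> {}}"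
  then show "g i x \<in> space X" using gspace by blast
  fix B assume B: "B \<in> \<U>" "g i x \<in> B"
  from x have xX: "x \<in> space X" and *: "\<forall>B\<in>\<U>. x \<in> B \<longrightarrow> B \<inter> C \<noteq> {}" by simp_all
  have "(g i -` B \<inter> space X) \<inter> C \<noteq> {}" using bspec[OF * pre[OF B(1), of i]] B(2) xX by simp
  then obtain c where "g i c \<in> B" "c \<in> C" by blast
  then show "B \<inter> C \<noteq> {}" using gC[of c i] by blast
qed

lemma meets_of_P: "B \<in> \<U> \<Longrightarrow> B \<inter> P \<noteq> {} \<Longrightarrow> B \<inter> C \<noteq> {}"
  by (auto simp: P_def)

lemma meager_subset:
  assumes "meager K" "K' \<inter> P \<subseteq> K"
  shows "meager K'"
proof -
  obtain F :: "nat \<Rightarrow> 'a set" where F: "\<forall>n. nowhere_dense (F n)" "K \<inter> P \<subseteq> (\<Union>n. F n)"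
    using assms(1) unfolding meager_def by (elim exE conjE)
  have "K' \<inter> P \<subseteq> K \<inter> P" using assms(2) by simp
  then show ?thesis unfolding meager_def using F by (intro exI[of _ F] conjI) (rule F(1), rule subset_trans)
qed

lemma nowhere_dense_imp_meager: "nowhere_dense K \<Longrightarrow> meager K"
  unfolding meager_def by (intro exI[of _ "\<lambda>_. K"]) auto

lemma meager_empty: "meager {}"
  by (rule nowhere_dense_imp_meager) (auto simp: nowhere_dense_def)

lemma meager_UN_nat:
  assumes "\<And>n::nat. meager (K n)"
  shows "meager (\<Union>n. K n)"
proof -
  have "\<forall>n. \<exists>F :: nat \<Rightarrow> 'a set. (\<forall>m. nowhere_dense (F m)) \<and> K n \<inter> P \<subseteq> (\<Union>m. F m)"
    using assms unfolding meager_def ..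
  from choice[OF this] obtain F :: "nat \<Rightarrow> nat \<Rightarrow> 'a set"
    where F: "\<forall>n. (\<forall>m. nowhere_dense (F n m)) \<and> K n \<inter> P \<subseteq> (\<Union>m. F n m)" ..
  define G where "G k = F (fst (prod_decode k)) (snd (prod_decode k))" for k
  show ?thesis
    unfolding meager_def
  proof (intro exI[of _ G] conjI allI)
    show "nowhere_dense (G k)" for k using F by (simp add: G_def)
    show "(\<Union>n. K n) \<inter> P \<subseteq> (\<Union>k. G k)"
    proof
      fix x assume "x \<in> (\<Union>n. K n) \<inter> P"
      then obtain n where "x \<in> K n \<inter> P" by blast
      then obtain m where "x \<in> F n m" using F by blast
      then have "x \<in> G (prod_encode (n, m))" by (simp add: G_def)
      then show "x \<in> (\<Union>k. G k)" by blast
    qed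
  qed
qed

lemma meager_UN:
  assumes "countable I" "\<And>i. i \<in> I \<Longrightarrow> meager (K i)"
  shows "meager (\<Union>i\<in>I. K i)"
proof (cases "I = {}")
  case True
  then show ?thesis using meager_empty by simp
next
  case False
  have "(\<Union>i\<in>I. K i) = (\<Union>n. K (from_nat_into I n))"
    using range_from_nat_into[OF False assms(1)] by (metis image_image)
  moreover have "meager (\<Union>n. K (from_nat_into I n))"
    by (intro meager_UN_nat assms(2) from_nat_into[OF False])
  ultimately show ?thesis by simp
qed

lemma meager_Un: "meager A \<Longrightarrow> meager B \<Longrightarrow> meager (A \<union> B)"
  using meager_UN[of "UNIV :: bool set" "\<lambda>b. if b then A else B"] by (simp add: UNIV_bool Un_commute)

lemma decide:
  assumes "V \<in> \<U>" "B \<in> \<U>" "c \<in> V" "c \<in> C"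
  obtains V' where "V' \<in> \<U>" "V' \<subseteq> V" "c \<in> V'" "if c \<in> B then V' \<subseteq> B else V' \<inter> B = {}"
proof (cases "c \<in> B")
  case True
  then show thesis using that[of "V \<inter> B"] assms Int by simp
next
  case False
  show thesis
  proof (rule that[of "V \<inter> (space X - B)"])
    show "V \<inter> (space X - B) \<in> \<U>" using assms(1,2) by (intro Int Compl)
    show "c \<in> V \<inter> (space X - B)" using False assms(3) C_space[OF assms(4)] by simp
    show "if c \<in> B then V \<inter> (space X - B) \<subseteq> B else V \<inter> (space X - B) \<inter> B = {}" using False by auto
  qed blast
qed

text \<open>The usual shrinking of open sets past the nowhere dense ones, where stage
  \<open>n\<close> also decides the basic set \<open>e n\<close> and satisfies the clause
  \<open>q n\<close>; this replaces shrinking diameters and makes \<open>coding_limit\<close>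
  applicable.\<close>

theorem baire:
  assumes "U \<in> \<U>" "U \<inter> C \<noteq> {}"
  shows "\<not> meager U"
proof
  assume "meager U"
  then obtain F :: "nat \<Rightarrow> 'a set" where F: "\<And>n. nowhere_dense (F n)" "U \<inter> P \<subseteq> (\<Union>n. F n)"
    unfolding meager_def by blast
  define \<Q>' where "\<Q>' = insert {({}, False)} \<Q>"
  define e where "e = from_nat_into \<U>"
  define q where "q = from_nat_into \<Q>'"
  have re: "range e = \<U>" unfolding e_def using codingD(1)[OF cod] ne by (intro range_from_nat_into)
  have rq: "range q = \<Q>'" unfolding q_def \<Q>'_def using codingD(3)[OF cod] by (intro range_from_nat_into) simp_all
  have eU: "e n \<in> \<U>" for n using re by blast
  have qn: "q n = {({}, False)} \<or> q n \<in> \<Q>" for n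
  proof -
    have "q n \<in> \<Q>'" using rq by blast
    then show ?thesis by (simp add: \<Q>'_def)
  qed
  have qU: "fst l \<in> \<U>" if "l \<in> q n" for l n
  proof (cases "q n \<in> \<Q>")
    case True
    then show ?thesis using subsetD[OF codingD(4)[OF cod True] that] by (simp add: mem_Times_iff)
  next
    case False
    then show ?thesis using qn[of n] that empty_U by simp
  qed
  have q: "\<exists>l\<in>q n. (z \<in> fst l) = snd l" if "z \<in> space X" for z n
    using qn[of n] codingD(5)[OF cod that, of "q n"] by (elim disjE) simp_all
  have "\<exists>V. \<forall>n. (V n \<in> \<U> \<and> V n \<inter> C \<noteq> {} \<and> V n \<subseteq> U) \<and> (V (Suc n) \<subseteq> V n \<and>
    (V (Suc n) \<subseteq> e n \<or> V (Suc n) \<inter> e n = {}) \<and>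
    (\<exists>l\<in>q n. if snd l then V (Suc n) \<subseteq> fst l else V (Suc n) \<inter> fst l = {}) \<and> V (Suc n) \<inter> P \<inter> F n = {})"
    (is "\<exists>V. \<forall>n. ?R V n")
  proof (rule dependent_nat_choice)
    show "\<exists>V. V \<in> \<U> \<and> V \<inter> C \<noteq> {} \<and> V \<subseteq> U" using assms by blast
    fix V n assume V: "V \<in> \<U> \<and> V \<inter> C \<noteq> {} \<and> V \<subseteq> U"
    \<comment> \<open>Following one point \<open>c\<close> of the orbit tells which way to decide
      \<open>e n\<close> and which literal of the clause to satisfy, and keeps the smaller sets
      nonempty in the closure.\<close>
    then obtain c where c: "c \<in> V" "c \<in> C" by blast
    obtain V1 where V1: "V1 \<in> \<U>" "V1 \<subseteq> V" "c \<in> V1" "if c \<in> e n then V1 \<subseteq> e n else V1 \<inter> e n = {}"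
      by (rule decide[OF conjunct1[OF V] eU[of n] c])
    obtain l where l: "l \<in> q n" "(c \<in> fst l) = snd l" using q[OF C_space[OF c(2)]] by blast
    obtain V2 where V2: "V2 \<in> \<U>" "V2 \<subseteq> V1" "c \<in> V2" "if c \<in> fst l then V2 \<subseteq> fst l else V2 \<inter> fst l = {}"
      by (rule decide[OF V1(1) qU[OF l(1)] V1(3) c(2)])
    have "V2 \<inter> C \<noteq> {}" using V2(3) c(2) by blast
    then obtain V3 where V3: "V3 \<in> \<U>" "V3 \<subseteq> V2" "V3 \<inter> C \<noteq> {}" "V3 \<inter> P \<inter> F n = {}"
      by (rule nowhere_denseD[OF F(1) V2(1)])
    have "V3 \<subseteq> e n \<or> V3 \<inter> e n = {}" using V1(4) V2(2) V3(2) by (cases "c \<in> e n") auto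
    moreover have "if snd l then V3 \<subseteq> fst l else V3 \<inter> fst l = {}"
      using V2(4) V3(2) l(2) by (cases "c \<in> fst l") auto
    moreover have "V3 \<subseteq> V" using V1(2) V2(2) V3(2) by blast
    ultimately show "\<exists>V'. (V' \<in> \<U> \<and> V' \<inter> C \<noteq> {} \<and> V' \<subseteq> U) \<and> (V' \<subseteq> V \<and> (V' \<subseteq> e n \<or> V' \<inter> e n = {}) \<and>
      (\<exists>l\<in>q n. if snd l then V' \<subseteq> fst l else V' \<inter> fst l = {}) \<and> V' \<inter> P \<inter> F n = {})"
      using V V3(1,3,4) l(1) by (intro exI[of _ V3] conjI bexI[of _ l]) blast+
  qed
  then obtain V where "\<forall>n. ?R V n" ..
  then have V: "V n \<in> \<U>" "V n \<inter> C \<noteq> {}" "V n \<subseteq> U" "V (Suc n) \<subseteq> V n"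
    "V (Suc n) \<subseteq> e n \<or> V (Suc n) \<inter> e n = {}"
    "\<exists>l\<in>q n. if snd l then V (Suc n) \<subseteq> fst l else V (Suc n) \<inter> fst l = {}" "V (Suc n) \<inter> P \<inter> F n = {}" for n
    by blast+
  have 1: "V n \<noteq> {}" "V n \<subseteq> space X" for n using V(1,2)[of n] Uspace by auto
  have 2: "\<exists>n. V n \<subseteq> B \<or> V n \<inter> B = {}" if B: "B \<in> \<U>" for B
  proof -
    obtain n where "B = e n" using re B by blast
    then show ?thesis using V(5)[of n] by blast
  qed
  have 3: "\<exists>n. \<exists>l\<in>D. if snd l then V n \<subseteq> fst l else V n \<inter> fst l = {}" if D: "D \<in> \<Q>" for D
  proof -
    obtain n where "D = q n" using rq D unfolding \<Q>'_def by (metis insertI2 imageE)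
    then show ?thesis using V(6)[of n] by blast
  qed
  obtain z where z: "z \<in> space X" "\<forall>B\<in>\<U>. (z \<in> B \<longleftrightarrow> (\<exists>n. V n \<subseteq> B)) \<and> (z \<notin> B \<longleftrightarrow> (\<exists>n. V n \<inter> B = {}))"
    using coding_limit[OF cod, of V, OF V(4) 1 2 3] by blast
  have zV: "z \<in> V n" for n using bspec[OF z(2) V(1)[of n]] by blast
  have "z \<in> P"
    unfolding P_def
  proof (intro CollectI conjI ballI impI)
    fix B assume B: "B \<in> \<U>" "z \<in> B"
    obtain n where "V n \<subseteq> B" using bspec[OF z(2) B(1)] B(2) by blast
    then show "B \<inter> C \<noteq> {}" using V(2)[of n] by blast
  qed (rule z(1))
  moreover have "z \<in> U" using zV[of 0] V(3)[of 0] by blast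
  ultimately obtain n where "z \<in> F n" using F(2) by blast
  then show False using V(7)[of n] zV[of "Suc n"] \<open>z \<in> P\<close> by blast
qed

text \<open>Only countably many basic sets \<open>V\<close> have \<open>V \<inter> A\<close> meager,
  so \<open>A\<close> is meager in their union. By the local hypothesis these sets are dense in
  \<open>U\<close>, so what they leave of \<open>U\<close> is nowhere dense.\<close>

lemma meager_of_local:
  assumes U: "U \<in> \<U>"
    and loc: "\<And>W. W \<in> \<U> \<Longrightarrow> W \<subseteq> U \<Longrightarrow> W \<inter> C \<noteq> {} \<Longrightarrow>
      \<exists>V\<in>\<U>. V \<subseteq> W \<and> V \<inter> C \<noteq> {} \<and> meager (V \<inter> A)"
  shows "meager (U \<inter> A)"
proof -
  define \<V> where "\<V> = {V \<in> \<U>. meager (V \<inter> A)}"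
  have "countable \<V>" unfolding \<V>_def by (rule countable_subset[OF _ codingD(1)[OF cod]]) blast
  then have m: "meager (\<Union>V\<in>\<V>. V \<inter> A)" by (rule meager_UN) (simp add: \<V>_def)
  have "nowhere_dense (U - \<Union>\<V>)"
    unfolding nowhere_dense_def
  proof (intro ballI impI)
    fix W assume W: "W \<in> \<U>" "W \<inter> C \<noteq> {}"
    show "\<exists>V\<in>\<U>. V \<subseteq> W \<and> V \<inter> C \<noteq> {} \<and> V \<inter> P \<inter> (U - \<Union>\<V>) = {}"
    proof (cases "(W \<inter> U) \<inter> C = {}")
      case True
      then have "(W \<inter> U) \<inter> P = {}" using meets_of_P[OF Int[OF W(1) U]] by blast
      then show ?thesis using W by (intro bexI[of _ W]) auto
    next
      case False
      obtain V where "V \<in> \<U>" "V \<subseteq> W \<inter> U" "V \<inter> C \<noteq> {}" "meager (V \<inter> A)"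
        using loc[OF Int[OF W(1) U] Int_lower2 False] by blast
      then show ?thesis by (intro bexI[of _ V]) (auto simp: \<V>_def)
    qed
  qed
  then have "meager ((U - \<Union>\<V>) \<union> (\<Union>V\<in>\<V>. V \<inter> A))"
    using m by (intro meager_Un[OF nowhere_dense_imp_meager])
  then show ?thesis by (rule meager_subset) blast
qed

text \<open>A local form of the Baire property: below every open set there is one in which
  \<open>A\<close> is meager or comeager. The alternative is symmetric, so complements are immediate
  in the induction over the sigma-algebra.\<close>

lemma baire_property:
  assumes A: "A \<in> sets X" and U: "U \<in> \<U>" "U \<inter> C \<noteq> {}"
  shows "\<exists>V\<in>\<U>. V \<subseteq> U \<and> V \<inter> C \<noteq> {} \<and> (meager (V \<inter> A) \<or> meager (V - A))"
proof -
  have "A \<in> sigma_sets (space X) \<B>" using A gen by simp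
  then show ?thesis using U
  proof (induction arbitrary: U)
    case (Basic a)
    obtain c where c: "c \<in> U" "c \<in> C" using Basic by blast
    have "a \<in> \<U>" using Basic(1) gen(2) by blast
    obtain V where V: "V \<in> \<U>" "V \<subseteq> U" "c \<in> V" "if c \<in> a then V \<subseteq> a else V \<inter> a = {}"
      by (rule decide[OF Basic(2) \<open>a \<in> \<U>\<close> c])
    have "V \<inter> a = {} \<or> V - a = {}" using V(4) by (cases "c \<in> a") auto
    then have "meager (V \<inter> a) \<or> meager (V - a)" using meager_empty by metis
    then show ?case using V c(2) by (intro bexI[of _ V]) auto
  next
    case Empty
    then show ?case using meager_empty by (intro bexI[of _ U]) auto
  next
    case (Compl a)
    obtain V where V: "V \<in> \<U>" "V \<subseteq> U" "V \<inter> C \<noteq> {}" "meager (V \<inter> a) \<or> meager (V - a)"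
      using Compl.IH[OF Compl.prems] by blast
    have "V \<inter> (space X - a) = V - a" "V - (space X - a) = V \<inter> a" using Uspace[OF V(1)] by auto
    then show ?case using V by (intro bexI[of _ V]) auto
  next
    case (Union a)
    show ?case
    proof (cases "\<exists>i. \<exists>V\<in>\<U>. V \<subseteq> U \<and> V \<inter> C \<noteq> {} \<and> meager (V - a i)")
      case True
      then obtain i V where V: "V \<in> \<U>" "V \<subseteq> U" "V \<inter> C \<noteq> {}" "meager (V - a i)" by blast
      have "meager (V - (\<Union>i. a i))" by (rule meager_subset[OF V(4)]) blast
      then show ?thesis using V by (intro bexI[of _ V]) simp_all
    next
      case False
      \<comment> \<open>No \<open>a i\<close> is comeager in any open part of \<open>U\<close>, so
        by induction each one is meager in some open subset of every open part, hence in all of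
        \<open>U\<close>.\<close>
      have "meager (U \<inter> a i)" for i
      proof (rule meager_of_local[OF Union.prems(1)])
        fix W assume W: "W \<in> \<U>" "W \<subseteq> U" "W \<inter> C \<noteq> {}"
        obtain V where V: "V \<in> \<U>" "V \<subseteq> W" "V \<inter> C \<noteq> {}" "meager (V \<inter> a i) \<or> meager (V - a i)"
          using Union.IH[OF W(1,3)] by blast
        moreover have "\<not> meager (V - a i)" using False V(1-3) W(2) by (meson subset_trans)
        ultimately show "\<exists>V\<in>\<U>. V \<subseteq> W \<and> V \<inter> C \<noteq> {} \<and> meager (V \<inter> a i)" by (intro bexI[of _ V]) simp_all
      qed
      then have "meager (\<Union>i. U \<inter> a i)" by (rule meager_UN_nat)
      then have "meager (U \<inter> (\<Union>i. a i))" by simp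
      then show ?thesis using Union.prems by (intro bexI[of _ U]) simp_all
    qed
  qed
qed

text \<open>\<open>g i\<close> is an involution preserving \<U>, \<open>C\<close> and
  \<open>P\<close>, so an open set avoiding \<open>K\<close> inside the preimage of \<open>U\<close>
  is carried back to one inside \<open>U\<close>.\<close>

lemma nowhere_dense_pre:
  assumes "nowhere_dense K"
  shows "nowhere_dense (g i -` K \<inter> space X)"
  unfolding nowhere_dense_def
proof (intro ballI impI)
  fix U assume U: "U \<in> \<U>" "U \<inter> C \<noteq> {}"
  obtain V where V: "V \<in> \<U>" "V \<subseteq> g i -` U \<inter> space X" "V \<inter> C \<noteq> {}" "V \<inter> P \<inter> K = {}"
    by (rule nowhere_denseD[OF assms pre[OF U(1)] preC[OF U]])
  show "\<exists>V\<in>\<U>. V \<subseteq> U \<and> V \<inter> C \<noteq> {} \<and> V \<inter> P \<inter> (g i -` K \<inter> space X) = {}"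
  proof (intro bexI[of _ "g i -` V \<inter> space X"] conjI)
    show "g i -` V \<inter> space X \<subseteq> U"
    proof
      fix y assume y: "y \<in> g i -` V \<inter> space X"
      then have "g i (g i y) \<in> U" using V(2) by blast
      then show "y \<in> U" using invol y by simp
    qed
    show "g i -` V \<inter> space X \<inter> P \<inter> (g i -` K \<inter> space X) = {}"
    proof -
      have "g i y \<in> V \<inter> P \<inter> K" if "y \<in> g i -` V \<inter> space X \<inter> P \<inter> (g i -` K \<inter> space X)" for y
        using that gP[of y i] by simp
      then show ?thesis unfolding V(4) by blast
    qed
  qed (rule preC[OF V(1,3)], rule pre[OF V(1)])
qed

lemma meager_pre:
  assumes "meager K"
  shows "meager (g i -` K \<inter> space X)"
proof -
  obtain F :: "nat \<Rightarrow> 'a set" where F: "\<forall>n. nowhere_dense (F n)" "K \<inter> P \<subseteq> (\<Union>n. F n)"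
    using assms unfolding meager_def by (elim exE conjE)
  show ?thesis
    unfolding meager_def
  proof (intro exI[of _ "\<lambda>n. g i -` F n \<inter> space X"] conjI allI)
    show "nowhere_dense (g i -` F n \<inter> space X)" for n using F(1) by (intro nowhere_dense_pre) simp
    show "g i -` K \<inter> space X \<inter> P \<subseteq> (\<Union>n. g i -` F n \<inter> space X)"
    proof
      fix x assume x: "x \<in> g i -` K \<inter> space X \<inter> P"
      then have "g i x \<in> K \<inter> P" using gP[of x i] by simp
      then obtain n where "g i x \<in> F n" using F(2) by blast
      then show "x \<in> (\<Union>n. g i -` F n \<inter> space X)" using x by blast
    qed
  qed
qed

text \<open>A Borel complete section is comeager in some open set \<open>U\<close>; a generic orbit is dense and all of its
  points in \<open>U\<close> lie in the section.\<close>

lemma complete_section_generic: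
  assumes S: "S \<in> sets X" "\<forall>x\<in>space X. S \<inter> E `` {x} \<noteq> {}"
  obtains U x where "U \<in> \<U>" "U \<inter> C \<noteq> {}" "x \<in> space X" "U \<inter> E `` {x} \<subseteq> S"
    "\<forall>V\<in>\<U>. V \<inter> C \<noteq> {} \<longrightarrow> V \<inter> E `` {x} \<noteq> {}"
proof -
  have sC: "space X \<inter> C \<noteq> {}" using C_ne C_space by blast
  \<comment> \<open>Every orbit meets \<open>S\<close>, so the preimages of \<open>S\<close> under
    the countably many \<open>g i\<close> cover the space, and they would all be meager.\<close>
  have "\<not> meager S"
  proof
    assume "meager S"
    then have "meager (\<Union>i. g i -` S \<inter> space X)" by (intro meager_UN_nat meager_pre)
    moreover have "space X \<subseteq> (\<Union>i. g i -` S \<inter> space X)"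
    proof
      fix x assume x: "x \<in> space X"
      have "S \<inter> range (\<lambda>i. g i x) \<noteq> {}" using bspec[OF S(2) x] unfolding cls[OF x] .
      then obtain i where "g i x \<in> S" by blast
      then show "x \<in> (\<Union>i. g i -` S \<inter> space X)" using x by blast
    qed
    ultimately have "meager (space X)" by (intro meager_subset[of "\<Union>i. g i -` S \<inter> space X" "space X"] le_infI1)
    then show False using baire[OF space_U sC] by simp
  qed
  \<comment> \<open>Otherwise the Baire property makes \<open>S\<close> meager in some open part of
    every open set, and \<open>meager_of_local\<close> makes it meager.\<close>
  obtain U where U: "U \<in> \<U>" "U \<inter> C \<noteq> {}" "meager (U - S)"
  proof (rule ccontr)
    assume no: "\<not> thesis"
    have "meager (space X \<inter> S)"
    proof (rule meager_of_local[OF space_U])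
      fix W assume W: "W \<in> \<U>" "W \<inter> C \<noteq> {}"
      obtain V where V: "V \<in> \<U>" "V \<subseteq> W" "V \<inter> C \<noteq> {}" "meager (V \<inter> S) \<or> meager (V - S)"
        using baire_property[OF S(1) W] by blast
      then show "\<exists>V\<in>\<U>. V \<subseteq> W \<and> V \<inter> C \<noteq> {} \<and> meager (V \<inter> S)"
        using no that[OF V(1,3)] by (intro bexI[OF _ V(1)]) blast
    qed
    moreover have "space X \<inter> S = S" using sets.sets_into_space[OF S(1)] by blast
    ultimately show False using \<open>\<not> meager S\<close> by simp
  qed
  define K where "K V = {x \<in> space X. \<forall>i. g i x \<notin> V}" for V
  \<comment> \<open>Every open \<open>W\<close> meeting the orbit contains a point \<open>c\<close>
    of it that some \<open>g i\<close> moves into \<open>V\<close>; near \<open>c\<close> the same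
    \<open>g i\<close> moves all points into \<open>V\<close>.\<close>
  have nK: "nowhere_dense (K V)" if V: "V \<in> \<U>" "V \<inter> C \<noteq> {}" for V
    unfolding nowhere_dense_def
  proof (intro ballI impI)
    fix W assume W: "W \<in> \<U>" "W \<inter> C \<noteq> {}"
    obtain c d where cd: "c \<in> W" "c \<in> C" "d \<in> V" "d \<in> C" using V W by blast
    have "d \<in> E `` {c}" using C_E[OF cd(2,4)] by simp
    then have "d \<in> range (\<lambda>i. g i c)" unfolding cls[OF C_space[OF cd(2)]] .
    then obtain i where i: "g i c = d" by blast
    have "c \<in> W \<inter> (g i -` V \<inter> space X) \<inter> C" using cd i C_space by simp
    then show "\<exists>V'\<in>\<U>. V' \<subseteq> W \<and> V' \<inter> C \<noteq> {} \<and> V' \<inter> P \<inter> K V = {}"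
      by (intro bexI[of _ "W \<inter> (g i -` V \<inter> space X)"] Int[OF W(1) pre[OF V(1)]]) (auto simp: K_def)
  qed
  define \<V> where "\<V> = {V \<in> \<U>. V \<inter> C \<noteq> {}}"
  have "countable \<V>" unfolding \<V>_def by (rule countable_subset[OF _ codingD(1)[OF cod]]) blast
  then have "meager (\<Union>V\<in>\<V>. K V)"
    by (rule meager_UN) (auto simp: \<V>_def intro: nowhere_dense_imp_meager nK)
  moreover have "meager (\<Union>i. g i -` (U - S) \<inter> space X)" using U(3) by (intro meager_UN_nat meager_pre)
  ultimately have M: "meager ((\<Union>V\<in>\<V>. K V) \<union> (\<Union>i. g i -` (U - S) \<inter> space X))" by (rule meager_Un)
  have "\<not> U \<inter> P \<subseteq> (\<Union>V\<in>\<V>. K V) \<union> (\<Union>i. g i -` (U - S) \<inter> space X)"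
    using baire[OF U(1,2)] meager_subset[OF M] by blast
  then obtain x where x: "x \<in> U" "x \<notin> (\<Union>V\<in>\<V>. K V)" "x \<notin> (\<Union>i. g i -` (U - S) \<inter> space X)" by blast
  have xX: "x \<in> space X" using x(1) Uspace[OF U(1)] by blast
  show thesis
  proof (rule that[OF U(1,2) xX])
    show "U \<inter> E `` {x} \<subseteq> S" unfolding cls[OF xX] using x(3) xX by auto
    show "\<forall>V\<in>\<U>. V \<inter> C \<noteq> {} \<longrightarrow> V \<inter> E `` {x} \<noteq> {}"
    proof (intro ballI impI)
      fix V assume "V \<in> \<U>" "V \<inter> C \<noteq> {}"
      then have "x \<notin> K V" using x(2) by (auto simp: \<V>_def)
      then show "V \<inter> E `` {x} \<noteq> {}" unfolding cls[OF xX] using xX by (auto simp: K_def)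
    qed
  qed
qed

section \<open>Splitting levels of finite subsets of a dense orbit\<close>

lemma two_points:
  assumes "V \<in> \<U>" "V \<inter> C \<noteq> {}"
  obtains B where "B \<in> \<U>" "(V \<inter> B) \<inter> C \<noteq> {}" "(V \<inter> (space X - B)) \<inter> C \<noteq> {}"
proof -
  have "\<exists>c\<in>V \<inter> C. \<exists>d\<in>V \<inter> C. c \<noteq> d"
    using dense[OF assms(1)] is_singletonI'[OF assms(2)] by blast
  then obtain c d where cd: "c \<in> V" "c \<in> C" "d \<in> V" "d \<in> C" "c \<noteq> d" by blast
  then obtain B where B: "B \<in> \<U>" "c \<in> B \<longleftrightarrow> d \<notin> B"
    using codingD(7)[OF cod C_space[OF cd(2)] C_space[OF cd(4)]] by blast
  show thesis
    by (rule that[OF B(1)]) (use cd B(2) C_space in auto)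
qed

lemma large_subset:
  assumes D: "\<forall>V\<in>\<U>. V \<inter> C \<noteq> {} \<longrightarrow> V \<inter> D \<noteq> {}" and V: "V \<in> \<U>" "V \<inter> C \<noteq> {}"
  shows "\<exists>A. A \<subseteq> V \<inter> D \<and> finite A \<and> card A = r"
  using V
proof (induction r arbitrary: V)
  case 0
  then show ?case by (intro exI[of _ "{}"]) simp
next
  case (Suc r)
  obtain B where B: "B \<in> \<U>" "(V \<inter> B) \<inter> C \<noteq> {}" "(V \<inter> (space X - B)) \<inter> C \<noteq> {}"
    by (rule two_points[OF Suc.prems])
  obtain A where A: "A \<subseteq> (V \<inter> B) \<inter> D" "finite A" "card A = r"
    using Suc.IH[OF Int[OF Suc.prems(1) B(1)] B(2)] by blast
  obtain a where a: "a \<in> (V \<inter> (space X - B)) \<inter> D"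
    using bspec[OF D Int[OF Suc.prems(1) Compl[OF B(1)]]] B(3) by blast
  have "a \<notin> A" using A a by blast
  then show ?case using A a by (intro exI[of _ "insert a A"]) auto
qed

definition e where "e = from_nat_into \<U>"

lemma range_e: "range e = \<U>"
  unfolding e_def using ne codingD(1)[OF cod] by (rule range_from_nat_into)

lemma e_U: "e n \<in> \<U>"
  using range_e by blast

definition split_level where "split_level A = (LEAST m. A \<inter> e m \<noteq> {} \<and> A - e m \<noteq> {})" for A :: "'a set"

text \<open>Pairs are taken in \<open>C\<close> and not in the generic orbit: the levels must be
  known when the coloring is chosen, and the generic orbit depends on the section obtained
  afterwards. \<open>subset_with_split_level\<close> transfers the levels to any dense set.\<close>

definition split_levels where
  "split_levels U = {m. \<exists>c\<in>U \<inter> C. \<exists>d\<in>U \<inter> C. (\<forall>j<m. c \<in> e j \<longleftrightarrow> d \<in> e j) \<and> c \<in> e m \<and> d \<notin> e m}"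

lemma atom:
  assumes "U \<in> \<U>"
  shows "{y \<in> U. \<forall>j<n. y \<in> e j \<longleftrightarrow> c \<in> e j} \<in> \<U>"
proof (induction n)
  case 0
  then show ?case using assms by simp
next
  case (Suc n)
  have "{y \<in> U. \<forall>j<Suc n. y \<in> e j \<longleftrightarrow> c \<in> e j} =
      {y \<in> U. \<forall>j<n. y \<in> e j \<longleftrightarrow> c \<in> e j} \<inter> (if c \<in> e n then e n else space X - e n)"
    using Uspace[OF assms] by (auto simp: less_Suc_eq)
  then show ?case using Int[OF Suc] Compl e_U by simp
qed

text \<open>The points of \<open>U\<close> that agree with \<open>c\<close> on the first
  \<open>n\<close> basic sets form an open set, which contains two points of the orbit since none is
  isolated. Their first difference has index at least \<open>n\<close>.\<close>

lemma infinite_split_levels: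
  assumes U: "U \<in> \<U>" "U \<inter> C \<noteq> {}"
  shows "infinite (split_levels U)"
  unfolding infinite_nat_iff_unbounded_le
proof
  fix n
  obtain c where c: "c \<in> U" "c \<in> C" using U by blast
  define A where "A = {y \<in> U. \<forall>j<n. y \<in> e j \<longleftrightarrow> c \<in> e j}"
  have A: "A \<in> \<U>" "A \<inter> C \<noteq> {}" using atom[OF U(1)] c by (auto simp: A_def)
  obtain B where B: "B \<in> \<U>" "(A \<inter> B) \<inter> C \<noteq> {}" "(A \<inter> (space X - B)) \<inter> C \<noteq> {}"
    by (rule two_points[OF A])
  then obtain a b where ab: "a \<in> A" "b \<in> A" "a \<in> C" "b \<in> C" "a \<in> B" "b \<notin> B" by blast
  obtain k where k: "B = e k" using B(1) range_e by blast
  define m where "m = (LEAST m. (a \<in> e m) \<noteq> (b \<in> e m))"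
  have m: "(a \<in> e m) \<noteq> (b \<in> e m)" unfolding m_def by (rule LeastI[of _ k]) (use ab k in simp)
  have lt: "a \<in> e j \<longleftrightarrow> b \<in> e j" if "j < m" for j using not_less_Least[of j] that unfolding m_def by blast
  have "n \<le> m"
  proof (rule ccontr)
    assume "\<not> n \<le> m"
    then show False using m ab(1,2) by (auto simp: A_def)
  qed
  moreover have "a \<in> U \<inter> C" "b \<in> U \<inter> C" using ab by (auto simp: A_def)
  then have "m \<in> split_levels U" unfolding split_levels_def using m lt by (cases "a \<in> e m") blast+
  ultimately show "\<exists>m\<ge>n. m \<in> split_levels U" by blast
qed

text \<open>Inside the open set \<open>T\<close> of points agreeing with \<open>c\<close> below
  \<open>m\<close>, no earlier basic set can split anything, while both \<open>e m\<close> and its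
  complement meet \<open>T\<close> in open sets, where \<open>D\<close> is dense.\<close>

lemma subset_with_split_level:
  assumes D: "\<forall>V\<in>\<U>. V \<inter> C \<noteq> {} \<longrightarrow> V \<inter> D \<noteq> {}" and U: "U \<in> \<U>" and m: "m \<in> split_levels U" and n: "n > 1"
  shows "\<exists>A. A \<subseteq> U \<inter> D \<and> finite A \<and> card A = n \<and> split_level A = m"
proof -
  obtain c d where cd: "c \<in> U \<inter> C" "d \<in> U \<inter> C" "\<forall>j<m. c \<in> e j \<longleftrightarrow> d \<in> e j" "c \<in> e m" "d \<notin> e m"
    using m unfolding split_levels_def by blast
  define T where "T = {y \<in> U. \<forall>j<m. y \<in> e j \<longleftrightarrow> c \<in> e j}"
  have T: "T \<in> \<U>" unfolding T_def by (rule atom[OF U])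
  have 1: "T \<inter> e m \<in> \<U>" "(T \<inter> e m) \<inter> C \<noteq> {}" using Int[OF T e_U] cd by (auto simp: T_def)
  have 2: "T \<inter> (space X - e m) \<in> \<U>" "(T \<inter> (space X - e m)) \<inter> C \<noteq> {}"
    using Int[OF T Compl[OF e_U]] cd C_space by (auto simp: T_def)
  \<comment> \<open>All points but one are taken on the side of \<open>e m\<close>;
    \<open>n > 1\<close> guarantees that this side is occupied.\<close>
  obtain A where A: "A \<subseteq> (T \<inter> e m) \<inter> D" "finite A" "card A = n - 1" using large_subset[OF D 1] by blast
  obtain b where b: "b \<in> (T \<inter> (space X - e m)) \<inter> D" using bspec[OF D 2(1)] 2(2) by blast
  have "b \<notin> A" using A b by blast
  have "A \<noteq> {}" using A(3) n by auto
  have "split_level (insert b A) = m"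
    unfolding split_level_def
  proof (rule Least_equality)
    show "insert b A \<inter> e m \<noteq> {} \<and> insert b A - e m \<noteq> {}" using \<open>A \<noteq> {}\<close> A b by auto
    fix j assume j: "insert b A \<inter> e j \<noteq> {} \<and> insert b A - e j \<noteq> {}"
    show "m \<le> j"
    proof (rule ccontr)
      assume "\<not> m \<le> j"
      then have "y \<in> e j \<longleftrightarrow> c \<in> e j" if "y \<in> insert b A" for y using that A b by (auto simp: T_def)
      then show False using j by blast
    qed
  qed
  then show ?thesis
    using A b n \<open>b \<notin> A\<close> by (intro exI[of _ "insert b A"]) (auto simp: T_def)
qed

end

section \<open>Increasing tuples and the coloring by the first splitting set\<close>

lemma increasing_list:
  assumes "standard_borel X" "finite A" "A \<subseteq> space X"
  shows "set (increasing_list X A) = A" "length (increasing_list X A) = card A"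
proof -
  have *: "set (increasing_list X A) = A \<and>
      sorted_wrt (\<lambda>x y. (x, y) \<in> the_order X \<and> x \<noteq> y) (increasing_list X A)"
    unfolding increasing_list_def by (rule theI'[OF increasing_list_ex1[OF assms]])
  then show set: "set (increasing_list X A) = A" by blast
  have "distinct xs" if "sorted_wrt (\<lambda>x y. (x, y) \<in> the_order X \<and> x \<noteq> y) xs" for xs
    using that by (induction xs) auto
  then show "length (increasing_list X A) = card A"
    using * distinct_card[of "increasing_list X A"] by simp
qed

lemma class_subsetsD:
  assumes "A \<in> class_subsets X E n"
  shows "finite A" "card A = n" "A \<subseteq> space X"
  using assms by (auto simp: class_subsets_def nsets_def)

lemma increasing_tuple_space:
  assumes X: "standard_borel X"
  shows "(\<lambda>A. \<lambda>i\<in>{..<n}. increasing_list X A ! i)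
    \<in> class_subsets X E n \<rightarrow> space (\<Pi>\<^sub>M i\<in>{..<n}. X)"
proof
  fix A assume "A \<in> class_subsets X E n"
  note A = class_subsetsD[OF this]
  have "increasing_list X A ! i \<in> space X" if "i < n" for i
    using nth_mem[of i "increasing_list X A"] increasing_list[OF X A(1,3)] A(2,3) that by auto
  then show "(\<lambda>i\<in>{..<n}. increasing_list X A ! i) \<in> space (\<Pi>\<^sub>M i\<in>{..<n}. X)"
    by (simp add: space_PiM PiE_def)
qed

text \<open>The index of the first splitting set does not depend on the order of the entries, so it
  can be computed from the increasing tuple by countably many Borel conditions on coordinates.
  Listing is measurable by the choice of the pulled-back sigma-algebra.\<close>

lemma borel_coloring_of_first_split:
  assumes X: "standard_borel X" and e [measurable]: "\<And>m::nat. e m \<in> sets X" and k: "k > 1"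
  shows "borel_coloring X E n k (\<lambda>A. if (LEAST m. A \<inter> e m \<noteq> {} \<and> A - e m \<noteq> {}) \<in> L then 1 else 2)"
proof -
  define M where "M = (\<Pi>\<^sub>M i\<in>{..<n}. X)"
  define \<iota> where "\<iota> A = (\<lambda>i\<in>{..<n}. increasing_list X A ! i)" for A
  define d where "d t = (LEAST m. (\<exists>i\<in>{..<n}. t i \<in> e m) \<and> (\<exists>i\<in>{..<n}. t i \<notin> e m))" for t
  have comp: "(\<lambda>t. t i) \<in> M \<rightarrow>\<^sub>M X" if "i \<in> {..<n}" for i
    unfolding M_def using that by (rule measurable_component_singleton)
  have in_e: "Measurable.pred M (\<lambda>t. t i \<in> e m)" if "i \<in> {..<n}" for i m
    using measurable_sets[OF comp[OF that] e] by (auto simp: pred_def vimage_def Int_def conj_commute)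
  have [measurable]: "d \<in> M \<rightarrow>\<^sub>M count_space UNIV"
    unfolding d_def using in_e
    by (intro measurable_Least pred_intros_logic pred_intros_finite) simp_all
  have "Measurable.pred M (\<lambda>t. d t \<in> L)" by measurable
  then have "(\<lambda>t. if d t \<in> L then 1 else 2) \<in> M \<rightarrow>\<^sub>M count_space {1..k}"
    using k by (intro measurable_If) (simp_all add: pred_def)
  moreover have "\<iota> \<in> class_subsets_space X E n \<rightarrow>\<^sub>M M"
    unfolding class_subsets_space_def \<iota>_def M_def
    by (rule measurable_vimage_algebra1[OF increasing_tuple_space[OF X]])
  ultimately have *: "(\<lambda>A. if d (\<iota> A) \<in> L then 1 else 2) \<in> class_subsets_space X E n \<rightarrow>\<^sub>M count_space {1..k}"
    by (rule measurable_compose[rotated])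
  have "d (\<iota> A) = (LEAST m. A \<inter> e m \<noteq> {} \<and> A - e m \<noteq> {})" if "A \<in> class_subsets X E n" for A
  proof -
    note A = class_subsetsD[OF that]
    have "\<iota> A ` {..<n} = A"
    proof -
      have "\<iota> A ` {..<n} = (!) (increasing_list X A) ` {0..<n}"
        by (intro image_cong) (auto simp: \<iota>_def)
      then show ?thesis
        using nth_image[of n "increasing_list X A"] increasing_list[OF X A(1,3)] A(2) by simp
    qed
    moreover have "(\<exists>i\<in>{..<n}. t i \<in> B) \<longleftrightarrow> t ` {..<n} \<inter> B \<noteq> {}"
      "(\<exists>i\<in>{..<n}. t i \<notin> B) \<longleftrightarrow> t ` {..<n} - B \<noteq> {}" for t :: "nat \<Rightarrow> 'a" and B by auto
    ultimately show ?thesis by (simp add: d_def)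
  qed
  then show ?thesis
    unfolding borel_coloring_def
    by (intro measurable_cong[THEN iffD1, OF _ *]) (simp add: class_subsets_space_def)
qed

theorem smooth_of_weak_borel_ramsey:
  fixes X :: "'a measure"
  assumes X: "standard_borel X" and E: "countable_borel_equiv X E" and nk: "n > 1" "k > 1"
    and R: "weak_borel_ramsey X E n k"
  shows "smooth X E"
proof (rule ccontr)
  assume not_smooth: "\<not> smooth X E"
  have eq: "equiv (space X) E" using E by (auto simp: countable_borel_equiv_def borel_equiv_def)
  obtain g :: "nat \<Rightarrow> 'a \<Rightarrow> 'a" where g: "\<forall>i. g i \<in> X \<rightarrow>\<^sub>M X" "\<forall>i. \<forall>x\<in>space X. g i (g i x) = x"
    "\<forall>x\<in>space X. E `` {x} = range (\<lambda>i. g i x)" by (rule feldman_moore[OF X E])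
  obtain \<B> where B: "countable \<B>" "\<B> \<subseteq> sets X" "sets X = sigma_sets (space X) \<B>" "coded X"
    by (rule standard_borel_coded[OF X])
  \<comment> \<open>Index 0 is intersection, index 1 is complement, and \<open>Suc (Suc m)\<close>
    is the preimage under \<open>g m\<close>: the closure conditions of \<open>dense_orbit\<close>
    in one family.\<close>
  define h where "h i A B = (case i of 0 \<Rightarrow> A \<inter> B | Suc j \<Rightarrow>
    (case j of 0 \<Rightarrow> space X - A | Suc m \<Rightarrow> g m -` A \<inter> space X))" for i and A B :: "'a set"
  have hs: "h i A B \<in> sets X" if "A \<in> sets X" "B \<in> sets X" for i A B
    using that g(1) unfolding h_def by (auto split: nat.split intro: measurable_sets)
  have "countable (insert {} \<B>)" "insert {} \<B> \<subseteq> sets X" using B(1,2) by simp_all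
  then obtain \<U> \<Q> where U: "insert {} \<B> \<subseteq> \<U>" "coding X \<U> \<Q>" "\<forall>i. \<forall>A\<in>\<U>. \<forall>B\<in>\<U>. h i A B \<in> \<U>"
    by (rule coding_closed_under[OF B(4) _ _ hs])
  have Une: "\<U> \<noteq> {}" using U(1) by blast
  have rng: "range (from_nat_into \<U>) = \<U>" using Une codingD(1)[OF U(2)] by (rule range_from_nat_into)
  have eU: "from_nat_into \<U> m \<in> \<U>" for m using rng by blast
  have es: "from_nat_into \<U> m \<in> sets X" for m using subsetD[OF codingD(2)[OF U(2)] eU] .
  \<comment> \<open>One isolated point in each orbit is enough for a selector. So failure of
    smoothness provides an orbit in which no point at all is isolated.\<close>
  have "\<not> (\<forall>x\<in>space X. \<exists>m. is_singleton (from_nat_into \<U> m \<inter> E `` {x}))"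
  proof
    assume "\<forall>x\<in>space X. \<exists>m. is_singleton (from_nat_into \<U> m \<inter> E `` {x})"
    then have one: "\<exists>m. is_singleton (from_nat_into \<U> m \<inter> E `` {x})" if "x \<in> space X" for x
      using that by blast
    obtain s where s: "s \<in> X \<rightarrow>\<^sub>M X" "\<forall>x\<in>space X. (x, s x) \<in> E" "\<forall>(x, y)\<in>E. s x = s y"
      by (rule borel_selector[OF coding_separating[OF U(2)] eq g(1)[rule_format] g(3)[rule_format] es one])
    then show False using smooth_of_selector[OF X eq s] not_smooth by blast
  qed
  then obtain x0 where x0: "x0 \<in> space X" "\<forall>m. \<not> is_singleton (from_nat_into \<U> m \<inter> E `` {x0})" by blast
  define C where "C = E `` {x0}"
  interpret dense_orbit X \<U> \<B> \<Q> g E C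
  proof
    show "A \<inter> B \<in> \<U>" if "A \<in> \<U>" "B \<in> \<U>" for A B
      using U(3)[rule_format, OF that, of 0] by (simp add: h_def)
    show "space X - A \<in> \<U>" if "A \<in> \<U>" for A
      using U(3)[rule_format, OF that that, of 1] by (simp add: h_def)
    show "g i -` A \<inter> space X \<in> \<U>" if "A \<in> \<U>" for i A
      using U(3)[rule_format, OF that that, of "Suc (Suc i)"] by (simp add: h_def)
    show "\<not> is_singleton (B \<inter> C)" if B: "B \<in> \<U>" for B
    proof -
      obtain m where "B = from_nat_into \<U> m" using rng B by blast
      then show ?thesis using spec[OF x0(2), of m] by (simp add: C_def)
    qed
    show "\<exists>x\<in>space X. C = E `` {x}" using x0(1) C_def by blast
  qed (use U(1,2) B(3) Une eq g in auto)
  \<comment> \<open>The open set in which the section will be comeager is not known yet, so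
    \<open>L\<close> is made to bisect the levels of every candidate.\<close>
  define \<A> where "\<A> = split_levels ` {U \<in> \<U>. U \<inter> C \<noteq> {}}"
  have "countable {U \<in> \<U>. U \<inter> C \<noteq> {}}" by (rule countable_subset[OF _ codingD(1)[OF cod]]) blast
  then have "countable \<A>" by (simp add: \<A>_def)
  moreover have "infinite A" if "A \<in> \<A>" for A using that infinite_split_levels unfolding \<A>_def by blast
  ultimately obtain L where L: "\<forall>A\<in>\<A>. A \<inter> L \<noteq> {} \<and> A - L \<noteq> {}"
    by (rule countable_infinite_nat_sets_bisected)
  define c where "c A = (if split_level A \<in> L then 1 else 2 :: nat)" for A
  have "borel_coloring X E n k c"
    unfolding c_def split_level_def by (rule borel_coloring_of_first_split[OF X Usets[OF e_U] nk(2)])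
  then obtain S where S: "S \<in> sets X" "complete_section X E S" "monochromatic X E n k c S"
    using R unfolding weak_borel_ramsey_def by blast
  then have "\<forall>x\<in>space X. S \<inter> E `` {x} \<noteq> {}" by (simp add: complete_section_def)
  then obtain U x where Ux: "U \<in> \<U>" "U \<inter> C \<noteq> {}" "x \<in> space X" "U \<inter> E `` {x} \<subseteq> S"
    and D: "\<forall>V\<in>\<U>. V \<inter> C \<noteq> {} \<longrightarrow> V \<inter> E `` {x} \<noteq> {}"
    by (rule complete_section_generic[OF S(1)])
  have "split_levels U \<in> \<A>" using Ux by (auto simp: \<A>_def)
  \<comment> \<open>A level in \<open>L\<close> and one outside it are both realised by
    \<open>n\<close>-subsets of the class of \<open>x\<close> inside \<open>U\<close>, hence inside
    the section.\<close>
  then obtain l m where lm: "l \<in> split_levels U" "l \<in> L" "m \<in> split_levels U" "m \<notin> L" using L by blast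
  obtain A1 where A1: "A1 \<subseteq> U \<inter> E `` {x}" "finite A1" "card A1 = n" "split_level A1 = l"
    using subset_with_split_level[OF D Ux(1) lm(1) nk(1)] by blast
  obtain A2 where A2: "A2 \<subseteq> U \<inter> E `` {x}" "finite A2" "card A2 = n" "split_level A2 = m"
    using subset_with_split_level[OF D Ux(1) lm(3) nk(1)] by blast
  obtain a where a: "\<forall>A\<in>nsets S n. A \<subseteq> E `` {x} \<longrightarrow> c A = a"
    using S(3) Ux(3) unfolding monochromatic_def by blast
  have "A1 \<in> nsets S n" "A2 \<in> nsets S n" using A1 A2 Ux(4) by (auto simp: nsets_def)
  then have "c A1 = c A2" using a A1(1) A2(1) by (metis le_infE)
  then show False using A1(4) A2(4) lm(2,4) by (simp add: c_def)
qed

section \<open>Smooth equivalence relations\<close>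

lemma pred_eq_nat:
  fixes f h :: "'x \<Rightarrow> nat"
  assumes f: "f \<in> M \<rightarrow>\<^sub>M count_space UNIV" and h: "h \<in> M \<rightarrow>\<^sub>M count_space UNIV"
  shows "Measurable.pred M (\<lambda>\<omega>. f \<omega> = h \<omega>)"
  by (rule measurable_compose_countable[where f = "\<lambda>v \<omega>. f \<omega> = v", OF pred_eq_const1[OF f] h]) simp

text \<open>The prehomogeneous sequence argument, uniform in the parameter: take the least element
  \<open>x j\<close> of \<open>J j\<close> and thin out the rest to \<open>J (Suc j)\<close>, so
  that the color of a set starting with \<open>x j\<close> and continuing in
  \<open>J (Suc j)\<close> is a number \<open>b j\<close>. The points with the least infinitely
  recurring \<open>b j\<close> form the homogeneous set.\<close>

lemma measurable_ramsey:
  fixes M :: "'x measure" and I :: "'x \<Rightarrow> nat set" and c :: "'x \<Rightarrow> nat set \<Rightarrow> nat"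
  assumes "\<forall>i. Measurable.pred M (\<lambda>\<omega>. i \<in> I \<omega>)" "\<forall>\<omega>\<in>space M. infinite (I \<omega>)"
    and "\<forall>A. finite A \<longrightarrow> card A = n \<longrightarrow> (\<lambda>\<omega>. c \<omega> A) \<in> M \<rightarrow>\<^sub>M count_space UNIV"
    and "\<forall>\<omega>\<in>space M. \<forall>A\<in>nsets (I \<omega>) n. c \<omega> A \<in> {1..k}"
  shows "\<exists>H a. (\<forall>i. Measurable.pred M (\<lambda>\<omega>. i \<in> H \<omega>)) \<and> a \<in> M \<rightarrow>\<^sub>M count_space UNIV \<and>
    (\<forall>\<omega>\<in>space M. H \<omega> \<subseteq> I \<omega> \<and> infinite (H \<omega>) \<and> a \<omega> \<in> {1..k} \<and> (\<forall>A\<in>nsets (H \<omega>) n. c \<omega> A = a \<omega>))"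
  using assms
proof (induction n arbitrary: I c)
  case 0
  have *: "nsets S 0 = {{}}" for S :: "nat set" by (rule nsets_zero)
  show ?case
    by (rule exI[of _ I], rule exI[of _ "\<lambda>\<omega>. c \<omega> {}"]) (use 0 in \<open>simp add: *\<close>)
next
  case (Suc n)
  define good where "good J \<longleftrightarrow> (\<forall>i. Measurable.pred M (\<lambda>\<omega>. i \<in> J \<omega>)) \<and>
    (\<forall>\<omega>\<in>space M. infinite (J \<omega>) \<and> J \<omega> \<subseteq> I \<omega>)" for J :: "'x \<Rightarrow> nat set"
  define least where "least J \<omega> = (LEAST i. i \<in> J \<omega>)" for J :: "'x \<Rightarrow> nat set" and \<omega>
  have least_in: "least J \<omega> \<in> J \<omega>" if "infinite (J \<omega>)" for J \<omega>
    unfolding least_def by (rule LeastI_ex) (use that in \<open>metis ex_in_conv finite.emptyI\<close>)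
  have least_le: "least J \<omega> \<le> i" if "i \<in> J \<omega>" for J \<omega> i
    unfolding least_def using that by (rule Least_le)
  define next_col where "next_col J J' b \<longleftrightarrow> b \<in> M \<rightarrow>\<^sub>M count_space UNIV \<and>
    (\<forall>\<omega>\<in>space M. J' \<omega> \<subseteq> J \<omega> - {least J \<omega>} \<and> b \<omega> \<in> {1..k} \<and>
      (\<forall>A\<in>nsets (J' \<omega>) n. c \<omega> (insert (least J \<omega>) A) = b \<omega>))" for J J' and b :: "'x \<Rightarrow> nat"
  have least_meas: "least J \<in> M \<rightarrow>\<^sub>M count_space UNIV" if "good J" for J
  proof -
    have [measurable]: "Measurable.pred M (\<lambda>\<omega>. i \<in> J \<omega>)" for i using that by (simp add: good_def)
    show ?thesis unfolding least_def by measurable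
  qed
  have step: "\<exists>J' b. good J' \<and> next_col J J' b" if J: "good J" for J
  proof -
    note [measurable] = least_meas[OF J]
    have [measurable]: "Measurable.pred M (\<lambda>\<omega>. i \<in> J \<omega>)" for i using J by (simp add: good_def)
    define I' where "I' \<omega> = J \<omega> - {least J \<omega>}" for \<omega>
    \<comment> \<open>The default covers the case in which inserting the least element does not
      enlarge \<open>A\<close>, where nothing is assumed about the measurability of
      \<open>c\<close>. It never arises for subsets of \<open>I' \<omega>\<close>.\<close>
    define c' where "c' \<omega> A = (if least J \<omega> \<in> A then 1 else c \<omega> (insert (least J \<omega>) A))" for \<omega> A
    \<comment> \<open>The induction hypothesis treats all parameters at once, so each stage makes
      one choice of measurable functions instead of a choice at every parameter.\<close>
    have "\<exists>H a. (\<forall>i. Measurable.pred M (\<lambda>\<omega>. i \<in> H \<omega>)) \<and> a \<in> M \<rightarrow>\<^sub>M count_space UNIV \<and>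
      (\<forall>\<omega>\<in>space M. H \<omega> \<subseteq> I' \<omega> \<and> infinite (H \<omega>) \<and> a \<omega> \<in> {1..k} \<and> (\<forall>A\<in>nsets (H \<omega>) n. c' \<omega> A = a \<omega>))"
    proof (rule Suc.IH)
      show "\<forall>i. Measurable.pred M (\<lambda>\<omega>. i \<in> I' \<omega>)"
      proof
        fix i
        have "Measurable.pred M (\<lambda>\<omega>. i \<in> J \<omega> \<and> i \<noteq> least J \<omega>)" by measurable
        then show "Measurable.pred M (\<lambda>\<omega>. i \<in> I' \<omega>)" by (simp add: I'_def)
      qed
      show "\<forall>\<omega>\<in>space M. infinite (I' \<omega>)" using J by (simp add: I'_def good_def)
      show "\<forall>A. finite A \<longrightarrow> card A = n \<longrightarrow> (\<lambda>\<omega>. c' \<omega> A) \<in> M \<rightarrow>\<^sub>M count_space UNIV"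
      proof (intro allI impI)
        fix A :: "nat set" assume A: "finite A" "card A = n"
        have m: "(\<lambda>\<omega>. if p \<in> A then 1 else c \<omega> (insert p A)) \<in> M \<rightarrow>\<^sub>M count_space UNIV" for p
          using Suc.prems(3)[rule_format, of "insert p A"] A by (cases "p \<in> A") simp_all
        show "(\<lambda>\<omega>. c' \<omega> A) \<in> M \<rightarrow>\<^sub>M count_space UNIV"
          unfolding c'_def by (rule measurable_compose_countable[OF m]) measurable
      qed
      show "\<forall>\<omega>\<in>space M. \<forall>A\<in>nsets (I' \<omega>) n. c' \<omega> A \<in> {1..k}"
      proof (intro ballI)
        fix \<omega> A assume w: "\<omega> \<in> space M" and A: "A \<in> nsets (I' \<omega>) n"
        have "infinite (J \<omega>)" "J \<omega> \<subseteq> I \<omega>" using J w by (simp_all add: good_def)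
        then have "insert (least J \<omega>) A \<in> nsets (I \<omega>) (Suc n)" "least J \<omega> \<notin> A"
          using A least_in[of J \<omega>] by (auto simp: nsets_def I'_def card_insert_if)
        then show "c' \<omega> A \<in> {1..k}" using Suc.prems(4) w unfolding c'_def by auto
      qed
    qed
    then obtain H a where H: "\<forall>i. Measurable.pred M (\<lambda>\<omega>. i \<in> H \<omega>)" "a \<in> M \<rightarrow>\<^sub>M count_space UNIV"
      "\<forall>\<omega>\<in>space M. H \<omega> \<subseteq> I' \<omega> \<and> infinite (H \<omega>) \<and> a \<omega> \<in> {1..k} \<and> (\<forall>A\<in>nsets (H \<omega>) n. c' \<omega> A = a \<omega>)"
      by (elim exE conjE)
    have "c \<omega> (insert (least J \<omega>) A) = a \<omega>" if "\<omega> \<in> space M" "A \<in> nsets (H \<omega>) n" for \<omega> A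
    proof -
      have "least J \<omega> \<notin> A" using H(3) that by (auto simp: nsets_def I'_def)
      moreover have "c' \<omega> A = a \<omega>" using H(3) that by blast
      ultimately show ?thesis by (simp add: c'_def)
    qed
    then have "next_col J H a" using H(2,3) unfolding next_col_def I'_def by simp
    moreover have "good H"
      unfolding good_def
    proof (intro conjI ballI)
      fix \<omega> assume "\<omega> \<in> space M"
      then have "H \<omega> \<subseteq> I' \<omega>" "infinite (H \<omega>)" "J \<omega> \<subseteq> I \<omega>" using H(3) J by (simp_all add: good_def)
      then show "infinite (H \<omega>)" "H \<omega> \<subseteq> I \<omega>" by (auto simp: I'_def)
    qed (rule H(1))
    ultimately show ?thesis by blast
  qed
  have "\<exists>t. \<forall>j. good (fst (t j)) \<and> next_col (fst (t j)) (fst (t (Suc j))) (snd (t (Suc j)))"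
  proof (rule dependent_nat_choice)
    show "\<exists>x :: ('x \<Rightarrow> nat set) \<times> ('x \<Rightarrow> nat). good (fst x)" using Suc.prems(1,2) by (intro exI[of _ "(I, \<lambda>_. 0)"]) (simp add: good_def)
    fix x :: "('x \<Rightarrow> nat set) \<times> ('x \<Rightarrow> nat)" and j :: nat
    assume "good (fst x)"
    then obtain J' b where "good J'" "next_col (fst x) J' b" using step by blast
    then show "\<exists>y. good (fst y) \<and> next_col (fst x) (fst y) (snd y)" by (intro exI[of _ "(J', b)"]) simp
  qed
  then obtain t where t: "\<forall>j. good (fst (t j)) \<and> next_col (fst (t j)) (fst (t (Suc j))) (snd (t (Suc j)))" ..
  define J where "J j = fst (t j)" for j
  \<comment> \<open>The color attached to \<open>x j\<close> is found together with
    \<open>J (Suc j)\<close>, hence the shift.\<close>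
  define b where "b j = snd (t (Suc j))" for j
  define x where "x j = least (J j)" for j
  have J: "good (J j)" and nx: "next_col (J j) (J (Suc j)) (b j)" for j
    using t by (simp_all add: J_def b_def)
  have [measurable]: "x j \<in> M \<rightarrow>\<^sub>M count_space UNIV" for j unfolding x_def by (rule least_meas[OF J])
  have [measurable]: "b j \<in> M \<rightarrow>\<^sub>M count_space UNIV" for j using nx[of j] by (simp add: next_col_def)
  \<comment> \<open>Taking the least color that recurs infinitely often keeps \<open>a\<close>
    measurable; one exists by the pigeonhole principle.\<close>
  define a where "a \<omega> = (LEAST v. \<forall>N. \<exists>j\<ge>N. b j \<omega> = v)" for \<omega>
  have [measurable]: "a \<in> M \<rightarrow>\<^sub>M count_space UNIV" unfolding a_def by measurable
  define H where "H \<omega> = {i. \<exists>j. x j \<omega> = i \<and> b j \<omega> = a \<omega>}" for \<omega>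
  have Hm: "Measurable.pred M (\<lambda>\<omega>. i \<in> H \<omega>)" for i
  proof -
    have "Measurable.pred M (\<lambda>\<omega>. x j \<omega> = i)" "Measurable.pred M (\<lambda>\<omega>. b j \<omega> = a \<omega>)" for j
      by (rule pred_eq_nat; measurable)+
    then show ?thesis
      unfolding H_def mem_Collect_eq by (intro pred_intros_countable pred_intros_logic)
  qed
  have main: "H \<omega> \<subseteq> I \<omega> \<and> infinite (H \<omega>) \<and> a \<omega> \<in> {1..k} \<and> (\<forall>A\<in>nsets (H \<omega>) (Suc n). c \<omega> A = a \<omega>)"
    if w: "\<omega> \<in> space M" for \<omega>
  proof -
    have Jw: "infinite (J j \<omega>)" "J j \<omega> \<subseteq> I \<omega>" for j using J[of j] w by (simp_all add: good_def)
    have nxw: "J (Suc j) \<omega> \<subseteq> J j \<omega> - {x j \<omega>}" "b j \<omega> \<in> {1..k}"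
      "A \<in> nsets (J (Suc j) \<omega>) n \<Longrightarrow> c \<omega> (insert (x j \<omega>) A) = b j \<omega>" for j A
      using nx[of j] w by (simp_all add: next_col_def x_def)
    have xJ: "x j \<omega> \<in> J j \<omega>" for j unfolding x_def by (rule least_in[of "J j" \<omega>, OF Jw(1)])
    have "J (Suc j) \<omega> \<subseteq> J j \<omega>" for j using nxw(1)[of j] by blast
    then have Jmono: "J j \<omega> \<subseteq> J i \<omega>" if "i \<le> j" for i j
      using lift_Suc_antimono_le[of "\<lambda>j. J j \<omega>", OF _ that] by blast
    have "x j \<omega> < x (Suc j) \<omega>" for j
    proof -
      have "x (Suc j) \<omega> \<in> J j \<omega> - {x j \<omega>}" using xJ[of "Suc j"] nxw(1)[of j] by blast
      then show ?thesis using least_le[of "x (Suc j) \<omega>" "J j" \<omega>] by (simp add: x_def order.not_eq_order_implies_strict)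
    qed
    then have sm: "strict_mono (\<lambda>j. x j \<omega>)" by (simp add: strict_mono_Suc_iff)
    have "\<exists>v. infinite {j. b j \<omega> = v}"
    proof -
      have "finite (range (\<lambda>j. b j \<omega>))" by (rule finite_subset[of _ "{1..k}"]) (use nxw(2) in auto)
      then obtain j0 where "\<not> finite {j \<in> UNIV. b j \<omega> = b j0 \<omega>}"
        using pigeonhole_infinite[of UNIV "\<lambda>j. b j \<omega>"] by auto
      then show ?thesis by auto
    qed
    then have "\<exists>v. \<forall>N. \<exists>j\<ge>N. b j \<omega> = v" by (auto simp: infinite_nat_iff_unbounded_le)
    then have aN: "\<forall>N. \<exists>j\<ge>N. b j \<omega> = a \<omega>" unfolding a_def by (rule LeastI_ex)
    then have inf: "infinite {j. b j \<omega> = a \<omega>}" by (simp add: infinite_nat_iff_unbounded_le)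
    have Him: "H \<omega> = (\<lambda>j. x j \<omega>) ` {j. b j \<omega> = a \<omega>}" by (auto simp: H_def)
    have "infinite (H \<omega>)"
      unfolding Him using inf finite_imageD[OF _ inj_on_subset[OF strict_mono_imp_inj_on[OF sm]]] by blast
    moreover have "H \<omega> \<subseteq> I \<omega>" unfolding Him using xJ Jw(2) by blast
    moreover have "a \<omega> \<in> {1..k}"
    proof -
      obtain j where "b j \<omega> = a \<omega>" using aN by blast
      then show ?thesis using nxw(2)[of j] by simp
    qed
    moreover have "c \<omega> A = a \<omega>" if "A \<in> nsets (H \<omega>) (Suc n)" for A
    proof -
      have A: "A \<subseteq> H \<omega>" "finite A" "card A = Suc n" using that by (simp_all add: nsets_def)
      have "A \<noteq> {}" using A(3) by auto
      then have Min: "Min A \<in> A" using A(2) by (rule Min_in[rotated])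
      then obtain j where j: "Min A = x j \<omega>" "b j \<omega> = a \<omega>" using A(1) unfolding Him by blast
      \<comment> \<open>The sequence \<open>x\<close> is strictly increasing, so the elements of
        \<open>A\<close> above its minimum come from later stages, which all lie inside
        \<open>J (Suc j)\<close>.\<close>
      have "A - {x j \<omega>} \<subseteq> J (Suc j) \<omega>"
      proof
        fix i assume i: "i \<in> A - {x j \<omega>}"
        then obtain l where l: "i = x l \<omega>" using A(1) unfolding Him by blast
        have "x j \<omega> < x l \<omega>" using i l j(1) Min_le[OF A(2), of i] by auto
        then have "Suc j \<le> l" using strict_mono_less[OF sm] by auto
        then show "i \<in> J (Suc j) \<omega>" using Jmono[of "Suc j" l] xJ[of l] l by blast
      qed
      moreover have "card (A - {x j \<omega>}) = n" using A Min j(1) by simp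
      ultimately have "A - {x j \<omega>} \<in> nsets (J (Suc j) \<omega>) n" using A(2) by (simp add: nsets_def)
      then have "c \<omega> (insert (x j \<omega>) (A - {x j \<omega>})) = b j \<omega>" by (rule nxw(3))
      then have "c \<omega> (insert (x j \<omega>) (A - {x j \<omega>})) = a \<omega>" unfolding j(2) .
      moreover have "insert (x j \<omega>) (A - {x j \<omega>}) = A" using Min j(1) by auto
      ultimately show ?thesis by simp
    qed
    ultimately show ?thesis by blast
  qed
  show ?case
    by (rule exI[of _ H], rule exI[of _ a]) (use Hm main in simp)
qed

section \<open>Pulling a coloring back to index sets, and the strong Ramsey property\<close>

lemma pred_mem_sets: "T \<in> sets M \<Longrightarrow> Measurable.pred M (\<lambda>x. x \<in> T)"
  using sets.Int_space_eq1[of T M] by (simp add: pred_def Collect_conj_eq)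

lemma borel_coloring_tuple_set:
  assumes X: "standard_borel X" and c: "borel_coloring X E n k c"
  obtains T where "T \<in> sets (\<Pi>\<^sub>M i\<in>{..<n}. X)"
    "\<forall>A\<in>class_subsets X E n. c A = a \<longleftrightarrow> (\<lambda>i\<in>{..<n}. increasing_list X A ! i) \<in> T"
proof -
  have c': "c \<in> class_subsets_space X E n \<rightarrow>\<^sub>M count_space {1..k}" using c by (simp add: borel_coloring_def)
  have sp: "space (class_subsets_space X E n) = class_subsets X E n" by (simp add: class_subsets_space_def)
  \<comment> \<open>The number \<open>a\<close> is arbitrary, while only subsets of
    \<open>{1..k}\<close> are measurable in the target.\<close>
  have "c -` ({a} \<inter> {1..k}) \<inter> space (class_subsets_space X E n) \<in> sets (class_subsets_space X E n)"
    by (rule measurable_sets[OF c']) simp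
  then obtain T where T: "T \<in> sets (\<Pi>\<^sub>M i\<in>{..<n}. X)" "c -` ({a} \<inter> {1..k}) \<inter> class_subsets X E n =
      (\<lambda>A. \<lambda>i\<in>{..<n}. increasing_list X A ! i) -` T \<inter> class_subsets X E n"
    unfolding sp unfolding class_subsets_space_def sets_vimage_algebra2[OF increasing_tuple_space[OF X]] by blast
  have "c A \<in> {1..k}" if "A \<in> class_subsets X E n" for A
    using measurable_space[OF c'] that by (simp add: sp)
  then have "\<forall>A\<in>class_subsets X E n. c A = a \<longleftrightarrow> A \<in> c -` ({a} \<inter> {1..k}) \<inter> class_subsets X E n" by auto
  then have "\<forall>A\<in>class_subsets X E n. c A = a \<longleftrightarrow> (\<lambda>i\<in>{..<n}. increasing_list X A ! i) \<in> T"
    unfolding T(2) by simp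
  then show thesis by (rule that[OF T(1)])
qed

text \<open>The index lists \<open>ps\<close> enumerate the possible increasing orders of the \<open>n\<close>-set.\<close>

lemma pred_coloring_of_index_set:
  fixes f :: "nat \<Rightarrow> 'a \<Rightarrow> 'a"
  assumes X: "standard_borel X" and c: "borel_coloring X E n k c"
    and f: "\<And>i. f i \<in> X \<rightarrow>\<^sub>M X" and F: "F \<in> sets X" and A: "finite A" "card A = n"
    and inj: "\<And>x. x \<in> F \<Longrightarrow> inj_on (\<lambda>i. f i x) A"
    and cl: "\<And>x. x \<in> F \<Longrightarrow> (\<lambda>i. f i x) ` A \<in> class_subsets X E n"
  shows "{x \<in> F. c ((\<lambda>i. f i x) ` A) = a} \<in> sets X"
proof -
  obtain T where T: "T \<in> sets (\<Pi>\<^sub>M i\<in>{..<n}. X)"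
    "\<forall>A\<in>class_subsets X E n. c A = a \<longleftrightarrow> (\<lambda>i\<in>{..<n}. increasing_list X A ! i) \<in> T"
    by (rule borel_coloring_tuple_set[OF X c])
  obtain \<V> where V: "separating X \<V>" by (rule standard_borel_separatingE[OF X])
  define lt where "lt = (\<lambda>x y. (x, y) \<in> the_order X \<and> x \<noteq> y)"
  have Rm: "the_order X \<in> sets (X \<Otimes>\<^sub>M X)"
    using borel_linear_order_the_order[OF X] by (simp add: borel_linear_order_def)
  note [measurable] = f pred_eq_of_separating[OF V f f]
  have [measurable]: "Measurable.pred X (\<lambda>x. (f i x, f j x) \<in> the_order X)" for i j
    by (rule measurable_compose[OF measurable_Pair[OF f f] pred_mem_sets[OF Rm]])
  \<comment> \<open>The first conjunct says that \<open>ps\<close> lists the indices in the order of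
    their values at \<open>x\<close>; only then is the tuple tested against \<open>T\<close> the
    increasing one.\<close>
  define Pr where "Pr ps x \<longleftrightarrow> (\<forall>i\<in>{..<n}. \<forall>j\<in>{..<n}. i < j \<longrightarrow> lt (f (ps ! i) x) (f (ps ! j) x)) \<and>
    (\<lambda>i\<in>{..<n}. f (ps ! i) x) \<in> T" for ps x
  have "(\<lambda>x. \<lambda>i\<in>{..<n}. f (ps ! i) x) \<in> X \<rightarrow>\<^sub>M (\<Pi>\<^sub>M i\<in>{..<n}. X)" for ps
    by (rule measurable_restrict) (rule f)
  then have [measurable]: "Measurable.pred X (\<lambda>x. (\<lambda>i\<in>{..<n}. f (ps ! i) x) \<in> T)" for ps
    using pred_mem_sets[OF T(1)] by (rule measurable_compose)
  have Pr [measurable]: "Measurable.pred X (Pr ps)" for ps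
    unfolding Pr_def lt_def by measurable
  define PS where "PS = {ps. set ps = A \<and> length ps = n}"
  have "{x \<in> F. c ((\<lambda>i. f i x) ` A) = a} = {x \<in> space X. x \<in> F \<and> (\<exists>ps\<in>PS. Pr ps x)}"
  proof -
    have "c ((\<lambda>i. f i x) ` A) = a \<longleftrightarrow> (\<exists>ps\<in>PS. Pr ps x)" if x: "x \<in> F" for x
    proof -
      define B where "B = (\<lambda>i. f i x) ` A"
      have B: "B \<in> class_subsets X E n" unfolding B_def by (rule cl[OF x])
      note Bp = class_subsetsD[OF B]
      have ex1: "\<exists>!xs. set xs = B \<and> sorted_wrt lt xs"
        using increasing_list_ex1[OF X Bp(1,3)] unfolding lt_def .
      have il: "set (increasing_list X B) = B \<and> sorted_wrt lt (increasing_list X B)"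
        unfolding increasing_list_def lt_def[symmetric] by (rule theI'[OF ex1])
      have len: "length (increasing_list X B) = n" using increasing_list(2)[OF X Bp(1,3)] Bp(2) by simp
      have key: "Pr ps x \<longleftrightarrow> (\<lambda>i\<in>{..<n}. increasing_list X B ! i) \<in> T"
        if eq: "map (\<lambda>i. f i x) ps = increasing_list X B" for ps
      proof -
        have l: "length ps = n" using len eq by (metis length_map)
        have nth: "increasing_list X B ! i = f (ps ! i) x" if "i < n" for i
          unfolding eq[symmetric] using that l by simp
        have "lt (f (ps ! i) x) (f (ps ! j) x)" if "i < j" "j < n" for i j
          using sorted_wrt_nth_less[OF conjunct2[OF il], of i j] that len nth[of i] nth[of j] by simp
        moreover have "(\<lambda>i\<in>{..<n}. increasing_list X B ! i) = (\<lambda>i\<in>{..<n}. f (ps ! i) x)"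
          by (rule restrict_ext) (simp add: nth)
        ultimately show ?thesis by (simp add: Pr_def)
      qed
      show ?thesis
      proof
        assume "c ((\<lambda>i. f i x) ` A) = a"
        then have inT: "(\<lambda>i\<in>{..<n}. increasing_list X B ! i) \<in> T" using T(2) B by (simp add: B_def)
        define ps where "ps = map (inv_into A (\<lambda>i. f i x)) (increasing_list X B)"
        have "map (\<lambda>i. f i x) ps = increasing_list X B"
          unfolding ps_def map_map 
          by (intro map_idI) (use il f_inv_into_f[of _ "\<lambda>i. f i x" A] in \<open>simp add: B_def\<close>)
        moreover have "set ps = A"
          unfolding ps_def using il inv_into_image_cancel[OF inj[OF x] subset_refl] by (simp add: B_def)
        moreover have "length ps = n" by (simp add: ps_def len)
        ultimately show "\<exists>ps\<in>PS. Pr ps x" using key inT by (intro bexI[of _ ps]) (simp_all add: PS_def)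
      next
        assume "\<exists>ps\<in>PS. Pr ps x"
        then obtain ps where ps: "set ps = A" "length ps = n" "Pr ps x" by (auto simp: PS_def)
        have "sorted_wrt lt (map (\<lambda>i. f i x) ps)"
          using ps(2,3) by (simp add: sorted_wrt_iff_nth_less Pr_def)
        moreover have "set (map (\<lambda>i. f i x) ps) = B" using ps(1) by (simp add: B_def)
        ultimately have "map (\<lambda>i. f i x) ps = increasing_list X B" using ex1 il by blast
        then have "(\<lambda>i\<in>{..<n}. increasing_list X B ! i) \<in> T" using key ps(3) by simp
        then show "c ((\<lambda>i. f i x) ` A) = a" using T(2) B by (simp add: B_def)
      qed
    qed
    then show ?thesis using sets.sets_into_space[OF F] by auto
  qed
  also have "\<dots> \<in> sets X"
  proof (intro sets.sets_Collect_conj sets.sets_Collect_countable_Ex')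
    show "{x \<in> space X. x \<in> F} \<in> sets X" using pred_mem_sets[OF F] by (simp add: pred_def)
    show "{x \<in> space X. Pr ps x} \<in> sets X" for ps using Pr by (simp add: pred_def)
  qed simp
  finally show ?thesis .
qed

text \<open>The selector turns the Feldman-Moore maps into an enumeration \<open>f\<close> of each
  class that depends on the class only. Once repetitions are dropped, \<open>c\<close> becomes a
  coloring of sets of naturals with a Borel parameter, and \<open>measurable_ramsey\<close> supplies
  the indices of a homogeneous set.\<close>

theorem borel_ramsey_of_smooth:
  fixes X :: "'a measure"
  assumes X: "standard_borel X" and E: "countable_borel_equiv X E" and ap: "aperiodic X E"
    and sm: "smooth X E"
  shows "borel_ramsey X E n k"
  unfolding borel_ramsey_def
proof (intro allI impI)
  fix c assume c: "borel_coloring X E n k c"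
  have eq: "equiv (space X) E" using E by (auto simp: countable_borel_equiv_def borel_equiv_def)
  have EX: "E \<subseteq> space X \<times> space X" using eq by (auto simp: equiv_def refl_on_def)
  obtain g :: "nat \<Rightarrow> 'a \<Rightarrow> 'a" where g: "\<forall>i. g i \<in> X \<rightarrow>\<^sub>M X" "\<forall>i. \<forall>x\<in>space X. g i (g i x) = x"
    "\<forall>x\<in>space X. E `` {x} = range (\<lambda>i. g i x)" by (rule feldman_moore[OF X E])
  obtain s where s: "s \<in> X \<rightarrow>\<^sub>M X" "\<forall>x\<in>space X. (x, s x) \<in> E" "\<forall>(x, y)\<in>E. s x = s y"
    by (rule smooth_selector[OF X E sm])
  obtain \<V> where V: "separating X \<V>" by (rule standard_borel_separatingE[OF X])
  have sX: "s x \<in> space X" if "x \<in> space X" for x using measurable_space[OF s(1) that] .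
  have ss: "s (s x) = s x" if "x \<in> space X" for x using s(2,3) that by force
  have cls_s: "E `` {s x} = E `` {x}" if "x \<in> space X" for x
    using equiv_class_eq[OF eq, of x "s x"] s(2) that by simp
  define f where "f i x = g i (s x)" for i x
  have f: "f i \<in> X \<rightarrow>\<^sub>M X" for i
    unfolding f_def using measurable_compose[OF s(1) g(1)[rule_format, of i]] .
  have fs: "f i (s x) = f i x" if "x \<in> space X" for i x by (simp add: f_def ss[OF that])
  have f_cls: "E `` {x} = range (\<lambda>i. f i x)" if x: "x \<in> space X" for x
    unfolding f_def using g(3)[rule_format, OF sX[OF x]] cls_s[OF x] by simp
  note [measurable] = f s(1) pred_eq_of_separating[OF V f f]
  \<comment> \<open>Indices at which a value first appears: this makes the enumeration injective,
    and aperiodicity makes the index set infinite.\<close>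
  define I where "I x = {i. \<forall>j<i. f j x \<noteq> f i x}" for x
  have I_meas: "Measurable.pred X (\<lambda>x. i \<in> I x)" for i
    unfolding I_def mem_Collect_eq by measurable
  have I_inj: "inj_on (\<lambda>i. f i x) (I x)" for x
  proof (rule inj_onI)
    fix i j assume "i \<in> I x" "j \<in> I x" "f i x = f j x"
    then show "i = j" by (cases i j rule: linorder_cases) (auto simp: I_def)
  qed
  have I_img: "(\<lambda>i. f i x) ` I x = E `` {x}" if x: "x \<in> space X" for x
  proof
    show "E `` {x} \<subseteq> (\<lambda>i. f i x) ` I x"
    proof
      fix y assume "y \<in> E `` {x}"
      then have ex: "\<exists>i. f i x = y" unfolding f_cls[OF x] by blast
      define i where "i = (LEAST i. f i x = y)"
      have i: "f i x = y" unfolding i_def by (rule LeastI_ex[OF ex])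
      have "f j x \<noteq> y" if "j < i" for j
        using not_less_Least[of j "\<lambda>i. f i x = y"] that unfolding i_def by blast
      then have "i \<in> I x" using i by (simp add: I_def)
      then show "y \<in> (\<lambda>i. f i x) ` I x" using i by blast
    qed
  qed (use f_cls[OF x] in blast)
  have I_inf: "infinite (I x)" if x: "x \<in> space X" for x
    using ap x I_img[OF x] unfolding aperiodic_def by (metis finite_imageI)
  have img_cl: "(\<lambda>i. f i x) ` A \<in> class_subsets X E n" if x: "x \<in> space X" and A: "A \<in> nsets (I x) n" for x A
  proof -
    have "(\<lambda>i. f i x) ` A \<subseteq> E `` {x}" using I_img[OF x] A by (auto simp: nsets_def)
    moreover have "card ((\<lambda>i. f i x) ` A) = n"
      using A card_image[OF inj_on_subset[OF I_inj]] by (auto simp: nsets_def)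
    moreover have "E `` {x} \<subseteq> space X" using EX by auto
    ultimately show ?thesis using A x by (auto simp: class_subsets_def nsets_def)
  qed
  \<comment> \<open>Outside \<open>I x\<close> indices may repeat values and the image may have
    fewer than \<open>n\<close> points, so \<open>d\<close> takes a default there.\<close>
  define d where "d x A = (if A \<subseteq> I x then c ((\<lambda>i. f i x) ` A) else 1)" for x A
  have c_col: "c A \<in> {1..k}" if "A \<in> class_subsets X E n" for A
    using measurable_space[OF c[unfolded borel_coloring_def], of A] that by (simp add: class_subsets_space_def)
  have d_meas: "(\<lambda>x. d x A) \<in> X \<rightarrow>\<^sub>M count_space UNIV" if A: "finite A" "card A = n" for A
  proof -
    define F where "F = {x \<in> space X. \<forall>i\<in>A. i \<in> I x}"
    have F: "F \<in> sets X"
      unfolding F_def using I_meas A(1) countable_finite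
      by (intro sets.sets_Collect_countable_All') (auto simp: pred_def)
    have F_iff: "x \<in> F \<longleftrightarrow> x \<in> space X \<and> A \<subseteq> I x" for x by (auto simp: F_def)
    have FA: "A \<in> nsets (I x) n" "x \<in> space X" if "x \<in> F" for x using that A by (auto simp: F_def nsets_def)
    have "(\<lambda>x. d x A) -` {a} \<inter> space X \<in> sets X" for a
    proof -
      have "{x \<in> F. c ((\<lambda>i. f i x) ` A) = a} \<in> sets X"
      proof (rule pred_coloring_of_index_set[OF X c f F A])
        show "inj_on (\<lambda>i. f i x) A" if "x \<in> F" for x
          using FA[OF that] by (intro inj_on_subset[OF I_inj]) (simp add: nsets_def)
        show "(\<lambda>i. f i x) ` A \<in> class_subsets X E n" if "x \<in> F" for x
          using img_cl FA[OF that] by blast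
      qed
      moreover have "(\<lambda>x. d x A) -` {a} \<inter> space X =
          {x \<in> F. c ((\<lambda>i. f i x) ` A) = a} \<union> (if a = 1 then space X - F else {})"
        by (auto simp: d_def F_iff split: if_splits)
      ultimately show ?thesis using F by auto
    qed
    then show ?thesis by (intro measurable_count_space_eq2_countable[THEN iffD2]) simp_all
  qed
  have d_col: "d x A \<in> {1..k}" if "x \<in> space X" "A \<in> nsets (I x) n" for x A
    using c_col[OF img_cl[OF that]] that(2) by (simp add: d_def nsets_def)
  obtain H a where Ha: "\<forall>i. Measurable.pred X (\<lambda>x. i \<in> H x)"
    "\<forall>x\<in>space X. H x \<subseteq> I x \<and> infinite (H x) \<and> a x \<in> {1..k} \<and> (\<forall>A\<in>nsets (H x) n. d x A = a x)"
  proof -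
    have "\<forall>i. Measurable.pred X (\<lambda>x. i \<in> I x)" "\<forall>x\<in>space X. infinite (I x)"
      "\<forall>A. finite A \<longrightarrow> card A = n \<longrightarrow> (\<lambda>x. d x A) \<in> X \<rightarrow>\<^sub>M count_space UNIV"
      "\<forall>x\<in>space X. \<forall>A\<in>nsets (I x) n. d x A \<in> {1..k}"
      using I_meas I_inf d_meas d_col by simp_all
    note ramsey = measurable_ramsey[OF this]
    show ?thesis using ramsey by (elim exE conjE) (rule that)
  qed
  have H: "H x \<subseteq> I x" "infinite (H x)" "a x \<in> {1..k}" "\<And>A. A \<in> nsets (H x) n \<Longrightarrow> d x A = a x"
    if "x \<in> space X" for x using Ha(2) that by blast+
  \<comment> \<open>\<open>H\<close> is only known to be measurable and may differ between
    equivalent points; evaluating it at \<open>s y\<close> makes it constant on classes. Testing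
    \<open>f i y = y\<close> shows that \<open>Y\<close> is Borel without taking an image.\<close>
  define Y where "Y = {y \<in> space X. \<exists>i. i \<in> H (s y) \<and> f i y = y}"
  have Y_cls: "Y \<inter> E `` {x} = (\<lambda>i. f i x) ` H (s x)" if x: "x \<in> space X" for x
  proof (intro equalityI subsetI)
    fix y assume y: "y \<in> Y \<inter> E `` {x}"
    then have "s x = s y" using s(3) by auto
    moreover obtain i where "i \<in> H (s y)" "f i y = y" using y by (auto simp: Y_def)
    ultimately have "i \<in> H (s x)" "y = f i x" by (simp_all add: f_def)
    then show "y \<in> (\<lambda>i. f i x) ` H (s x)" by blast
  next
    fix y assume "y \<in> (\<lambda>i. f i x) ` H (s x)"
    then obtain i where i: "i \<in> H (s x)" "y = f i x" by blast
    have xy: "(x, y) \<in> E" using f_cls[OF x] i(2) by blast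
    have "s x = s y" using s(3) xy by auto
    moreover have "y \<in> space X" using xy EX by blast
    ultimately have "y \<in> Y" using i unfolding Y_def f_def by auto
    then show "y \<in> Y \<inter> E `` {x}" using xy by simp
  qed
  have inj_s: "inj_on (\<lambda>i. f i x) (H (s x))" if x: "x \<in> space X" for x
    using inj_on_subset[OF I_inj[of "s x"] H(1)[OF sX[OF x]]] by (simp add: fs[OF x])
  show "\<exists>Y\<in>sets X. infinite_complete_section X E Y \<and> monochromatic X E n k c Y"
  proof (intro bexI[of _ Y] conjI)
    have "id \<in> X \<rightarrow>\<^sub>M X" by simp
    have "Measurable.pred X (\<lambda>y. i \<in> H (s y))" for i
      using measurable_compose[OF s(1) Ha(1)[rule_format, of i]] .
    moreover have "Measurable.pred X (\<lambda>y. f i y = y)" for i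
      using pred_eq_of_separating[OF V f \<open>id \<in> X \<rightarrow>\<^sub>M X\<close>] by simp
    ultimately have "Measurable.pred X (\<lambda>y. \<exists>i. i \<in> H (s y) \<and> f i y = y)" by measurable
    then show "Y \<in> sets X" by (simp add: Y_def pred_def)
    show "infinite_complete_section X E Y"
      unfolding infinite_complete_section_def
    proof (intro conjI ballI)
      show "Y \<subseteq> space X" by (auto simp: Y_def)
      show "infinite (Y \<inter> E `` {x})" if x: "x \<in> space X" for x
        unfolding Y_cls[OF x] using H(2)[OF sX[OF x]] finite_imageD[OF _ inj_s[OF x]] by blast
    qed
    show "monochromatic X E n k c Y"
      unfolding monochromatic_def
    proof (intro ballI)
      fix x assume x: "x \<in> space X"
      note Hs = H[OF sX[OF x]]
      show "\<exists>a\<in>{1..k}. \<forall>A\<in>nsets Y n. A \<subseteq> E `` {x} \<longrightarrow> c A = a"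
      proof (rule bexI[OF _ Hs(3)], intro ballI impI)
        fix A assume A: "A \<in> nsets Y n" "A \<subseteq> E `` {x}"
        then have "A \<subseteq> (\<lambda>i. f i x) ` H (s x)" using Y_cls[OF x] by (auto simp: nsets_def)
        then obtain A' where A': "A' \<subseteq> H (s x)" "A = (\<lambda>i. f i x) ` A'" by (auto simp: subset_image_iff)
        have inj: "inj_on (\<lambda>i. f i x) A'" by (rule inj_on_subset[OF inj_s[OF x] A'(1)])
        have "A' \<in> nsets (H (s x)) n"
          using A(1) A' inj card_image[OF inj] finite_imageD[OF _ inj] by (auto simp: nsets_def)
        then have "d (s x) A' = a (s x)" by (rule Hs(4))
        moreover have "d (s x) A' = c A"
          using A' Hs(1) by (auto simp: d_def fs[OF x])
        ultimately show "c A = a (s x)" by simp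
      qed
    qed
  qed
qed

text \<open>A single weak instance already yields smoothness, smoothness yields every strong
  instance, and each strong instance yields the weak one, so the conditions form a cycle. Taking
  \<open>n = k = 2\<close> leads from the universal conditions to the existential ones.\<close>

theorem theorem1p3:
  fixes X :: "'a measure" and E :: "('a \<times> 'a) set"
  assumes "standard_borel X"
    and "countable_borel_equiv X E"
    and "aperiodic X E"
  shows "((\<exists>n k. n > 1 \<and> k > 1 \<and> borel_ramsey X E n k) \<longleftrightarrow>
            (\<forall>n k. n > 1 \<longrightarrow> k > 1 \<longrightarrow> borel_ramsey X E n k)) \<and>
         ((\<forall>n k. n > 1 \<longrightarrow> k > 1 \<longrightarrow> borel_ramsey X E n k) \<longleftrightarrow>
            (\<exists>n k. n > 1 \<and> k > 1 \<and> weak_borel_ramsey X E n k)) \<and>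
         ((\<exists>n k. n > 1 \<and> k > 1 \<and> weak_borel_ramsey X E n k) \<longleftrightarrow>
            (\<forall>n k. n > 1 \<longrightarrow> k > 1 \<longrightarrow> weak_borel_ramsey X E n k)) \<and>
         ((\<forall>n k. n > 1 \<longrightarrow> k > 1 \<longrightarrow> weak_borel_ramsey X E n k) \<longleftrightarrow> smooth X E)"
proof -
  have strong: "borel_ramsey X E n k" if "smooth X E" for n k
    using borel_ramsey_of_smooth[OF assms that] .
  have "infinite_complete_section X E Y \<Longrightarrow> complete_section X E Y" for Y
    unfolding infinite_complete_section_def complete_section_def by (metis finite.emptyI)
  then have weak: "weak_borel_ramsey X E n k" if "borel_ramsey X E n k" for n k
    using that unfolding borel_ramsey_def weak_borel_ramsey_def by blast
  have smooth: "smooth X E" if "n > 1" "k > 1" "weak_borel_ramsey X E n k" for n k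
    by (rule smooth_of_weak_borel_ramsey[OF assms(1,2) that])
  have two: "(1::nat) < 2" by simp
  show ?thesis using strong weak smooth two by metis
qed

end
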